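(* Let $\mathbf{M}$ be an $m$-symmetric Hunt process on $E$ whose Dirichlet form $(\mathcal{E},\mathcal{F})$ is regular on $L^2(E;m)$, and assume that $\mathbf{M}$ has no killing measure, is transient, irreducible and strong Feller (conditions (i)–(iv) spelled out in the context). Let $\mu\in S_1$, let $\{A_t^\mu\}_{t\ge 0}\in\mathbf{A}_{c,1}^+$ be in the Revuz correspondence with $\mu$, and let $g^\mu(x)=E_x[e^{-A_\zeta^\mu}]$ for $x\in E$. Assume that (a) $\mathbf{M}$ is conservative and the function $h^\mu(x)=P_x(A_\infty^\mu<\infty)$, $x\in E$, is constant on $E$; (b) $\displaystyle\lim_{x\to\Delta}\int_E G(x,y)g^\mu(y)\,\mu(\mathrm{d}y)=0$; (c) there exists $x_0\in E$ such that $\int_E G(x_0,y)\,\mu(\mathrm{d}y)=\infty$ and $\int_K G(x_0,y)\,\mu(\mathrm{d}y)<\infty$ for every compact set $K\subset E$. Then $P_x(A_\infty^\mu=\infty)=1$ for every $x\in E$.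
   Context: $E$ is a locally compact separable metric space that is not compact, $E_\Delta=E\cup\{\Delta\}$ is its one-point compactification, and $m$ is a positive Radon measure on $E$ with full support. $\mathbf{M}=(\Omega,\{X_t\}_{t\ge0},\{P_x\}_{x\in E},\{\mathcal{F}_t\}_{t\ge0},\{\theta_t\}_{t\ge0},\zeta)$ is an $m$-symmetric Hunt process on $E$ with cemetery $\Delta$, minimal completed admissible filtration $\{\mathcal{F}_t\}$, shifts $\theta_t$ and lifetime $\zeta=\inf\{t>0: X_t=\Delta\}$. Functions on $E$ are extended by $0$ at $\Delta$. $\mathbf{M}$ is conservative if $P_x(\zeta=\infty)=1$ for all $x\in E$. The limit $x\to\Delta$ is in the topology of $E_\Delta$. $\mathcal{B}^+(E)$ and $\mathcal{B}_b(E)$ denote the non-negative and the bounded Borel functions on $E$. The semigroup and resolvent are $p_tf(x)=E_x[f(X_t);t<\zeta]$ and $G_\alpha f(x)=\int_0^\infty e^{-\alpha t}p_tf(x)\,\mathrm{d}t$. $(\mathcal{E},\mathcal{F})$ is the associated Dirichlet form on $L^2(E;m)$, assumed regular; for $u,v\in\mathcal{F}\cap C_0(E)$ ($C_0(E)$: continuous functions with compact support) it has the Beurling–Deny expression $$\mathcal{E}(u,v)=\mathcal{E}^{(c)}(u,v)+\iint_{E\times E\setminus\mathrm{diag}}(u(x)-u(y))(v(x)-v(y))\,J(\mathrm{d}x,\mathrm{d}y)+\int_E uv\,\mathrm{d}k,$$ with $\mathcal{E}^{(c)}$ strongly local, $J$ the symmetric jumping measure and $k$ the killing measure. Standing assumptions: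 (i) $k=0$; (ii) (transience) there is a Borel $g\in L^1(E;m)$ with $g>0$ $m$-a.e. and $\int_0^\infty p_tg\,\mathrm{d}t<\infty$ $m$-a.e.; (iii) (irreducibility) if a Borel set $A$ satisfies $p_t(\mathbf{1}_Af)=\mathbf{1}_Ap_tf$ $m$-a.e. for all bounded Borel $f\in L^2(E;m)$ and $t>0$, then $m(A)=0$ or $m(E\setminus A)=0$; (iv) (strong Feller) $p_tf$ is bounded and continuous on $E$ for all $f\in\mathcal{B}_b(E)$ and $t>0$. By (iv), $p_t(x,\mathrm{d}y)=p_t(x,y)\,m(\mathrm{d}y)$ for all $t>0$, $x\in E$. For $\alpha\ge0$, $G_\alpha(x,y)=\int_0^\infty e^{-\alpha t}p_t(x,y)\,\mathrm{d}t$ denotes the non-negative, jointly measurable, symmetric resolvent kernel, $\alpha$-excessive in each variable, with $G_\alpha f(x)=\int_E G_\alpha(x,y)f(y)\,m(\mathrm{d}y)$ for $f\in\mathcal{B}^+(E)$ and $x\in E$; $G(x,y)=G_0(x,y)$. For a measure $\mu$, $G_\alpha\mu(x)=\int_E G_\alpha(x,y)\,\mu(\mathrm{d}y)$. $S_0$ is the set of positive Radon measures $\mu$ on $E$ with $\iint G_1(x,y)\,\mu(\mathrm{d}x)\mu(\mathrm{d}y)<\infty$; $S_{00}=\{\mu\in S_0:\mu(E)<\infty,\ \sup_{x\in E}G_1\mu(x)<\infty\}$. $S_1$ (smooth measures in the strict sense) is the set of positive Borel measures $\mu$ on $E$ for which there are Borel sets $B_n\uparrow E$ with $\mathbf{1}_{B_n}\cdot\mu\in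 S_{00}$ for every $n$ and $P_x(\lim_n\sigma_{E\setminus B_n}\ge\zeta)=1$ for all $x\in E$, where $\sigma_B=\inf\{t>0:X_t\in B\}$. $\mathbf{A}_{c,1}^+$ is the family of positive continuous additive functionals in the strict sense: $\{\mathcal{F}_t\}$-adapted $[0,\infty]$-valued $\{A_t\}$ with a defining set $\Lambda$ such that $P_x(\Lambda)=1$ for all $x\in E$, $\theta_t\Lambda\subset\Lambda$, and on $\Lambda$: $A_0=0$, $t\mapsto A_t$ is continuous, $A_t<\infty$ for $t<\zeta$, $A_t=A_\zeta$ for $t\ge\zeta$, $A_{t+s}=A_t+A_s\circ\theta_t$. $S_1$ and $\mathbf{A}_{c,1}^+$ (up to equivalence) are in one-to-one Revuz correspondence: $\mu\leftrightarrow\{A_t\}$ when for all $\alpha\ge0$ and $f,h\in\mathcal{B}^+(E)$, $\int_E E_x[\int_0^\infty e^{-\alpha t}f(X_t)\,\mathrm{d}A_t]h(x)\,m(\mathrm{d}x)=\int_E G_\alpha h(x)f(x)\,\mu(\mathrm{d}x)$. Convention $e^{-\infty}=0$; $A_\infty=\lim_{t\to\infty}A_t$. *)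

theory Defs
  imports "HOL-Probability.Probability"
begin

section \<open>State space\<close>

text \<open>
  The state space \<open>E\<close> is the universe of a type \<open>'a\<close>. The one-point compactification lives on
  \<open>'a option\<close>, with \<^const>\<open>None\<close> as the cemetery.
\<close>

definition cpt_top :: "'a::topological_space option topology" where
  "cpt_top = Alexandroff_compactification euclidean"

definition cpt_borel :: "'a::topological_space option measure" where
  "cpt_borel = sigma UNIV {U. openin cpt_top U}"

definition ext0 :: "('a \<Rightarrow> 'b::zero) \<Rightarrow> 'a option \<Rightarrow> 'b" where
  "ext0 f z = (case z of None \<Rightarrow> 0 | Some x \<Rightarrow> f x)"

definition radon_measure :: "'a::topological_space measure \<Rightarrow> bool" where
  "radon_measure \<mu> \<longleftrightarrow> sets \<mu> = sets borel \<and> (\<forall>K. compact K \<longrightarrow> emeasure \<mu> K < \<infinity>)"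

definition full_support :: "'a::topological_space measure \<Rightarrow> bool" where
  "full_support \<mu> \<longleftrightarrow> (\<forall>U. open U \<and> U \<noteq> {} \<longrightarrow> 0 < emeasure \<mu> U)"


section \<open>Hunt processes\<close>

text \<open>
  Paths are \<open>X :: real \<Rightarrow> 'w \<Rightarrow> 'a option\<close>; only times \<open>t \<ge> 0\<close> are ever used. Random times and the
  index of the filtrations range over \<open>[0,\<infinity>]\<close>, i.e. \<^typ>\<open>ennreal\<close>, so that \<^const>\<open>stopping_time\<close>
  applies and the filtration at \<open>\<infinity>\<close> is included.
\<close>

definition lifetime :: "(real \<Rightarrow> 'w \<Rightarrow> 'a option) \<Rightarrow> 'w \<Rightarrow> ennreal" where
  "lifetime X \<omega> = Inf {ennreal t | t. 0 < t \<and> X t \<omega> = None}"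

definition hitting_time :: "(real \<Rightarrow> 'w \<Rightarrow> 'a option) \<Rightarrow> 'a set \<Rightarrow> 'w \<Rightarrow> ennreal" where
  "hitting_time X B \<omega> = Inf {ennreal t | t. 0 < t \<and> X t \<omega> \<in> Some ` B}"

definition natural_filtration ::
    "(real \<Rightarrow> 'w \<Rightarrow> 'a::topological_space option) \<Rightarrow> ennreal \<Rightarrow> 'w measure" where
  "natural_filtration X t =
     sigma UNIV {X s -` B | s B. 0 \<le> s \<and> ennreal s \<le> t \<and> B \<in> sets cpt_borel}"

text \<open>
  Each \<open>P x\<close> is a measure on the \<open>\<sigma>\<close>-algebra generated by all \<open>X t\<close>. For an initial law \<open>\<nu>\<close> on \<open>E\<close>
  the measure \<open>P\<^sub>\<nu>(\<Lambda>) = \<integral> P x \<Lambda> \<nu>(dx)\<close> is \<^term>\<open>bind \<nu> P\<close>. The minimal completed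
  admissible filtration is the intersection over all \<open>\<nu>\<close> of the \<open>P\<^sub>\<nu>\<close>-augmentations.
\<close>

definition completed_filtration ::
    "('a::topological_space \<Rightarrow> 'w measure) \<Rightarrow> (real \<Rightarrow> 'w \<Rightarrow> 'a option) \<Rightarrow> ennreal \<Rightarrow> 'w measure" where
  "completed_filtration P X t =
     sigma UNIV (\<Inter>\<nu>\<in>space (prob_algebra borel).
       sigma_sets UNIV (sets (natural_filtration X t) \<union> null_sets (completion (bind \<nu> P))))"

text \<open>
  Events of the completed filtration lie in the completion of every \<open>P x\<close>, but in general not in
  \<^term>\<open>sets (P x)\<close>.
\<close>

definition Prob :: "('a \<Rightarrow> 'w measure) \<Rightarrow> 'a \<Rightarrow> 'w set \<Rightarrow> real" where
  "Prob P x \<Lambda> = measure (completion (P x)) \<Lambda>"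

definition Expect :: "('a \<Rightarrow> 'w measure) \<Rightarrow> 'a \<Rightarrow> ('w \<Rightarrow> ennreal) \<Rightarrow> ennreal" where
  "Expect P x Y = (\<integral>\<^sup>+\<omega>. Y \<omega> \<partial>completion (P x))"

text \<open>The law of \<open>X t\<close> when started at a point of \<open>E\<^sub>\<Delta>\<close>; the cemetery is a trap.\<close>

definition law_from ::
    "('a \<Rightarrow> 'w measure) \<Rightarrow> (real \<Rightarrow> 'w \<Rightarrow> 'a option) \<Rightarrow> real \<Rightarrow> 'a option set \<Rightarrow> 'a option \<Rightarrow> ennreal" where
  "law_from P X t B z =
     (case z of None \<Rightarrow> indicator B None | Some y \<Rightarrow> emeasure (P y) (X t -` B))"

text \<open>
  In \<open>strong_markov\<close>, \<open>\<Lambda>\<close> ranges over the \<open>\<sigma>\<close>-algebra of events prior to \<open>\<sigma>\<close>, which expresses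
  \<open>P\<^sub>\<nu>(X\<^sub>\<sigma>\<^sub>+\<^sub>s \<in> B | \<F>\<^sub>\<sigma>) = P\<^bsub>X\<^sub>\<sigma>\<^esub>(X\<^sub>s \<in> B)\<close> on \<open>{\<sigma> < \<infinity>}\<close>.
\<close>

locale hunt_process =
  fixes P :: "'a::{metric_space, second_countable_topology} \<Rightarrow> 'w measure"
    and X :: "real \<Rightarrow> 'w \<Rightarrow> 'a option"
    and \<theta> :: "real \<Rightarrow> 'w \<Rightarrow> 'w"
  assumes kernel: "P \<in> borel \<rightarrow>\<^sub>M prob_algebra (natural_filtration X \<infinity>)"
    and normal: "\<And>x. AE \<omega> in P x. X 0 \<omega> = Some x"
    and cemetery: "\<And>t \<omega>. 0 \<le> t \<Longrightarrow> lifetime X \<omega> \<le> ennreal t \<Longrightarrow> X t \<omega> = None"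
    and shift: "\<And>s t \<omega>. 0 \<le> s \<Longrightarrow> 0 \<le> t \<Longrightarrow> X s (\<theta> t \<omega>) = X (s + t) \<omega>"
    and right_continuous:
      "\<And>t \<omega>. 0 \<le> t \<Longrightarrow> limitin cpt_top (\<lambda>s. X s \<omega>) (X t \<omega>) (at_right t)"
    and left_limits:
      "\<And>t \<omega>. 0 < t \<Longrightarrow> \<exists>z. limitin cpt_top (\<lambda>s. X s \<omega>) z (at_left t)"
    and filtration_right_continuous:
      "\<And>t. t < \<infinity> \<Longrightarrow>
        sets (completed_filtration P X t) = (\<Inter>u\<in>{t<..}. sets (completed_filtration P X u))"
    and strong_markov:
      "\<And>\<nu> \<sigma> \<Lambda> s B.
        \<nu> \<in> space (prob_algebra borel) \<Longrightarrow>
        stopping_time (completed_filtration P X) \<sigma> \<Longrightarrow>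
        (\<And>t. {\<omega>\<in>\<Lambda>. \<sigma> \<omega> \<le> t} \<in> sets (completed_filtration P X t)) \<Longrightarrow>
        0 \<le> s \<Longrightarrow> B \<in> sets cpt_borel \<Longrightarrow>
        emeasure (completion (bind \<nu> P)) {\<omega>\<in>\<Lambda>. \<sigma> \<omega> < \<infinity> \<and> X (enn2real (\<sigma> \<omega>) + s) \<omega> \<in> B} =
        (\<integral>\<^sup>+\<omega>\<in>{\<omega>\<in>\<Lambda>. \<sigma> \<omega> < \<infinity>}. law_from P X s B (X (enn2real (\<sigma> \<omega>)) \<omega>) \<partial>completion (bind \<nu> P))"
    and quasi_left_continuous:
      "\<And>\<nu> \<sigma>\<^sub>n \<sigma>.
        \<nu> \<in> space (prob_algebra borel) \<Longrightarrow>
        (\<And>n::nat. stopping_time (completed_filtration P X) (\<sigma>\<^sub>n n)) \<Longrightarrow>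
        (\<And>\<omega>. incseq (\<lambda>n. \<sigma>\<^sub>n n \<omega>)) \<Longrightarrow>
        (\<And>\<omega>. \<sigma> \<omega> = (SUP n. \<sigma>\<^sub>n n \<omega>)) \<Longrightarrow>
        AE \<omega> in bind \<nu> P. \<sigma> \<omega> < \<infinity> \<longrightarrow>
          limitin cpt_top (\<lambda>n. X (enn2real (\<sigma>\<^sub>n n \<omega>)) \<omega>) (X (enn2real (\<sigma> \<omega>)) \<omega>) sequentially"

definition conservative :: "('a \<Rightarrow> 'w measure) \<Rightarrow> (real \<Rightarrow> 'w \<Rightarrow> 'a option) \<Rightarrow> bool" where
  "conservative P X \<longleftrightarrow> (\<forall>x. Prob P x {\<omega>. lifetime X \<omega> = \<infinity>} = 1)"


section \<open>Semigroup, resolvent and resolvent kernel\<close>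

text \<open>
  \<open>trans_nn\<close> is the semigroup on \<open>[0,\<infinity>]\<close>-valued functions, \<open>trans_op\<close> on real-valued ones (the
  Bochner integral defaults to \<open>0\<close> where \<open>f (X t)\<close> is not integrable, which for \<open>f \<in> L\<^sup>2(m)\<close> happens
  only on an \<open>m\<close>-null set of starting points).
\<close>

definition trans_nn ::
    "('a \<Rightarrow> 'w measure) \<Rightarrow> (real \<Rightarrow> 'w \<Rightarrow> 'a option) \<Rightarrow> real \<Rightarrow> ('a \<Rightarrow> ennreal) \<Rightarrow> 'a \<Rightarrow> ennreal" where
  "trans_nn P X t f x = (\<integral>\<^sup>+\<omega>\<in>{\<omega>. ennreal t < lifetime X \<omega>}. ext0 f (X t \<omega>) \<partial>P x)"

definition trans_op ::
    "('a \<Rightarrow> 'w measure) \<Rightarrow> (real \<Rightarrow> 'w \<Rightarrow> 'a option) \<Rightarrow> real \<Rightarrow> ('a \<Rightarrow> real) \<Rightarrow> 'a \<Rightarrow> real" where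
  "trans_op P X t f x = (LINT \<omega>:{\<omega>. ennreal t < lifetime X \<omega>}|P x. ext0 f (X t \<omega>))"

definition resolvent ::
    "('a \<Rightarrow> 'w measure) \<Rightarrow> (real \<Rightarrow> 'w \<Rightarrow> 'a option) \<Rightarrow> real \<Rightarrow> ('a \<Rightarrow> ennreal) \<Rightarrow> 'a \<Rightarrow> ennreal" where
  "resolvent P X \<alpha> f x =
     (\<integral>\<^sup>+t\<in>{0..}. ennreal (exp (- \<alpha> * t)) * trans_nn P X t f x \<partial>lborel)"

definition m_symmetric ::
    "'a::topological_space measure \<Rightarrow> ('a \<Rightarrow> 'w measure) \<Rightarrow> (real \<Rightarrow> 'w \<Rightarrow> 'a option) \<Rightarrow> bool" where
  "m_symmetric m P X \<longleftrightarrow>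
     (\<forall>t\<ge>0. \<forall>f\<in>borel_measurable borel. \<forall>g\<in>borel_measurable borel.
        (\<integral>\<^sup>+x. trans_nn P X t f x * g x \<partial>m) = (\<integral>\<^sup>+x. f x * trans_nn P X t g x \<partial>m))"

definition transient ::
    "'a::topological_space measure \<Rightarrow> ('a \<Rightarrow> 'w measure) \<Rightarrow> (real \<Rightarrow> 'w \<Rightarrow> 'a option) \<Rightarrow> bool" where
  "transient m P X \<longleftrightarrow>
     (\<exists>g::'a \<Rightarrow> real. g \<in> borel_measurable borel \<and> integrable m g \<and> (AE x in m. 0 < g x) \<and>
        (AE x in m. resolvent P X 0 (\<lambda>y. ennreal (g y)) x < \<infinity>))"

definition square_integrable :: "'a::topological_space measure \<Rightarrow> ('a \<Rightarrow> real) set" where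
  "square_integrable m = {u \<in> borel_measurable borel. integrable m (\<lambda>x. (u x)\<^sup>2)}"

definition irreducible_process ::
    "'a::topological_space measure \<Rightarrow> ('a \<Rightarrow> 'w measure) \<Rightarrow> (real \<Rightarrow> 'w \<Rightarrow> 'a option) \<Rightarrow> bool" where
  "irreducible_process m P X \<longleftrightarrow>
     (\<forall>A\<in>sets borel.
        (\<forall>f\<in>square_integrable m. bounded (range f) \<longrightarrow>
           (\<forall>t>0. AE x in m. trans_op P X t (\<lambda>y. indicator A y * f y) x = indicator A x * trans_op P X t f x))
        \<longrightarrow> emeasure m A = 0 \<or> emeasure m (- A) = 0)"

definition strong_feller ::
    "('a::topological_space \<Rightarrow> 'w measure) \<Rightarrow> (real \<Rightarrow> 'w \<Rightarrow> 'a option) \<Rightarrow> bool" where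
  "strong_feller P X \<longleftrightarrow>
     (\<forall>t>0. \<forall>f\<in>borel_measurable borel. bounded (range f) \<longrightarrow>
        bounded (range (trans_op P X t f)) \<and> continuous_on UNIV (trans_op P X t f))"

definition excessive ::
    "('a::topological_space \<Rightarrow> 'w measure) \<Rightarrow> (real \<Rightarrow> 'w \<Rightarrow> 'a option) \<Rightarrow> real \<Rightarrow> ('a \<Rightarrow> ennreal) \<Rightarrow> bool" where
  "excessive P X \<alpha> u \<longleftrightarrow>
     u \<in> borel_measurable borel \<and>
     (\<forall>x. \<forall>t>0. ennreal (exp (- \<alpha> * t)) * trans_nn P X t u x \<le> u x) \<and>
     (\<forall>x. ((\<lambda>t. ennreal (exp (- \<alpha> * t)) * trans_nn P X t u x) \<longlongrightarrow> u x) (at_right 0))"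

definition green :: "(real \<Rightarrow> 'a \<Rightarrow> 'a \<Rightarrow> ennreal) \<Rightarrow> real \<Rightarrow> 'a \<Rightarrow> 'a \<Rightarrow> ennreal" where
  "green p \<alpha> x y = (\<integral>\<^sup>+t\<in>{0<..}. ennreal (exp (- \<alpha> * t)) * p t x y \<partial>lborel)"

definition green_potential ::
    "(real \<Rightarrow> 'a \<Rightarrow> 'a \<Rightarrow> ennreal) \<Rightarrow> real \<Rightarrow> 'a measure \<Rightarrow> 'a \<Rightarrow> ennreal" where
  "green_potential p \<alpha> \<mu> x = (\<integral>\<^sup>+y. green p \<alpha> x y \<partial>\<mu>)"

text \<open>
  \<open>p t x y\<close> is a transition density with respect to \<open>m\<close>, in a version for which the resolvent kernels
  are jointly measurable, symmetric and \<open>\<alpha>\<close>-excessive in each variable.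
\<close>

definition transition_density ::
    "'a::topological_space measure \<Rightarrow> ('a \<Rightarrow> 'w measure) \<Rightarrow> (real \<Rightarrow> 'w \<Rightarrow> 'a option) \<Rightarrow>
     (real \<Rightarrow> 'a \<Rightarrow> 'a \<Rightarrow> ennreal) \<Rightarrow> bool" where
  "transition_density m P X p \<longleftrightarrow>
     (\<forall>t>0. \<forall>x. p t x \<in> borel_measurable borel \<and>
        (\<forall>f\<in>borel_measurable borel. trans_nn P X t f x = (\<integral>\<^sup>+y. p t x y * f y \<partial>m))) \<and>
     (\<forall>x y. (\<lambda>t. p t x y) \<in> borel_measurable (restrict_space borel {0<..})) \<and>
     (\<forall>\<alpha>\<ge>0.
        (\<lambda>(x, y). green p \<alpha> x y) \<in> borel_measurable (borel \<Otimes>\<^sub>M borel) \<and>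
        (\<forall>x y. green p \<alpha> x y = green p \<alpha> y x) \<and>
        (\<forall>y. excessive P X \<alpha> (\<lambda>x. green p \<alpha> x y)) \<and>
        (\<forall>x. excessive P X \<alpha> (\<lambda>y. green p \<alpha> x y)) \<and>
        (\<forall>f\<in>borel_measurable borel. \<forall>x. resolvent P X \<alpha> f x = (\<integral>\<^sup>+y. green p \<alpha> x y * f y \<partial>m)))"


section \<open>The Dirichlet form\<close>

text \<open>\<open>approx_form\<close> is \<open>(u - p\<^sub>t u, v)/t\<close>; the form is its limit as \<open>t\<close> decreases to \<open>0\<close>.\<close>

definition approx_form ::
    "'a measure \<Rightarrow> ('a \<Rightarrow> 'w measure) \<Rightarrow> (real \<Rightarrow> 'w \<Rightarrow> 'a option) \<Rightarrow> real \<Rightarrow>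
     ('a \<Rightarrow> real) \<Rightarrow> ('a \<Rightarrow> real) \<Rightarrow> real" where
  "approx_form m P X t u v = (LINT x|m. (u x - trans_op P X t u x) * v x) / t"

definition form_domain ::
    "'a::topological_space measure \<Rightarrow> ('a \<Rightarrow> 'w measure) \<Rightarrow> (real \<Rightarrow> 'w \<Rightarrow> 'a option) \<Rightarrow> ('a \<Rightarrow> real) set" where
  "form_domain m P X =
     {u \<in> square_integrable m. \<exists>l. ((\<lambda>t. approx_form m P X t u u) \<longlongrightarrow> l) (at_right 0)}"

definition dirichlet_form ::
    "'a measure \<Rightarrow> ('a \<Rightarrow> 'w measure) \<Rightarrow> (real \<Rightarrow> 'w \<Rightarrow> 'a option) \<Rightarrow>
     ('a \<Rightarrow> real) \<Rightarrow> ('a \<Rightarrow> real) \<Rightarrow> real" where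
  "dirichlet_form m P X u v = Lim (at_right 0) (\<lambda>t. approx_form m P X t u v)"

definition supp :: "('a::topological_space \<Rightarrow> real) \<Rightarrow> 'a set" where
  "supp u = closure {x. u x \<noteq> 0}"

definition C0 :: "('a::topological_space \<Rightarrow> real) set" where
  "C0 = {u. continuous_on UNIV u \<and> compact (supp u)}"

definition regular_form ::
    "'a::topological_space measure \<Rightarrow> ('a \<Rightarrow> 'w measure) \<Rightarrow> (real \<Rightarrow> 'w \<Rightarrow> 'a option) \<Rightarrow> bool" where
  "regular_form m P X \<longleftrightarrow>
     (\<forall>u\<in>form_domain m P X. \<forall>\<epsilon>>0. \<exists>v\<in>form_domain m P X \<inter> C0.
        dirichlet_form m P X (\<lambda>x. u x - v x) (\<lambda>x. u x - v x) + (LINT x|m. (u x - v x)\<^sup>2) < \<epsilon>) \<and>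
     (\<forall>u\<in>C0. \<forall>\<epsilon>>0. \<exists>v\<in>form_domain m P X \<inter> C0. \<forall>x. \<bar>u x - v x\<bar> < \<epsilon>)"

definition symmetric_form_on ::
    "('a \<Rightarrow> real) set \<Rightarrow> (('a \<Rightarrow> real) \<Rightarrow> ('a \<Rightarrow> real) \<Rightarrow> real) \<Rightarrow> bool" where
  "symmetric_form_on D \<E> \<longleftrightarrow>
     (\<forall>u\<in>D. \<forall>v\<in>D. \<E> u v = \<E> v u) \<and>
     (\<forall>u\<in>D. \<forall>v\<in>D. \<forall>w\<in>D. \<E> (\<lambda>x. u x + v x) w = \<E> u w + \<E> v w) \<and>
     (\<forall>c. \<forall>u\<in>D. \<forall>v\<in>D. \<E> (\<lambda>x. c * u x) v = c * \<E> u v) \<and>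
     (\<forall>u\<in>D. 0 \<le> \<E> u u)"

definition strongly_local_on ::
    "('a::topological_space \<Rightarrow> real) set \<Rightarrow> (('a \<Rightarrow> real) \<Rightarrow> ('a \<Rightarrow> real) \<Rightarrow> real) \<Rightarrow> bool" where
  "strongly_local_on D \<E> \<longleftrightarrow>
     (\<forall>u\<in>D. \<forall>v\<in>D. (\<exists>U c. open U \<and> supp u \<subseteq> U \<and> (\<forall>x\<in>U. v x = c)) \<longrightarrow> \<E> u v = 0)"

definition off_diagonal :: "('a \<times> 'a) set" where
  "off_diagonal = {(x, y). x \<noteq> y}"

text \<open>The Beurling--Deny decomposition; it determines \<open>\<E>\<^sub>c\<close> (on its domain), \<open>J\<close> and \<open>k\<close> uniquely.\<close>

definition beurling_deny ::
    "'a::topological_space measure \<Rightarrow> ('a \<Rightarrow> 'w measure) \<Rightarrow> (real \<Rightarrow> 'w \<Rightarrow> 'a option) \<Rightarrow>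
     (('a \<Rightarrow> real) \<Rightarrow> ('a \<Rightarrow> real) \<Rightarrow> real) \<Rightarrow> ('a \<times> 'a) measure \<Rightarrow> 'a measure \<Rightarrow> bool" where
  "beurling_deny m P X \<E>\<^sub>c J k \<longleftrightarrow>
     (let D = form_domain m P X \<inter> C0 in
        symmetric_form_on D \<E>\<^sub>c \<and> strongly_local_on D \<E>\<^sub>c \<and>
        space J = off_diagonal \<and> sets J = sets (restrict_space borel off_diagonal) \<and>
        (\<forall>K. compact K \<and> K \<subseteq> off_diagonal \<longrightarrow> emeasure J K < \<infinity>) \<and>
        distr J J prod.swap = J \<and>
        radon_measure k \<and>
        (\<forall>u\<in>D. integrable J (\<lambda>(x, y). (u x - u y)\<^sup>2)) \<and>
        (\<forall>u\<in>D. \<forall>v\<in>D. dirichlet_form m P X u v =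
            \<E>\<^sub>c u v + (LINT (x, y)|J. (u x - u y) * (v x - v y)) + (LINT x|k. u x * v x)))"


section \<open>Smooth measures and additive functionals\<close>

definition S0 :: "(real \<Rightarrow> 'a \<Rightarrow> 'a \<Rightarrow> ennreal) \<Rightarrow> 'a::topological_space measure set" where
  "S0 p = {\<mu>. radon_measure \<mu> \<and> (\<integral>\<^sup>+x. (\<integral>\<^sup>+y. green p 1 x y \<partial>\<mu>) \<partial>\<mu>) < \<infinity>}"

definition S00 :: "(real \<Rightarrow> 'a \<Rightarrow> 'a \<Rightarrow> ennreal) \<Rightarrow> 'a::topological_space measure set" where
  "S00 p = {\<mu> \<in> S0 p. emeasure \<mu> UNIV < \<infinity> \<and> (SUP x. green_potential p 1 \<mu> x) < \<infinity>}"

definition S1 ::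
    "('a \<Rightarrow> 'w measure) \<Rightarrow> (real \<Rightarrow> 'w \<Rightarrow> 'a option) \<Rightarrow> (real \<Rightarrow> 'a \<Rightarrow> 'a \<Rightarrow> ennreal) \<Rightarrow>
     'a::topological_space measure set" where
  "S1 P X p = {\<mu>. sets \<mu> = sets borel \<and>
     (\<exists>B :: nat \<Rightarrow> 'a set. (\<forall>n. B n \<in> sets borel) \<and> incseq B \<and> (\<Union>n. B n) = UNIV \<and>
        (\<forall>n. density \<mu> (indicator (B n)) \<in> S00 p) \<and>
        (\<forall>x. Prob P x {\<omega>. lim (\<lambda>n. hitting_time X (- B n) \<omega>) \<ge> lifetime X \<omega>} = 1))}"

text \<open>The value \<open>A\<^sub>\<tau>\<close> at a time \<open>\<tau> \<in> [0,\<infinity>]\<close>, with \<open>A\<^sub>\<infinity>\<close> the limit as \<open>t \<rightarrow> \<infinity>\<close>.\<close>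

definition af_at :: "(real \<Rightarrow> 'w \<Rightarrow> ennreal) \<Rightarrow> ennreal \<Rightarrow> 'w \<Rightarrow> ennreal" where
  "af_at A \<tau> \<omega> = (if \<tau> = \<infinity> then Lim at_top (\<lambda>t. A t \<omega>) else A (enn2real \<tau>) \<omega>)"

definition strict_pcaf ::
    "('a::topological_space \<Rightarrow> 'w measure) \<Rightarrow> (real \<Rightarrow> 'w \<Rightarrow> 'a option) \<Rightarrow> (real \<Rightarrow> 'w \<Rightarrow> 'w) \<Rightarrow>
     (real \<Rightarrow> 'w \<Rightarrow> ennreal) set" where
  "strict_pcaf P X \<theta> = {A.
     (\<forall>t\<ge>0. A t \<in> borel_measurable (completed_filtration P X (ennreal t))) \<and>
     (\<exists>\<Lambda>\<in>sets (completed_filtration P X \<infinity>).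
        (\<forall>x. Prob P x \<Lambda> = 1) \<and>
        (\<forall>t\<ge>0. \<theta> t ` \<Lambda> \<subseteq> \<Lambda>) \<and>
        (\<forall>\<omega>\<in>\<Lambda>.
           A 0 \<omega> = 0 \<and>
           continuous_on {0..} (\<lambda>t. A t \<omega>) \<and>
           (\<forall>t\<ge>0. ennreal t < lifetime X \<omega> \<longrightarrow> A t \<omega> < \<infinity>) \<and>
           (\<forall>t\<ge>0. lifetime X \<omega> \<le> ennreal t \<longrightarrow> A t \<omega> = af_at A (lifetime X \<omega>) \<omega>) \<and>
           (\<forall>t\<ge>0. \<forall>s\<ge>0. A (t + s) \<omega> = A t \<omega> + A s (\<theta> t \<omega>))))}"

text \<open>
  The Stieltjes integral of \<open>\<phi>\<close> against \<open>dA\<^sub>t\<close> over \<open>[0,\<zeta>)\<close>. As \<open>A\<close> may be infinite from \<open>\<zeta>\<close> on,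
  it is the supremum over \<open>T < \<zeta>\<close> of the integrals over \<open>[0,T]\<close>. Integrands of the form
  \<open>e\<^bsup>-\<alpha>t\<^esup> f(X\<^sub>t)\<close> vanish on \<open>[\<zeta>,\<infinity>)\<close>, so nothing is lost there.
\<close>

definition af_integral ::
    "(real \<Rightarrow> 'w \<Rightarrow> 'a option) \<Rightarrow> (real \<Rightarrow> 'w \<Rightarrow> ennreal) \<Rightarrow> (real \<Rightarrow> ennreal) \<Rightarrow> 'w \<Rightarrow> ennreal" where
  "af_integral X A \<phi> \<omega> =
     (SUP T\<in>{T. 0 \<le> T \<and> ennreal T < lifetime X \<omega>}.
        \<integral>\<^sup>+t. \<phi> t \<partial>interval_measure (\<lambda>s. enn2real (A (max 0 (min s T)) \<omega>)))"

definition revuz_correspondence ::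
    "'a::topological_space measure \<Rightarrow> ('a \<Rightarrow> 'w measure) \<Rightarrow> (real \<Rightarrow> 'w \<Rightarrow> 'a option) \<Rightarrow>
     'a measure \<Rightarrow> (real \<Rightarrow> 'w \<Rightarrow> ennreal) \<Rightarrow> bool" where
  "revuz_correspondence m P X \<mu> A \<longleftrightarrow>
     (\<forall>\<alpha>\<ge>0. \<forall>f\<in>borel_measurable borel. \<forall>h\<in>borel_measurable borel.
        (\<integral>\<^sup>+x. Expect P x
            (\<lambda>\<omega>. af_integral X A (\<lambda>t. ennreal (exp (- \<alpha> * t)) * ext0 f (X t \<omega>)) \<omega>) * h x \<partial>m) =
        (\<integral>\<^sup>+x. resolvent P X \<alpha> h x * f x \<partial>\<mu>))"

definition exp_neg :: "ennreal \<Rightarrow> ennreal" where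
  "exp_neg a = (if a = \<infinity> then 0 else ennreal (exp (- enn2real a)))"

text \<open>The function \<open>g\<^sup>\<mu>(x) = E\<^sub>x[exp (-A\<^sub>\<zeta>)]\<close>.\<close>

definition laplace_total ::
    "('a \<Rightarrow> 'w measure) \<Rightarrow> (real \<Rightarrow> 'w \<Rightarrow> 'a option) \<Rightarrow> (real \<Rightarrow> 'w \<Rightarrow> ennreal) \<Rightarrow> 'a \<Rightarrow> ennreal" where
  "laplace_total P X A x = Expect P x (\<lambda>\<omega>. exp_neg (af_at A (lifetime X \<omega>) \<omega>))"

end

theory Submission
  imports Defs
begin

text \<open>
  Let \<open>g(x) = E\<^sub>x[exp (-A\<^sub>\<infinity>)]\<close>. By the zero-one law for shift-invariant events the constant
  \<open>h\<close> is \<open>0\<close> or \<open>1\<close>, and \<open>h = 0\<close> is the claim. If \<open>h = 1\<close>, then \<open>A\<^sub>\<infinity> < \<infinity>\<close> almost surely, and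
  \<open>1 - exp (-A\<^sub>\<infinity>) = \<integral> exp (-(A\<^sub>\<infinity> - A\<^sub>t)) dA\<^sub>t\<close> with the Markov property gives
  \<open>1 - g(x) = E\<^sub>x[\<integral> g(X\<^sub>t) dA\<^sub>t]\<close>, which the Revuz correspondence identifies with
  \<open>\<integral> G(x,y) g(y) \<mu>(dy)\<close>. By (b), \<open>g \<ge> 1/2\<close> off a compact set \<open>K\<close>, so the potential of \<open>\<mu>\<close>
  restricted to the complement of \<open>K\<close> is at most \<open>2\<close>, contradicting (c).

  The identity for \<open>1 - g\<close> needs the Markov property at the times \<open>\<tau>\<^sub>u = inf {t. A\<^sub>t \<ge> u}\<close>, after
  the substitution \<open>u = A\<^sub>t\<close>. Since \<open>p\<^sub>s g\<close> is continuous and decreases to \<open>g\<close> as \<open>s \<down> 0\<close>, it is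
  enough to approximate \<open>\<tau>\<^sub>u\<close> from the right by times in a grid.
\<close>

text \<open>The obstacle is measurability. \<open>A\<close> is adapted only to the completed
  filtration, so exp(-A_\<infinity>) agrees with a functional measurable for the uncompleted
  \<sigma>-algebra only up to a null set that depends on the initial law. At a fixed time t > 0 the
  law of the position is absolutely continuous with respect to m from every starting point, so a
  single version, chosen for an initial law equivalent to m, serves there. At the random time at
  which A reaches level u this argument breaks down: the law of the position may be carried by an
  m-null set, as \<mu> itself may be. Letting a further time s > 0 pass turns g into p_s g, which is
  the same for all versions and continuous by the strong Feller property. This fixes the order of
  the limits: the grid is refined for fixed s, and only then s tends to 0, since g itself need not
  be continuous. A null set matters at the other end as well: the Revuz correspondence identifies
  functions only m-a.e., while (c) concerns a single point.\<close>

section \<open>Topology and Borel sets of the one-point compactification\<close>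

lemma space_cpt_borel [simp]: "space cpt_borel = UNIV"
  by (simp add: cpt_borel_def)

lemma sets_cpt_borel: "sets cpt_borel = sigma_sets UNIV {U. openin cpt_top U}"
  by (simp add: cpt_borel_def)

text \<open>Compact sets are closed in a Hausdorff space, so neighbourhoods of the cemetery are
  simply complements of compact sets.\<close>

lemma openin_cpt_top:
  fixes V :: "'a::t2_space option set"
  shows "openin cpt_top V \<longleftrightarrow>
    (\<exists>U. open U \<and> V = Some ` U) \<or> (\<exists>K. compact K \<and> V = insert None (Some ` (- K)))"
  by (auto simp: cpt_top_def openin_Alexandroff_compactification Compl_eq_Diff_UNIV
      dest: compact_imp_closed)

lemma topspace_cpt_top [simp]: "topspace cpt_top = UNIV"
  by (auto simp: cpt_top_def UNIV_option_conv)

lemma Some_image_cpt [measurable]: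
  fixes U :: "'a::t2_space set"
  assumes "U \<in> sets borel"
  shows "Some ` U \<in> sets cpt_borel"
proof -
  have "U \<in> sigma_sets UNIV {S. open S}"
    using assms by (simp add: borel_def)
  then show ?thesis
  proof induction
    case (Basic U)
    then show ?case by (auto simp: sets_cpt_borel openin_cpt_top intro!: sigma_sets.Basic)
  next
    case (Compl U)
    have "range Some \<in> sets (cpt_borel :: 'a option measure)"
      by (auto simp: sets_cpt_borel openin_cpt_top intro!: sigma_sets.Basic)
    moreover have "Some ` (UNIV - U) = range Some - Some ` U" by auto
    ultimately show ?case using Compl by simp
  next
    case (Union U)
    then show ?case by (simp add: image_UN)
  qed simp
qed

lemma None_cpt [measurable]: "{None} \<in> sets (cpt_borel :: 'a::t2_space option measure)"
proof -
  have "{None} = space cpt_borel - Some ` (UNIV :: 'a set)"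
    by (auto simp: UNIV_option_conv)
  then show ?thesis by (metis sets.compl_sets Some_image_cpt sets.top space_borel)
qed

lemma measurable_the_cpt [measurable]:
  "(the :: 'a::t2_space option \<Rightarrow> 'a) \<in> cpt_borel \<rightarrow>\<^sub>M borel"
proof (rule measurableI)
  fix U :: "'a set" assume [measurable]: "U \<in> sets borel"
  \<comment> \<open>\<open>the None\<close> is an unspecified point, which may or may not lie in
    \<open>U\<close>; hence the case distinction.\<close>
  have "the -` U = Some ` U \<union> (if the None \<in> U then {None} else {})"
    by (auto simp: image_iff) (metis option.exhaust_sel)+
  moreover have "Some ` U \<union> {None} \<in> sets cpt_borel"
    by (intro sets.Un) auto
  ultimately show "the -` U \<inter> space cpt_borel \<in> sets cpt_borel"
    by auto
qed simp

lemma measurable_ext0 [measurable]: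
  fixes f :: "'a::t2_space \<Rightarrow> 'b::{zero, topological_space}"
  assumes [measurable]: "f \<in> borel_measurable borel"
  shows "ext0 f \<in> borel_measurable cpt_borel"
proof -
  have "(\<lambda>z. if z = None then 0 else f (the z)) \<in> borel_measurable cpt_borel"
    by (intro measurable_If) (auto simp: Collect_conv_if)
  moreover have "ext0 f = (\<lambda>z. if z = None then 0 else f (the z))"
    by (auto simp: ext0_def fun_eq_iff split: option.split)
  ultimately show ?thesis by simp
qed

lemma limitin_cpt_top_SomeD:
  fixes f :: "'b \<Rightarrow> 'a::t2_space option"
  assumes "limitin cpt_top f (Some x) F"
  shows "((\<lambda>s. the (f s)) \<longlongrightarrow> x) F"
proof (rule topological_tendstoI)
  fix S :: "'a set" assume "open S" "x \<in> S"
  then have "eventually (\<lambda>s. f s \<in> Some ` S) F"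
    using assms by (auto simp: limitin_def openin_cpt_top)
  then show "eventually (\<lambda>s. the (f s) \<in> S) F"
    by (rule eventually_mono) auto
qed

text \<open>This converts (b), a limit in the compactification, into smallness off a compact set of
  E.\<close>

lemma tendsto_cemetery_compact:
  fixes f :: "'a::t2_space \<Rightarrow> ennreal"
  assumes "(ext0 f \<longlongrightarrow> 0) (atin cpt_top None)" "0 < e"
  obtains K where "compact K" "\<And>x. x \<notin> K \<Longrightarrow> f x < e"
proof -
  have "eventually (\<lambda>z. ext0 f z < e) (atin cpt_top None)"
    using assms by (rule order_tendstoD)
  then obtain U where U: "openin cpt_top U" "None \<in> U" "\<forall>z\<in>U - {None}. ext0 f z < e"
    by (auto simp: eventually_atin)
  then obtain K where "compact K" "U = insert None (Some ` (- K))"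
    by (auto simp: openin_cpt_top)
  with U show ?thesis by (intro that[of K]) (auto simp: ext0_def)
qed

text \<open>Local compactness covers E by open sets lying in compact ones, which have finite mass,
  and the Lindelof property makes the cover countable.\<close>

lemma sigma_finite_radon_measure:
  fixes m :: "'a::{metric_space, second_countable_topology} measure"
  assumes lc: "locally_compact_space (euclidean :: 'a topology)" and m: "radon_measure m"
  shows "sigma_finite_measure m"
proof -
  let ?G = "{U :: 'a set. open U \<and> (\<exists>K. compact K \<and> U \<subseteq> K)}"
  have "\<exists>U\<in>?G. x \<in> U" for x :: 'a
    using lc by (simp add: locally_compact_space_def) blast
  then have un: "\<Union>?G = UNIV" by blast
  obtain G' where G': "G' \<subseteq> ?G" "countable G'" "\<Union>G' = \<Union>?G"
    using Lindelof[of ?G] by auto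
  have sm: "sets m = sets borel" and sp: "space m = UNIV"
    using m sets_eq_imp_space_eq[of m borel] by (auto simp: radon_measure_def)
  have "emeasure m U \<noteq> \<infinity>" if U: "U \<in> G'" for U
  proof -
    obtain K where K: "compact K" "U \<subseteq> K" using U G' by auto
    then have "emeasure m U \<le> emeasure m K"
      by (intro emeasure_mono) (auto simp: sm compact_imp_closed)
    also have "\<dots> < \<infinity>" using m K by (auto simp: radon_measure_def)
    finally show ?thesis by simp
  qed
  then show ?thesis
    using G' un by (intro sigma_finite_measure.intro exI[of _ G']) (auto simp: sm sp)
qed

subsection \<open>Time change of Stieltjes integrals\<close>

text \<open>\<open>r\<close> models a trajectory of A, extended by 0 to negative times. Flat
  stretches are allowed and the range may be bounded, so statements about the inverse are confined
  to levels 0 < u <= r T.\<close>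

locale continuous_clock =
  fixes r :: "real \<Rightarrow> real"
  assumes cont: "continuous_on UNIV r"
    and r_mono: "s \<le> t \<Longrightarrow> r s \<le> r t"
    and r_nonpos: "t \<le> 0 \<Longrightarrow> r t = 0"
begin

text \<open>The first time at which level u is reached. If it is never reached, this is the infimum
  of the empty set and carries no meaning.\<close>

definition clock_inv :: "real \<Rightarrow> real" where
  "clock_inv u = Inf {t. 0 \<le> t \<and> u \<le> r t}"

context
  fixes u T assumes u: "0 < u" "u \<le> r T"
begin

lemma clock_set: "{t. 0 \<le> t \<and> u \<le> r t} = {t. u \<le> r t}"
  using u r_nonpos by (auto) (metis linear not_le)

lemma clock_inv_attained: "u \<le> r (clock_inv u)"
proof -
  let ?S = "{t. 0 \<le> t \<and> u \<le> r t}"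
  have "closed ?S"
    using cont by (auto intro!: closed_Collect_conj closed_Collect_le continuous_intros)
  moreover have "?S \<noteq> {}" using u clock_set by auto
  moreover have "bdd_below ?S" by (auto intro!: bdd_belowI)
  ultimately have "Inf ?S \<in> ?S" by (rule closed_contains_Inf[rotated 2])
  then show ?thesis by (simp add: clock_inv_def)
qed

lemma clock_inv_le_iff: "clock_inv u \<le> t \<longleftrightarrow> u \<le> r t"
proof
  assume "clock_inv u \<le> t"
  then show "u \<le> r t" using clock_inv_attained r_mono by force
next
  assume "u \<le> r t"
  then show "clock_inv u \<le> t"
    unfolding clock_inv_def clock_set using clock_set
    by (intro cInf_lower) (auto intro!: bdd_belowI[of _ 0])
qed

lemma clock_inv_pos: "0 < clock_inv u"
  using clock_inv_le_iff[of 0] r_nonpos[of 0] u by auto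

text \<open>Before the inverse time the values stay below u, and continuity excludes a jump over the
  level.\<close>

lemma clock_inv_eq: "r (clock_inv u) = u"
proof (rule antisym)
  have "continuous (at_left (clock_inv u)) r"
    using cont continuous_on_eq_continuous_at[of UNIV r] continuous_at_imp_continuous_at_within by blast
  then have "(r \<longlongrightarrow> r (clock_inv u)) (at_left (clock_inv u))"
    by (simp add: continuous_within)
  moreover have "\<forall>\<^sub>F t in at_left (clock_inv u). r t \<le> u"
    using clock_inv_le_iff by (auto simp: eventually_at_filter intro!: always_eventually)
      (metis linorder_not_le less_eq_real_def)
  ultimately show "r (clock_inv u) \<le> u"
    by (intro tendsto_upperbound) auto
qed (rule clock_inv_attained)

end

text \<open>The substitution u = r t for measures. Since \<open>clock_inv u <= t\<close> is
  equivalent to \<open>u <= r t\<close>, the inverse pulls half-open time intervals back to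
  half-open level intervals, and both sides assign them the increment of the stopped clock.\<close>

lemma interval_measure_clock:
  assumes T: "0 \<le> T"
  shows "interval_measure (\<lambda>s. r (min s T)) =
    distr (restrict_space lborel {0<..r T}) borel clock_inv"
proof -
  let ?M = "interval_measure (\<lambda>s. r (min s T))"
  let ?L = "restrict_space lborel {0<..r T}"
  let ?N = "distr ?L borel clock_inv"
  have le: "clock_inv u \<le> t \<longleftrightarrow> u \<le> r t" if "u \<in> {0<..r T}" for u t
    using that clock_inv_le_iff by auto
  have meas[measurable]: "clock_inv \<in> borel_measurable ?L"
  proof (rule borel_measurableI_le)
    fix t
    have "{x \<in> space ?L. clock_inv x \<le> t} = {0<..r T} \<inter> {..r t}"
      using le by (auto simp: space_restrict_space)
    then show "{x \<in> space ?L. clock_inv x \<le> t} \<in> sets ?L"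
      by (auto simp: sets_restrict_space)
  qed
  have contT: "continuous_on UNIV (\<lambda>s. r (min s T))"
    by (intro continuous_on_compose2[OF cont] continuous_intros) auto
  have contw: "continuous (at_right a) (\<lambda>s. r (min s T))" for a
    using contT by (auto simp: continuous_on_eq_continuous_at intro: continuous_at_imp_continuous_at_within)
  have monoT: "r (min s T) \<le> r (min t T)" if "s \<le> t" for s t
    using that by (intro r_mono) auto
  have Ioc: "emeasure ?M {a<..b} = ennreal (r (min b T) - r (min a T))" if "a \<le> b" for a b
    by (rule emeasure_interval_measure_Ioc[OF that monoT contw])
  have *: "emeasure ?M {a<..b} = emeasure ?N {a<..b}" if "a \<le> b" for a b
  proof -
    have "clock_inv -` {a<..b} \<inter> {0<..r T} = {r (min a T)<..r (min b T)}"
    proof (intro set_eqI iffI)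
      fix u assume u: "u \<in> clock_inv -` {a<..b} \<inter> {0<..r T}"
      then have "r a < u" "u \<le> r b" using le[of u a] le[of u b] by auto
      moreover have "a < T" using u le[of u T] by auto
      ultimately show "u \<in> {r (min a T)<..r (min b T)}"
        using u r_mono[of "min a T" a] by (auto simp: min_def)
    next
      fix u assume u: "u \<in> {r (min a T)<..r (min b T)}"
      have "r b \<ge> r (min b T)" "r T \<ge> r (min b T)" by (auto intro: r_mono)
      moreover have "0 \<le> r (min a T)" using r_nonpos[of "min (min a T) 0"] r_mono[OF min.cobounded1[of "min a T" 0]] by simp
      moreover have "\<not> u \<le> r a" using u calculation
        by (auto simp: min_def split: if_splits)
      ultimately show "u \<in> clock_inv -` {a<..b} \<inter> {0<..r T}"
        using u le[of u a] le[of u b] by auto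
    qed
    moreover have "r (min a T) \<le> r (min b T)" using that by (intro r_mono) auto
    moreover have "{r (min a T)<..r (min b T)} \<subseteq> {0<..r T}"
      using calculation by blast
    ultimately have "emeasure ?N {a<..b} = ennreal (r (min b T) - r (min a T))"
      by (subst emeasure_distr) (auto simp: space_restrict_space emeasure_restrict_space)
    also have "\<dots> = emeasure ?M {a<..b}"
      using Ioc[OF that] by simp
    finally show ?thesis by simp
  qed
  show ?thesis
  proof (rule measure_eqI_generator_eq[where \<Omega>=UNIV and E="range (\<lambda>(a, b). {a<..b::real})" and A="\<lambda>n. {-real n<..real n}"])
    fix S assume "S \<in> range (\<lambda>(a, b). {a<..b::real})"
    then obtain a b where S: "S = {a<..b}" by auto
    show "emeasure ?M S = emeasure ?N S"
      unfolding S by (cases "a \<le> b") (use * in auto)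
  next
    show "(\<Union>i. {- real i<..real i}) = UNIV"
      by (rule UN_Ioc_eq_UNIV)
  next
    fix i show "emeasure ?M {- real i<..real i} \<noteq> \<infinity>"
      using Ioc[of "- real i" "real i"] by simp
  qed (auto simp: Int_stable_def borel_sigma_sets_Ioc)
qed

text \<open>Measurability of the integrand is asked for on positive times only, because paths are
  arbitrary at negative times. This suffices since \<open>clock_inv\<close> is positive at the
  levels involved.\<close>

lemma nn_integral_clock:
  assumes T: "0 \<le> T" and \<phi>: "(\<lambda>t. \<phi> t * indicator {0<..} t) \<in> borel_measurable borel"
  shows "(\<integral>\<^sup>+t. \<phi> t \<partial>interval_measure (\<lambda>s. r (min s T))) =
    (\<integral>\<^sup>+u. \<phi> (clock_inv u) * indicator {0<..r T} u \<partial>lborel)"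
proof -
  let ?L = "restrict_space lborel {0<..r T}"
  let ?\<phi> = "\<lambda>t. \<phi> t * indicator {0<..} t"
  have meas[measurable]: "clock_inv \<in> borel_measurable ?L"
  proof (rule borel_measurableI_le)
    fix t
    have "{x \<in> space ?L. clock_inv x \<le> t} = {0<..r T} \<inter> {..r t}"
      using clock_inv_le_iff by (auto simp: space_restrict_space)
    then show "{x \<in> space ?L. clock_inv x \<le> t} \<in> sets ?L"
      by (auto simp: sets_restrict_space)
  qed
  have pos: "0 < clock_inv u" if "u \<in> {0<..r T}" for u
    using clock_inv_pos that by auto
  have "AE t in distr ?L borel clock_inv. 0 < t"
    using pos by (subst AE_distr_iff[OF meas]) (auto simp: space_restrict_space)
  then have "(\<integral>\<^sup>+t. \<phi> t \<partial>distr ?L borel clock_inv) = (\<integral>\<^sup>+t. ?\<phi> t \<partial>distr ?L borel clock_inv)"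
    by (intro nn_integral_cong_AE) auto
  also have "\<dots> = (\<integral>\<^sup>+u. ?\<phi> (clock_inv u) \<partial>?L)"
    using \<phi> by (subst nn_integral_distr) auto
  also have "\<dots> = (\<integral>\<^sup>+u. ?\<phi> (clock_inv u) * indicator {0<..r T} u \<partial>lborel)"
    by (subst nn_integral_restrict_space) auto
  also have "\<dots> = (\<integral>\<^sup>+u. \<phi> (clock_inv u) * indicator {0<..r T} u \<partial>lborel)"
    using pos by (intro nn_integral_cong) (auto simp: indicator_def)
  finally show ?thesis by (simp add: interval_measure_clock[OF T])
qed

end

subsection \<open>Conservative Hunt processes\<close>

locale conservative_hunt_process = hunt_process P X \<theta>
  for P :: "'a::{metric_space, second_countable_topology} \<Rightarrow> 'w measure"
    and X :: "real \<Rightarrow> 'w \<Rightarrow> 'a option"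
    and \<theta> :: "real \<Rightarrow> 'w \<Rightarrow> 'w" +
  assumes cons: "conservative P X"
begin

definition \<F>0 :: "'w measure" where "\<F>0 = natural_filtration X \<infinity>"
abbreviation "\<F> \<equiv> completed_filtration P X"

text \<open>The position as a point of E. By conservativeness the unspecified value
  \<open>the None\<close> occurs at times t >= 0 only on a null set, see
  \<open>AE_alive\<close>.\<close>

definition Y :: "real \<Rightarrow> 'w \<Rightarrow> 'a" where
  "Y t \<omega> = the (X t \<omega>)"

lemma space_natural [simp]: "space (natural_filtration X t) = UNIV"
  by (simp add: natural_filtration_def)

lemma space_F0 [simp]: "space \<F>0 = UNIV"
  by (simp add: \<F>0_def)

lemma sets_natural: "sets (natural_filtration X t) =
    sigma_sets UNIV {X s -` B | s B. 0 \<le> s \<and> ennreal s \<le> t \<and> B \<in> sets cpt_borel}"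
  by (simp add: natural_filtration_def)

lemma measurable_X: "0 \<le> s \<Longrightarrow> ennreal s \<le> t \<Longrightarrow> X s \<in> natural_filtration X t \<rightarrow>\<^sub>M cpt_borel"
  by (intro measurableI) (auto simp: sets_natural intro!: sigma_sets.Basic)

lemma measurable_X0 [measurable (raw)]: "0 \<le> s \<Longrightarrow> X s \<in> \<F>0 \<rightarrow>\<^sub>M cpt_borel"
  unfolding \<F>0_def by (rule measurable_X) auto

lemma measurable_Y0 [measurable (raw)]: "0 \<le> s \<Longrightarrow> Y s \<in> \<F>0 \<rightarrow>\<^sub>M borel"
  unfolding Y_def[abs_def] by measurable

lemma P_prob_algebra: "P x \<in> space (prob_algebra \<F>0)"
  using kernel unfolding \<F>0_def by (rule measurable_space) simp

lemma prob_space_P: "prob_space (P x)"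
  using P_prob_algebra[of x] by (simp add: space_prob_algebra)

lemma sets_P [simp, measurable_cong]: "sets (P x) = sets \<F>0"
  using P_prob_algebra[of x] by (simp add: space_prob_algebra)

lemma space_P [simp]: "space (P x) = UNIV"
  using sets_eq_imp_space_eq[OF sets_P] by simp

lemma kernel_subprob [measurable]: "P \<in> borel \<rightarrow>\<^sub>M subprob_algebra \<F>0"
  using kernel unfolding \<F>0_def by (rule measurable_prob_algebraD)

lemma prob_space_C: "prob_space (completion (P x))"
  using prob_space_P by (rule prob_space.prob_space_completion)

lemma return_prob_algebra: "return borel x \<in> space (prob_algebra borel)"
  by (auto simp: space_prob_algebra intro!: prob_space_return)

lemma bind_return_P: "return borel x \<bind> P = P x"
  by (rule bind_return[OF kernel_subprob]) simp

text \<open>An intersection of \<sigma>-algebras is already one, so generating adds nothing.\<close>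

lemma sets_completed: "sets (\<F> t) = (\<Inter>\<nu>\<in>space (prob_algebra borel).
    sigma_sets UNIV (sets (natural_filtration X t) \<union> null_sets (completion (bind \<nu> P))))"
proof -
  let ?S = "\<Inter>\<nu>\<in>space (prob_algebra borel).
    sigma_sets UNIV (sets (natural_filtration X t) \<union> null_sets (completion (bind \<nu> P)))"
  have "sigma_sets UNIV ?S \<subseteq> ?S"
    by (intro INT_greatest sigma_sets_mono) blast
  then have "sigma_sets UNIV ?S = ?S"
    by (auto intro: sigma_sets.Basic)
  then show ?thesis
    by (simp add: completed_filtration_def)
qed

lemma space_completed [simp]: "space (\<F> t) = UNIV"
  by (simp add: completed_filtration_def)

lemma natural_subset_natural: "t \<le> u \<Longrightarrow> sets (natural_filtration X t) \<subseteq> sets (natural_filtration X u)"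
  unfolding sets_natural by (intro sigma_sets_mono') (auto dest: order_trans)

lemma completed_mono: "t \<le> u \<Longrightarrow> sets (\<F> t) \<subseteq> sets (\<F> u)"
  unfolding sets_completed
  by (intro INF_mono') (auto intro!: sigma_sets_mono' dest: subsetD[OF natural_subset_natural])

lemma completed_subset_completion:
  assumes "\<nu> \<in> space (prob_algebra borel)"
  shows "sets (\<F> t) \<subseteq> sets (completion (bind \<nu> P))"
proof -
  have s: "sets (bind \<nu> P) = sets \<F>0" "space (bind \<nu> P) = UNIV"
    using assms by (auto simp: space_prob_algebra intro!: sets_bind space_bind
      simp: prob_space.not_empty sets_eq_imp_space_eq[of \<nu> borel])
  have "sets (natural_filtration X t) \<subseteq> sets (completion (bind \<nu> P))"
    using natural_subset_natural[of t \<infinity>] by (auto simp: s \<F>0_def intro!: sets_completionI_sets)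
  then have "sigma_sets (space (completion (bind \<nu> P)))
      (sets (natural_filtration X t) \<union> null_sets (completion (bind \<nu> P))) \<subseteq> sets (completion (bind \<nu> P))"
    by (intro sets.sigma_sets_subset) auto
  then have "sigma_sets UNIV (sets (natural_filtration X t) \<union> null_sets (completion (bind \<nu> P)))
      \<subseteq> sets (completion (bind \<nu> P))"
    by (simp add: s)
  then show ?thesis using assms unfolding sets_completed by blast
qed

lemma completed_subset_C: "sets (\<F> t) \<subseteq> sets (completion (P x))"
  using completed_subset_completion[OF return_prob_algebra, of t x] by (simp add: bind_return_P)

lemma measurable_completed_C: "f \<in> \<F> t \<rightarrow>\<^sub>M N \<Longrightarrow> f \<in> completion (P x) \<rightarrow>\<^sub>M N"
  using completed_subset_C[of t x] by (auto simp: measurable_def)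

lemma natural_subset_completed: "sets (natural_filtration X t) \<subseteq> sets (\<F> t)"
  by (auto simp: sets_completed)

lemma measurable_X_completed: "0 \<le> s \<Longrightarrow> ennreal s \<le> t \<Longrightarrow> X s \<in> \<F> t \<rightarrow>\<^sub>M cpt_borel"
  using measurable_X[of s t] natural_subset_completed[of t] by (auto simp: measurable_def)

lemma measurable_X_C [measurable (raw)]: "0 \<le> s \<Longrightarrow> X s \<in> completion (P x) \<rightarrow>\<^sub>M cpt_borel"
  by (rule measurable_completion) simp

lemma measurable_Y_C [measurable (raw)]: "0 \<le> s \<Longrightarrow> Y s \<in> completion (P x) \<rightarrow>\<^sub>M borel"
  by (rule measurable_completion) simp

lemma AE_P_Prob1: "Prob P x S = 1 \<Longrightarrow> AE \<omega> in P x. \<omega> \<in> S"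
proof -
  assume S: "Prob P x S = 1"
  interpret prob_space "completion (P x)" by (rule prob_space_C)
  \<comment> \<open>\<open>measure\<close> is 0 on non-measurable sets, so the value 1 forces
    measurability.\<close>
  have "S \<in> sets (completion (P x))"
    using S measure_notin_sets[of S "completion (P x)"] by (auto simp: Prob_def)
  then show ?thesis using S prob_eq_1[of S] by (simp add: Prob_def AE_completion_iff)
qed

lemma AE_lifetime: "AE \<omega> in P x. lifetime X \<omega> = \<infinity>"
  using AE_P_Prob1[of x "{\<omega>. lifetime X \<omega> = \<infinity>}"] cons by (simp add: conservative_def)

lemma alive: "lifetime X \<omega> = \<infinity> \<Longrightarrow> 0 < t \<Longrightarrow> X t \<omega> = Some (Y t \<omega>)"
proof (rule ccontr)
  assume *: "lifetime X \<omega> = \<infinity>" "0 < t" "X t \<omega> \<noteq> Some (Y t \<omega>)"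
  then have "X t \<omega> = None" by (cases "X t \<omega>") (auto simp: Y_def)
  then have "lifetime X \<omega> \<le> ennreal t"
    using * unfolding lifetime_def by (intro Inf_lower) auto
  then show False using * by (simp add: top_unique)
qed

lemma AE_alive: "AE \<omega> in P x. \<forall>t\<ge>0. X t \<omega> = Some (Y t \<omega>)"
  using AE_lifetime normal
proof eventually_elim
  case (elim \<omega>)
  then show ?case using alive[of \<omega>] by (metis Y_def le_less option.sel)
qed

lemma measurable_shift: "0 \<le> t \<Longrightarrow> \<theta> t \<in> \<F>0 \<rightarrow>\<^sub>M \<F>0"
  unfolding natural_filtration_def[of X \<infinity>] \<F>0_def
proof (rule measurable_measure_of)
  fix S assume t: "0 \<le> t" and "S \<in> {X s -` B |s B. 0 \<le> s \<and> ennreal s \<le> \<infinity> \<and> B \<in> sets cpt_borel}"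
  then obtain s B where S: "S = X s -` B" "0 \<le> s" "B \<in> sets cpt_borel" by auto
  have "\<theta> t -` S = X (s + t) -` B" using S t by (auto simp: shift)
  moreover have "X (s + t) -` B \<in> sets \<F>0"
    using measurable_sets[OF measurable_X0[of "s + t"], of B] S t by simp
  ultimately show "\<theta> t -` S \<inter> space (sigma UNIV {X s -` B |s B. 0 \<le> s \<and> ennreal s \<le> \<infinity> \<and> B \<in> sets cpt_borel})
      \<in> sets (sigma UNIV {X s -` B |s B. 0 \<le> s \<and> ennreal s \<le> \<infinity> \<and> B \<in> sets cpt_borel})"
    by (simp add: natural_filtration_def \<F>0_def)
qed auto

text \<open>The unnormalised law on the event \<Lambda>. Conditioning on the past up to t becomes an
  identity between measures, one for each \<Lambda> of that past; the completion is taken first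
  because \<Lambda> belongs only to the completed filtration.\<close>

definition restrict_P :: "'a \<Rightarrow> 'w set \<Rightarrow> 'w measure" where
  "restrict_P x \<Lambda> = density (completion (P x)) (indicator \<Lambda>)"

lemma sets_restrict_P [simp, measurable_cong]: "sets (restrict_P x \<Lambda>) = sets (completion (P x))"
  by (simp add: restrict_P_def)

lemma space_restrict_P [simp]: "space (restrict_P x \<Lambda>) = UNIV"
  by (simp add: restrict_P_def)

lemma measurable_restrict_P [measurable (raw)]: "f \<in> \<F>0 \<rightarrow>\<^sub>M N \<Longrightarrow> f \<in> restrict_P x \<Lambda> \<rightarrow>\<^sub>M N"
  by (auto intro!: measurable_completion simp: restrict_P_def cong: measurable_cong_sets)

lemma emeasure_restrict_P:
  assumes "\<Lambda> \<in> sets (\<F> t)" "B \<in> sets \<F>0"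
  shows "emeasure (restrict_P x \<Lambda>) B = emeasure (completion (P x)) (\<Lambda> \<inter> B)"
proof -
  have *: "\<Lambda> \<in> sets (completion (P x))" "B \<in> sets (completion (P x))"
    using assms completed_subset_C[of t x] by (auto intro: sets_completionI_sets)
  then show ?thesis
    unfolding restrict_P_def
    by (subst emeasure_density) (simp_all add: sets.Int flip: indicator_inter_arith)
qed

lemma nn_integral_restrict_P:
  assumes "\<Lambda> \<in> sets (\<F> t)" "f \<in> borel_measurable (completion (P x))"
  shows "(\<integral>\<^sup>+\<omega>. f \<omega> \<partial>restrict_P x \<Lambda>) = (\<integral>\<^sup>+\<omega>. indicator \<Lambda> \<omega> * f \<omega> \<partial>P x)"
  using assms completed_subset_C[of t x] unfolding restrict_P_def
  by (subst nn_integral_density) (auto simp: nn_integral_completion)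

text \<open>The strong Markov axiom at the constant time t, with the Dirac law at x as initial law.
  The cemetery branch of \<open>law_from\<close> is met only on a null set.\<close>

lemma markov_marginal:
  assumes \<Lambda>: "\<Lambda> \<in> sets (\<F> (ennreal t))" and [simp]: "0 \<le> t" "0 \<le> s"
  shows "distr (restrict_P x \<Lambda>) cpt_borel (X (t + s)) =
    bind (distr (restrict_P x \<Lambda>) borel (Y t)) (\<lambda>y. distr (P y) cpt_borel (X s))"
    (is "?L = ?R")
proof (rule measure_eqI)
  let ?K = "\<lambda>y. distr (P y) cpt_borel (X s)"
  have K: "?K \<in> borel \<rightarrow>\<^sub>M subprob_algebra cpt_borel"
    by (rule measurable_compose[OF kernel_subprob measurable_distr]) simp
  show "sets ?L = sets ?R"
    using K by (subst sets_bind[where N=cpt_borel]) auto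
  fix B assume "B \<in> sets ?L"
  then have B[measurable]: "B \<in> sets cpt_borel" by simp
  have st: "{\<omega> \<in> \<Lambda>. ennreal t \<le> u} \<in> sets (\<F> u)" for u
  proof (cases "ennreal t \<le> u")
    case True
    then show ?thesis using completed_mono[of "ennreal t" u] \<Lambda> by auto
  qed auto
  have "emeasure ?L B = emeasure (completion (P x)) {\<omega>\<in>\<Lambda>. ennreal t < \<infinity> \<and> X (enn2real (ennreal t) + s) \<omega> \<in> B}"
  proof -
    have "X (t + s) -` B \<in> sets \<F>0"
      using measurable_sets[OF measurable_X0[of "t + s"] B] by simp
    moreover have "emeasure ?L B = emeasure (restrict_P x \<Lambda>) (X (t + s) -` B)"
      by (subst emeasure_distr) simp_all
    ultimately have "emeasure ?L B = emeasure (completion (P x)) (\<Lambda> \<inter> X (t + s) -` B)"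
      using emeasure_restrict_P[OF \<Lambda>] by simp
    also have "\<Lambda> \<inter> X (t + s) -` B = {\<omega>\<in>\<Lambda>. ennreal t < \<infinity> \<and> X (enn2real (ennreal t) + s) \<omega> \<in> B}"
      by auto
    finally show ?thesis .
  qed
  also have "\<dots> = (\<integral>\<^sup>+\<omega>\<in>{\<omega>\<in>\<Lambda>. ennreal t < \<infinity>}. law_from P X s B (X (enn2real (ennreal t)) \<omega>) \<partial>completion (P x))"
    using strong_markov[OF return_prob_algebra[of x] stopping_time_const[of _ "ennreal t"] st \<open>0 \<le> s\<close> B]
    by (simp add: bind_return_P)
  also have "\<dots> = (\<integral>\<^sup>+\<omega>. indicator \<Lambda> \<omega> * emeasure (?K (Y t \<omega>)) B \<partial>P x)"
    unfolding nn_integral_completion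
  proof (rule nn_integral_cong_AE)
    have law: "law_from P X s B (Some y) = emeasure (?K y) B" for y
      by (simp add: law_from_def emeasure_distr)
    show "AE \<omega> in P x. law_from P X s B (X (enn2real (ennreal t)) \<omega>) * indicator {\<omega>\<in>\<Lambda>. ennreal t < \<infinity>} \<omega> =
      indicator \<Lambda> \<omega> * emeasure (?K (Y t \<omega>)) B"
      using AE_alive[of x]
    proof eventually_elim
      case (elim \<omega>)
      then have "X t \<omega> = Some (Y t \<omega>)" by simp
      then show ?case by (simp add: law indicator_def)
    qed
  qed
  also have "\<dots> = (\<integral>\<^sup>+\<omega>. emeasure (?K (Y t \<omega>)) B \<partial>restrict_P x \<Lambda>)"
    by (intro nn_integral_restrict_P[OF \<Lambda>, symmetric]
        measurable_compose[OF measurable_Y_C measurable_compose[OF K measurable_emeasure_subprob_algebra]]) auto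
  also have "\<dots> = emeasure ?R B"
    using K by (subst emeasure_bind[where N=cpt_borel]) (auto simp: nn_integral_distr)
  finally show "emeasure ?L B = emeasure ?R B" .
qed

end

section \<open>The Markov property for path events\<close>

definition cylinder :: "(real \<Rightarrow> 'w \<Rightarrow> 'a option) \<Rightarrow> real set \<Rightarrow> (real \<Rightarrow> 'a option set) \<Rightarrow> 'w set" where
  "cylinder X S B = {\<omega>. \<forall>s\<in>S. X s \<omega> \<in> B s}"

definition cylinders :: "(real \<Rightarrow> 'w \<Rightarrow> 'a::topological_space option) \<Rightarrow> 'w set set" where
  "cylinders X = {cylinder X S B | S B. finite S \<and> S \<subseteq> {0..} \<and> (\<forall>s. B s \<in> sets cpt_borel)}"

lemma Int_stable_cylinders: "Int_stable (cylinders (X :: real \<Rightarrow> 'w \<Rightarrow> 'a::t2_space option))"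
proof (rule Int_stableI)
  fix G H assume "G \<in> cylinders X" "H \<in> cylinders X"
  then obtain S B S' B' where *: "G = cylinder X S B" "H = cylinder X S' B'" "finite S" "finite S'"
    "S \<subseteq> {0..}" "S' \<subseteq> {0..}" "\<forall>s. B s \<in> sets cpt_borel" "\<forall>s. B' s \<in> sets cpt_borel"
    by (auto simp: cylinders_def)
  let ?B = "\<lambda>s. (if s \<in> S then B s else UNIV) \<inter> (if s \<in> S' then B' s else UNIV)"
  have U: "UNIV \<in> sets (cpt_borel :: 'a option measure)"
    using sets.top[of "cpt_borel :: 'a option measure"] by simp
  have "G \<inter> H = cylinder X (S \<union> S') ?B"
    using * by (auto simp: cylinder_def)
  moreover have "\<forall>s. ?B s \<in> sets cpt_borel" using * U by auto
  ultimately show "G \<inter> H \<in> cylinders X"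
    unfolding cylinders_def using * by (intro CollectI exI[of _ "S \<union> S'"] exI[of _ ?B]) simp
qed

context conservative_hunt_process
begin

lemma cylinder_natural:
  assumes "finite S" "S \<subseteq> {0..}" "\<And>s. B s \<in> sets cpt_borel" "\<And>s. s \<in> S \<Longrightarrow> ennreal s \<le> t"
  shows "cylinder X S B \<in> sets (natural_filtration X t)"
proof -
  have *: "X s -` B s \<in> sets (natural_filtration X t)" if "s \<in> S" for s
    using measurable_sets[OF measurable_X[of s t] assms(3)[of s]] assms that by auto
  have "cylinder X S B = (\<Inter>s\<in>S. X s -` B s) \<inter> UNIV"
    by (auto simp: cylinder_def)
  also have "\<dots> \<in> sets (natural_filtration X t)"
  proof (cases "S = {}")
    case True
    then show ?thesis using sets.top[of "natural_filtration X t"] by simp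
  next
    case False
    then show ?thesis using * assms(1) by (auto intro!: sets.finite_INT)
  qed
  finally show ?thesis .
qed

lemma cylinder_F0:
  assumes "finite S" "S \<subseteq> {0..}" "\<And>s. B s \<in> sets cpt_borel"
  shows "cylinder X S B \<in> sets \<F>0"
  unfolding \<F>0_def using assms by (rule cylinder_natural) auto

lemma sets_F0_cylinders: "sets \<F>0 = sigma_sets UNIV (cylinders X)"
proof
  show "sigma_sets UNIV (cylinders X) \<subseteq> sets \<F>0"
    using sets.sigma_sets_subset[of "cylinders X" \<F>0] cylinder_F0 by (auto simp: cylinders_def)
  have "X s -` B \<in> cylinders X" if "0 \<le> s" "B \<in> sets cpt_borel" for s B
    unfolding cylinders_def using that
    by (intro CollectI exI[of _ "{s}"] exI[of _ "\<lambda>_. B"]) (auto simp: cylinder_def)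
  then show "sets \<F>0 \<subseteq> sigma_sets UNIV (cylinders X)"
    unfolding \<F>0_def sets_natural by (intro sigma_sets_mono') auto
qed

lemma UNIV_cylinders: "UNIV \<in> cylinders X"
  unfolding cylinders_def
  by (intro CollectI exI[of _ "{}"] exI[of _ "\<lambda>_. {}"]) (auto simp: cylinder_def)

lemma measure_eqI_cylinders:
  assumes "sets M = sets \<F>0" "sets N = sets \<F>0" "emeasure M UNIV \<noteq> \<infinity>"
    "\<And>S B. finite S \<Longrightarrow> S \<subseteq> {0..} \<Longrightarrow> (\<And>s. B s \<in> sets cpt_borel) \<Longrightarrow>
      emeasure M (cylinder X S B) = emeasure N (cylinder X S B)"
  shows "M = N"
proof (rule measure_eqI_generator_eq[OF Int_stable_cylinders[of X], of UNIV _ _ "\<lambda>_. UNIV"])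
  show "emeasure M G = emeasure N G" if "G \<in> cylinders X" for G
    using that assms(4) by (auto simp: cylinders_def)
qed (use assms UNIV_cylinders in \<open>auto simp: sets_F0_cylinders\<close>)

lemma nn_integral_markov_marginal:
  assumes \<Lambda>: "\<Lambda> \<in> sets (\<F> (ennreal t))" and t: "0 \<le> t" "0 \<le> s"
    and f[measurable]: "f \<in> borel_measurable cpt_borel"
  shows "(\<integral>\<^sup>+\<omega>. f (X (t + s) \<omega>) \<partial>restrict_P x \<Lambda>) =
    (\<integral>\<^sup>+\<omega>. (\<integral>\<^sup>+\<omega>'. f (X s \<omega>') \<partial>P (Y t \<omega>)) \<partial>restrict_P x \<Lambda>)"
proof -
  let ?K = "\<lambda>y. distr (P y) cpt_borel (X s)"
  have K: "?K \<in> borel \<rightarrow>\<^sub>M subprob_algebra cpt_borel"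
    by (rule measurable_compose[OF kernel_subprob measurable_distr]) (simp add: t)
  have X: "X (t + s) \<in> restrict_P x \<Lambda> \<rightarrow>\<^sub>M cpt_borel" "Y t \<in> restrict_P x \<Lambda> \<rightarrow>\<^sub>M borel"
    using t by (auto intro!: measurable_restrict_P)
  have "(\<integral>\<^sup>+\<omega>. f (X (t + s) \<omega>) \<partial>restrict_P x \<Lambda>) =
      (\<integral>\<^sup>+z. f z \<partial>distr (restrict_P x \<Lambda>) cpt_borel (X (t + s)))"
    by (rule nn_integral_distr[OF X(1), symmetric]) simp
  also have "\<dots> = (\<integral>\<^sup>+z. f z \<partial>bind (distr (restrict_P x \<Lambda>) borel (Y t)) ?K)"
    by (subst markov_marginal[OF \<Lambda> t]) simp
  also have "\<dots> = (\<integral>\<^sup>+y. (\<integral>\<^sup>+z. f z \<partial>?K y) \<partial>distr (restrict_P x \<Lambda>) borel (Y t))"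
    using K by (intro nn_integral_bind[OF f]) simp
  also have "\<dots> = (\<integral>\<^sup>+\<omega>. (\<integral>\<^sup>+z. f z \<partial>?K (Y t \<omega>)) \<partial>restrict_P x \<Lambda>)"
    using measurable_compose[OF K nn_integral_measurable_subprob_algebra[OF f]]
    by (intro nn_integral_distr[OF X(2)]) simp
  also have "\<dots> = (\<integral>\<^sup>+\<omega>. (\<integral>\<^sup>+\<omega>'. f (X s \<omega>') \<partial>P (Y t \<omega>)) \<partial>restrict_P x \<Lambda>)"
    using t by (intro nn_integral_cong nn_integral_distr) simp_all
  finally show ?thesis .
qed

text \<open>Induction on the number of time points. The constraint at the earliest time s joins the
  conditioning event, and the others form a shorter cylinder seen from time t + s. The induction
  hypothesis is used twice, at t + s under P_x and at s under each P_y; the one-time Markov property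
  links the two.\<close>

lemma markov_cylinder:
  assumes "finite S" "S \<subseteq> {0..}" "\<And>s. B s \<in> sets cpt_borel" "0 \<le> t" "\<Lambda> \<in> sets (\<F> (ennreal t))"
  shows "emeasure (restrict_P x \<Lambda>) (\<theta> t -` cylinder X S B) =
    (\<integral>\<^sup>+\<omega>. emeasure (P (Y t \<omega>)) (cylinder X S B) \<partial>restrict_P x \<Lambda>)"
  using assms
proof (induction "card S" arbitrary: S B t \<Lambda> x)
  case 0
  then have "cylinder X S B = UNIV" by (auto simp: cylinder_def)
  moreover have "emeasure (P y) UNIV = 1" for y
    using prob_space.emeasure_space_1[OF prob_space_P[of y]] by simp
  ultimately show ?case by simp
next
  case (Suc n)
  define s where "s = Min S"
  have "S \<noteq> {}" using Suc.hyps(2) by auto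
  then have "s \<in> S" using Suc.prems Min_in[of S] by (simp add: s_def)
  then have s: "s \<in> S" "\<And>r. r \<in> S \<Longrightarrow> s \<le> r" "0 \<le> s"
    using Suc.prems by (auto simp: s_def)
  define S' where "S' = (\<lambda>r. r - s) ` (S - {s})"
  define B' where "B' = (\<lambda>r. B (r + s))"
  have S': "n = card S'" "finite S'" "S' \<subseteq> {0..}"
    using Suc.prems Suc.hyps(2) s by (auto simp: S'_def card_image inj_on_def)
  have B': "B' r \<in> sets cpt_borel" for r using Suc.prems by (simp add: B'_def)
  let ?C' = "cylinder X S' B'"
  have \<theta>C': "\<omega> \<in> \<theta> u -` ?C' \<longleftrightarrow> (\<forall>r\<in>S - {s}. X (r - s + u) \<omega> \<in> B r)" if "0 \<le> u" for u \<omega>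
    using that s(2) by (auto simp: cylinder_def S'_def B'_def shift)
  have C: "cylinder X S B = X s -` B s \<inter> \<theta> s -` ?C'"
  proof (rule set_eqI)
    show "\<omega> \<in> cylinder X S B \<longleftrightarrow> \<omega> \<in> X s -` B s \<inter> \<theta> s -` ?C'" for \<omega>
      unfolding Int_iff \<theta>C'[OF s(3)] using s by (auto simp: cylinder_def)
  qed
  have X_iff: "\<omega> \<in> \<theta> t -` cylinder X S B \<longleftrightarrow> (\<forall>r\<in>S. X (r + t) \<omega> \<in> B r)" for \<omega>
    using Suc.prems by (auto simp: cylinder_def shift subset_iff)
  have ts: "0 \<le> t + s" using Suc.prems s by simp
  have \<theta>C: "\<theta> t -` cylinder X S B = X (t + s) -` B s \<inter> \<theta> (t + s) -` ?C'"
  proof (rule set_eqI)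
    show "\<omega> \<in> \<theta> t -` cylinder X S B \<longleftrightarrow> \<omega> \<in> X (t + s) -` B s \<inter> \<theta> (t + s) -` ?C'" for \<omega>
      unfolding Int_iff \<theta>C'[OF ts] X_iff using s by (auto simp: algebra_simps)
  qed
  have C'm: "?C' \<in> sets \<F>0" using S' B' by (intro cylinder_F0)
  have \<theta>C'm: "\<theta> u -` ?C' \<in> sets \<F>0" if "0 \<le> u" for u
    using measurable_sets[OF measurable_shift[OF that] C'm] by simp
  have XF: "X u -` B s \<in> sets (\<F> (ennreal u))" if "0 \<le> u" for u
    using measurable_sets[OF measurable_X_completed[OF that order_refl]] Suc.prems by auto
  have XF0: "X u -` B s \<in> sets \<F>0" if "0 \<le> u" for u
    using measurable_sets[OF measurable_X0[OF that]] Suc.prems by auto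
  let ?\<Lambda> = "\<Lambda> \<inter> X (t + s) -` B s"
  have \<Lambda>': "?\<Lambda> \<in> sets (\<F> (ennreal (t + s)))"
    using XF[OF ts] Suc.prems completed_mono[of "ennreal t" "ennreal (t + s)"] s by (auto simp: ennreal_leI)
  \<comment> \<open>What is left of the cylinder once everything after its earliest time has been
    integrated out: a function of the position at that time.\<close>
  define f where "f z = indicator (B s) z * emeasure (P (the z)) ?C'" for z
  have PC'[measurable]: "(\<lambda>y. emeasure (P y) ?C') \<in> borel_measurable borel"
    by (rule measurable_compose[OF kernel_subprob measurable_emeasure_subprob_algebra[OF C'm]])
  have f[measurable]: "f \<in> borel_measurable cpt_borel"
    using Suc.prems measurable_compose[OF measurable_the_cpt PC'] unfolding f_def by simp
  have fX: "(\<integral>\<^sup>+\<omega>'. f (X s \<omega>') \<partial>P y) = emeasure (P y) (cylinder X S B)" for y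
  proof -
    have "(\<integral>\<^sup>+\<omega>'. f (X s \<omega>') \<partial>P y) = (\<integral>\<^sup>+\<omega>'. emeasure (P (Y s \<omega>')) ?C' \<partial>restrict_P y (X s -` B s))"
      using s by (subst nn_integral_restrict_P[OF XF])
        (auto simp: f_def Y_def indicator_def intro!: measurable_compose[OF measurable_Y_C PC', simplified Y_def])
    also have "\<dots> = emeasure (restrict_P y (X s -` B s)) (\<theta> s -` ?C')"
      using Suc.hyps(1)[OF S' B' s(3) XF[OF s(3)], of y] by simp
    also have "\<dots> = emeasure (completion (P y)) (cylinder X S B)"
      unfolding C by (rule emeasure_restrict_P[OF XF[OF s(3)] \<theta>C'm[OF s(3)]])
    also have "\<dots> = emeasure (P y) (cylinder X S B)"
      using Suc.prems by (simp add: emeasure_completion cylinder_F0)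
    finally show ?thesis .
  qed
  have "emeasure (restrict_P x \<Lambda>) (\<theta> t -` cylinder X S B) = emeasure (restrict_P x ?\<Lambda>) (\<theta> (t + s) -` ?C')"
    unfolding \<theta>C using Suc.prems \<theta>C'm[OF ts] XF0[OF ts]
    by (subst emeasure_restrict_P[where t="ennreal t"], simp, simp, subst emeasure_restrict_P[OF \<Lambda>'], simp)
      (simp add: Int_assoc)
  also have "\<dots> = (\<integral>\<^sup>+\<omega>. emeasure (P (Y (t + s) \<omega>)) ?C' \<partial>restrict_P x ?\<Lambda>)"
    using Suc.hyps(1)[OF S' B' ts \<Lambda>', of x] .
  also have "\<dots> = (\<integral>\<^sup>+\<omega>. f (X (t + s) \<omega>) \<partial>restrict_P x \<Lambda>)"
    using ts Suc.prems measurable_compose[OF measurable_Y_C PC'] measurable_compose[OF measurable_X_C f]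
    by (subst nn_integral_restrict_P[OF \<Lambda>'], simp, subst nn_integral_restrict_P[where t="ennreal t"])
      (auto simp: f_def Y_def indicator_def intro!: nn_integral_cong)
  also have "\<dots> = (\<integral>\<^sup>+\<omega>. (\<integral>\<^sup>+\<omega>'. f (X s \<omega>') \<partial>P (Y t \<omega>)) \<partial>restrict_P x \<Lambda>)"
    using Suc.prems s by (intro nn_integral_markov_marginal) auto
  finally show ?case by (simp add: fX)
qed

text \<open>Both sides are finite measures, and cylinders are an intersection-stable generator on
  which they agree.\<close>

lemma markov_shift:
  assumes "0 \<le> t" "\<Lambda> \<in> sets (\<F> (ennreal t))"
  shows "distr (restrict_P x \<Lambda>) \<F>0 (\<theta> t) = bind (distr (restrict_P x \<Lambda>) borel (Y t)) P"
proof (rule measure_eqI_cylinders)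
  have Y: "Y t \<in> restrict_P x \<Lambda> \<rightarrow>\<^sub>M borel" "\<theta> t \<in> restrict_P x \<Lambda> \<rightarrow>\<^sub>M \<F>0"
    using assms by (auto intro!: measurable_restrict_P measurable_shift)
  show "sets (distr (restrict_P x \<Lambda>) borel (Y t) \<bind> P) = sets \<F>0"
    by (subst sets_bind[where N=\<F>0]) auto
  have "emeasure (restrict_P x \<Lambda>) UNIV = emeasure (completion (P x)) \<Lambda>"
    using emeasure_restrict_P[OF assms(2) sets.top, of x] by simp
  then show "emeasure (distr (restrict_P x \<Lambda>) \<F>0 (\<theta> t)) UNIV \<noteq> \<infinity>"
    using Y finite_measure.emeasure_finite[OF prob_space.finite_measure[OF prob_space_C[of x]], of \<Lambda>]
    by (subst emeasure_distr) (auto simp: sets.top[of \<F>0, simplified])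
  fix S :: "real set" and B :: "real \<Rightarrow> 'a option set" assume *: "finite S" "S \<subseteq> {0..}" "\<And>s. B s \<in> sets cpt_borel"
  have C: "cylinder X S B \<in> sets \<F>0" using * by (rule cylinder_F0)
  have "emeasure (distr (restrict_P x \<Lambda>) borel (Y t) \<bind> P) (cylinder X S B) =
    (\<integral>\<^sup>+\<omega>. emeasure (P (Y t \<omega>)) (cylinder X S B) \<partial>restrict_P x \<Lambda>)"
    using Y C by (subst emeasure_bind[OF _ _ C])
      (auto intro!: nn_integral_distr measurable_compose[OF kernel_subprob measurable_emeasure_subprob_algebra])
  then show "emeasure (distr (restrict_P x \<Lambda>) \<F>0 (\<theta> t)) (cylinder X S B) =
    emeasure (distr (restrict_P x \<Lambda>) borel (Y t) \<bind> P) (cylinder X S B)"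
    using markov_cylinder[OF * assms, of x] Y C by (simp add: emeasure_distr)
qed simp

lemma nn_integral_markov:
  assumes "0 \<le> t" "\<Lambda> \<in> sets (\<F> (ennreal t))" and f: "f \<in> borel_measurable \<F>0"
  shows "(\<integral>\<^sup>+\<omega>. indicator \<Lambda> \<omega> * f (\<theta> t \<omega>) \<partial>P x) =
    (\<integral>\<^sup>+\<omega>. indicator \<Lambda> \<omega> * (\<integral>\<^sup>+\<omega>'. f \<omega>' \<partial>P (Y t \<omega>)) \<partial>P x)"
proof -
  have Y: "Y t \<in> restrict_P x \<Lambda> \<rightarrow>\<^sub>M borel" "\<theta> t \<in> restrict_P x \<Lambda> \<rightarrow>\<^sub>M \<F>0"
    using assms by (auto intro!: measurable_restrict_P measurable_shift)
  have g: "(\<lambda>y. \<integral>\<^sup>+\<omega>'. f \<omega>' \<partial>P y) \<in> borel_measurable borel"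
    by (rule measurable_compose[OF kernel_subprob nn_integral_measurable_subprob_algebra[OF f]])
  have "(\<integral>\<^sup>+\<omega>. indicator \<Lambda> \<omega> * f (\<theta> t \<omega>) \<partial>P x) = (\<integral>\<^sup>+\<omega>. f (\<theta> t \<omega>) \<partial>restrict_P x \<Lambda>)"
    using measurable_compose[OF measurable_shift[OF assms(1)] f] assms
    by (intro nn_integral_restrict_P[symmetric]) (auto intro!: measurable_completion cong: measurable_cong_sets)
  also have "\<dots> = (\<integral>\<^sup>+\<omega>. f \<omega> \<partial>distr (restrict_P x \<Lambda>) \<F>0 (\<theta> t))"
    using f by (intro nn_integral_distr[OF Y(2), symmetric]) simp
  also have "\<dots> = (\<integral>\<^sup>+y. (\<integral>\<^sup>+\<omega>. f \<omega> \<partial>P y) \<partial>distr (restrict_P x \<Lambda>) borel (Y t))"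
    unfolding markov_shift[OF assms(1,2)] by (rule nn_integral_bind[OF f]) simp
  also have "\<dots> = (\<integral>\<^sup>+\<omega>. (\<integral>\<^sup>+\<omega>'. f \<omega>' \<partial>P (Y t \<omega>)) \<partial>restrict_P x \<Lambda>)"
    using g by (intro nn_integral_distr[OF Y(1)]) simp
  also have "\<dots> = (\<integral>\<^sup>+\<omega>. indicator \<Lambda> \<omega> * (\<integral>\<^sup>+\<omega>'. f \<omega>' \<partial>P (Y t \<omega>)) \<partial>P x)"
    using assms g by (intro nn_integral_restrict_P) (auto intro!: measurable_compose[OF measurable_Y_C])
  finally show ?thesis .
qed

end

section \<open>The semigroup and its absolute continuity\<close>

context conservative_hunt_process
begin

text \<open>From the lifetime on the path sits in the cemetery, where \<open>ext0\<close> already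
  gives 0.\<close>

lemma indicator_alive_ext0:
  assumes "0 < t"
  shows "ext0 f (X t \<omega>) * indicator {\<omega>. ennreal t < lifetime X \<omega>} \<omega> = (ext0 f (X t \<omega>) :: ennreal)"
    "indicator {\<omega>. ennreal t < lifetime X \<omega>} \<omega> *\<^sub>R ext0 g (X t \<omega>) = (ext0 g (X t \<omega>) :: real)"
  using assms cemetery[of t \<omega>] by (auto simp: ext0_def indicator_def not_less)

lemma trans_nn_eq: "0 < t \<Longrightarrow> trans_nn P X t f x = (\<integral>\<^sup>+\<omega>. f (Y t \<omega>) \<partial>P x)"
  unfolding trans_nn_def indicator_alive_ext0
  using AE_alive[of x] by (intro nn_integral_cong_AE, eventually_elim) (simp add: ext0_def)

lemma trans_op_eq:
  assumes "0 < t" and [measurable]: "f \<in> borel_measurable borel"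
  shows "trans_op P X t f x = (LINT \<omega>|P x. f (Y t \<omega>))"
proof -
  have "(\<lambda>\<omega>. ext0 f (X t \<omega>)) \<in> borel_measurable (P x)" "(\<lambda>\<omega>. f (Y t \<omega>)) \<in> borel_measurable (P x)"
    using measurable_compose[OF measurable_X0 measurable_ext0[OF assms(2)], of t]
      measurable_compose[OF measurable_Y0 assms(2), of t] assms(1) by simp_all
  then show ?thesis
    unfolding trans_op_def set_lebesgue_integral_def indicator_alive_ext0[OF assms(1)]
    using AE_alive[of x] assms(1)
    by (intro integral_cong_AE) (auto elim!: eventually_mono simp: ext0_def)
qed

end

locale strong_feller_hunt_process = conservative_hunt_process P X \<theta>
  for P :: "'a::{metric_space, second_countable_topology} \<Rightarrow> 'w measure"
    and X :: "real \<Rightarrow> 'w \<Rightarrow> 'a option"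
    and \<theta> :: "real \<Rightarrow> 'w \<Rightarrow> 'w" +
  fixes m :: "'a measure" and p :: "real \<Rightarrow> 'a \<Rightarrow> 'a \<Rightarrow> ennreal"
  assumes sigma_finite_m: "sigma_finite_measure m"
    and sets_m [simp, measurable_cong]: "sets m = sets borel"
    and m_nonzero: "emeasure m UNIV \<noteq> 0"
    and density: "transition_density m P X p"
    and feller: "strong_feller P X"
begin

lemma space_m [simp]: "space m = UNIV"
  using sets_eq_imp_space_eq[OF sets_m] by simp

text \<open>The law of the position at a fixed t > 0 has a density with respect to m from every
  starting point. This is the passage from statements valid m-a.e. to statements under each
  P_x.\<close>

lemma AE_Y:
  assumes "0 < t" "AE y in m. Q y"
  shows "AE \<omega> in P x. Q (Y t \<omega>)"
proof -
  obtain N where N: "{y. \<not> Q y} \<subseteq> N" "N \<in> sets borel" "emeasure m N = 0"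
    using assms(2) by (auto elim!: AE_E simp: null_sets_def)
  have "(\<integral>\<^sup>+\<omega>. indicator N (Y t \<omega>) \<partial>P x) = (\<integral>\<^sup>+y. p t x y * indicator N y \<partial>m)"
    using density N assms(1) by (subst trans_nn_eq[symmetric]) (auto simp: transition_density_def)
  also have "\<dots> = (\<integral>\<^sup>+y. 0 \<partial>m)"
  proof (rule nn_integral_cong_AE)
    have "AE y in m. y \<notin> N" using N by (intro AE_not_in) (auto simp: null_sets_def)
    then show "AE y in m. p t x y * indicator N y = 0" by eventually_elim simp
  qed
  finally have "AE \<omega> in P x. indicator N (Y t \<omega>) = (0::ennreal)"
    using N(2) assms(1) measurable_compose[OF measurable_Y0, of t "indicator N" borel]
      nn_integral_0_iff_AE[of "\<lambda>\<omega>. indicator N (Y t \<omega>)" "P x"] by simp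
  then show ?thesis
    by eventually_elim (use N(1) in \<open>auto simp: indicator_def split: if_splits\<close>)
qed

lemma trans_nn_le_1:
  assumes "0 < t" "f \<in> borel_measurable borel" "\<And>y. f y \<le> 1"
  shows "trans_nn P X t f x \<le> 1"
proof -
  have "(\<integral>\<^sup>+\<omega>. f (Y t \<omega>) \<partial>P x) \<le> (\<integral>\<^sup>+\<omega>. 1 \<partial>P x)"
    by (intro nn_integral_mono assms)
  then show ?thesis
    using prob_space.emeasure_space_1[OF prob_space_P[of x]] by (simp add: trans_nn_eq assms)
qed

text \<open>\<open>strong_feller\<close> concerns bounded real functions; the bound by 1 makes the
  passage between them and \<open>ennreal\<close> lossless.\<close>

lemma continuous_trans_nn:
  assumes t: "0 < t" and f[measurable]: "f \<in> borel_measurable borel" and "\<And>y. f y \<le> 1"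
  shows "continuous_on UNIV (trans_nn P X t f)"
proof -
  let ?f = "\<lambda>y. enn2real (f y)"
  have f1: "f y = ennreal (?f y)" for y
    using assms(3)[of y] by (auto simp: less_top_ennreal ennreal_enn2real_if top_unique)
  have b: "0 \<le> ?f y" "?f y \<le> 1" for y
    using assms(3)[of y] by (auto simp: enn2real_leI)
  have Y[measurable]: "Y t \<in> P x \<rightarrow>\<^sub>M borel" for x
    using measurable_Y0[of t] t by simp
  have int: "integrable (P x) (\<lambda>\<omega>. ?f (Y t \<omega>))" for x
  proof -
    interpret prob_space "P x" by (rule prob_space_P)
    show ?thesis using b by (intro integrable_const_bound[of _ 1]) auto
  qed
  have "trans_nn P X t f x = ennreal (trans_op P X t ?f x)" for x
    using t b by (subst trans_nn_eq, simp, subst trans_op_eq, simp, simp, subst f1,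
        subst nn_integral_eq_integral[OF int]) auto
  moreover have "continuous_on UNIV (trans_op P X t ?f)"
  proof -
    have "bounded (range ?f)" using b by (auto simp: bounded_iff intro!: exI[of _ 1])
    moreover have "?f \<in> borel_measurable borel" by measurable
    ultimately show ?thesis using feller t unfolding strong_feller_def by blast
  qed
  ultimately show ?thesis
    by (auto intro!: continuous_intros simp: continuous_on_ennreal cong: continuous_on_cong)
qed

text \<open>m may be infinite, whereas the completions are indexed by probability laws. Normalising
  a strictly positive integrable density gives a law whose null sets are m-null.\<close>

lemma equivalent_probability:
  "\<exists>\<nu>\<in>space (prob_algebra (borel :: 'a measure)). \<forall>Q. (AE y in \<nu>. Q y) \<longrightarrow> (AE y in m. Q y)"
proof -
  interpret sigma_finite_measure m by (rule sigma_finite_m)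
  obtain h where h[measurable]: "h \<in> borel_measurable m" and fin: "integral\<^sup>N m h \<noteq> \<infinity>"
    and pos: "\<And>x. 0 < h x" "\<And>x. h x < \<infinity>"
    using Ex_finite_integrable_function by auto
  define c where "c = integral\<^sup>N m h"
  have "c \<noteq> 0"
  proof
    assume "c = 0"
    then have "AE x in m. h x = 0" by (simp add: c_def nn_integral_0_iff_AE)
    then have "AE x in m. False" using pos by (simp add: less_le)
    then show False using m_nonzero by (simp add: AE_iff_measurable[OF sets.top])
  qed
  define \<nu> where "\<nu> = density m (\<lambda>x. h x / c)"
  have "emeasure \<nu> UNIV = 1"
    unfolding \<nu>_def using \<open>c \<noteq> 0\<close> fin
    by (subst emeasure_density) (auto simp: nn_integral_divide c_def ennreal_divide_self less_top)
  then have "prob_space \<nu>" by (intro prob_spaceI) (simp add: \<nu>_def)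
  moreover have "0 < h x / c" for x
    using pos[of x] fin by (auto simp: ennreal_zero_less_divide c_def less_top)
  then have "AE y in m. Q y" if "AE y in \<nu>. Q y" for Q
    using that unfolding \<nu>_def by (subst (asm) AE_density) auto
  ultimately show ?thesis
    by (intro bexI[of _ \<nu>]) (auto simp: space_prob_algebra \<nu>_def)
qed

text \<open>The \<open>\<F>0\<close>-measurable version of \<open>Z\<close> depends on the initial law \<open>\<nu>\<close>; for \<open>\<nu>\<close> equivalent to \<open>m\<close> one
  version serves all starting points, because \<open>p\<^sub>t(x, \<cdot>)\<close> is absolutely continuous.\<close>

lemma completed_version:
  fixes Z :: "'w \<Rightarrow> ennreal"
  assumes "Z \<in> borel_measurable (\<F> \<infinity>)"
  shows "\<exists>Z'\<in>borel_measurable \<F>0. (AE y in m. (\<integral>\<^sup>+\<omega>. Z' \<omega> \<partial>P y) = (\<integral>\<^sup>+\<omega>. Z \<omega> \<partial>P y)) \<and>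
    (\<forall>x. \<forall>s>0. AE \<omega> in P x. Z (\<theta> s \<omega>) = Z' (\<theta> s \<omega>))"
proof -
  obtain \<nu> where \<nu>: "\<nu> \<in> space (prob_algebra borel)" "\<And>Q. (AE y in \<nu>. Q y) \<Longrightarrow> AE y in m. Q y"
    using equivalent_probability by blast
  have sets_\<nu>: "sets \<nu> = sets borel" "space \<nu> \<noteq> {}"
    using \<nu>(1) by (auto simp: space_prob_algebra prob_space.not_empty)
  have K: "P \<in> \<nu> \<rightarrow>\<^sub>M subprob_algebra \<F>0"
    using kernel_subprob sets_\<nu>(1) measurable_cong_sets by blast
  have s: "sets (bind \<nu> P) = sets \<F>0"
    by (rule sets_bind[OF sets_kernel[OF K] sets_\<nu>(2)]) auto
  have "Z \<in> borel_measurable (completion (bind \<nu> P))"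
    using assms completed_subset_completion[OF \<nu>(1), of \<infinity>] sets_eq_imp_space_eq[OF s]
    by (auto simp: measurable_def)
  then obtain Z' where Z': "Z' \<in> borel_measurable (bind \<nu> P)" "AE \<omega> in bind \<nu> P. Z \<omega> = Z' \<omega>"
    using completion_ex_borel_measurable by blast
  from Z'(2) obtain N where N: "{\<omega>. Z \<omega> \<noteq> Z' \<omega>} \<subseteq> N" "N \<in> sets \<F>0" "emeasure (bind \<nu> P) N = 0"
    using sets_eq_imp_space_eq[OF s] s by (auto elim!: AE_E simp: null_sets_def)
  have Z'm: "Z' \<in> borel_measurable \<F>0" using Z'(1) s by (simp cong: measurable_cong_sets)
  have "(\<integral>\<^sup>+y. emeasure (P y) N \<partial>\<nu>) = 0"
    using N emeasure_bind[OF sets_\<nu>(2) K N(2)] by simp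
  moreover have PN: "(\<lambda>y. emeasure (P y) N) \<in> borel_measurable borel"
    by (rule measurable_compose[OF kernel_subprob measurable_emeasure_subprob_algebra[OF N(2)]])
  ultimately have "AE y in \<nu>. emeasure (P y) N = 0"
    using sets_\<nu>(1) by (subst (asm) nn_integral_0_iff_AE) (auto cong: measurable_cong_sets)
  then have m0: "AE y in m. emeasure (P y) N = 0" by (rule \<nu>(2))
  show ?thesis
  proof (intro bexI[OF _ Z'm] conjI allI impI)
    show "AE y in m. (\<integral>\<^sup>+\<omega>. Z' \<omega> \<partial>P y) = (\<integral>\<^sup>+\<omega>. Z \<omega> \<partial>P y)"
      using m0
    proof eventually_elim
      case (elim y)
      then have "AE \<omega> in P y. \<omega> \<notin> N" using N by (intro AE_not_in) (auto simp: null_sets_def)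
      then show ?case using N(1) by (intro nn_integral_cong_AE) (auto elim!: eventually_mono dest: subsetD simp: eq_commute[of "Z' _"])
    qed
    \<comment> \<open>By the Markov property the shifted path lies in \<open>N\<close> with
      probability E_x[P_y(N)], y being the position at s; the law of y does not charge the m-null
      set where P_y(N) > 0.\<close>
    fix x and s :: real assume s: "0 < s"
    have "(\<integral>\<^sup>+\<omega>. indicator UNIV \<omega> * indicator N (\<theta> s \<omega>) \<partial>P x) =
        (\<integral>\<^sup>+\<omega>. indicator UNIV \<omega> * (\<integral>\<^sup>+\<omega>'. indicator N \<omega>' \<partial>P (Y s \<omega>)) \<partial>P x)"
      using s N(2) sets.top[of "\<F> (ennreal s)"] by (intro nn_integral_markov) auto
    also have "\<dots> = (\<integral>\<^sup>+\<omega>. 0 \<partial>P x)"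
      using AE_Y[OF s m0, of x] N(2) by (intro nn_integral_cong_AE) (auto elim!: eventually_mono)
    finally have "AE \<omega> in P x. indicator N (\<theta> s \<omega>) = (0::ennreal)"
      using N(2) s measurable_compose[OF measurable_shift, of s "indicator N" borel]
        nn_integral_0_iff_AE[of "\<lambda>\<omega>. indicator N (\<theta> s \<omega>)" "P x"]
      by (simp cong: measurable_cong_sets)
    then show "AE \<omega> in P x. Z (\<theta> s \<omega>) = Z' (\<theta> s \<omega>)"
      by eventually_elim (use N(1) in \<open>auto simp: indicator_def split: if_splits\<close>)
  qed
qed

text \<open>If \<open>P\<^sub>x(H) = c\<close> for a shift-invariant event \<open>H\<close>, the Markov property makes \<open>H\<close> independent of
  every \<open>\<F>\<^sub>t\<close>, hence of itself, and so \<open>c = c\<^sup>2\<close>.\<close>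

lemma invariant_zero_one:
  assumes H: "H \<in> sets (\<F> \<infinity>)"
    and inv: "\<And>x t. 0 < t \<Longrightarrow> AE \<omega> in P x. \<theta> t \<omega> \<in> H \<longleftrightarrow> \<omega> \<in> H"
    and c: "\<And>x. Prob P x H = c"
  shows "c = 0 \<or> c = 1"
proof -
  fix x :: 'a
  interpret prob_space "completion (P x)" by (rule prob_space_C)
  have c0: "0 \<le> c" using c[of x] measure_nonneg[of "completion (P x)" H] by (simp add: Prob_def)
  have HC: "H \<in> sets (completion (P y))" for y using H completed_subset_C by blast
  have int_H: "(\<integral>\<^sup>+\<omega>. indicator H \<omega> \<partial>P y) = ennreal c" for y
  proof -
    interpret Cy: prob_space "completion (P y)" by (rule prob_space_C)
    have "(\<integral>\<^sup>+\<omega>. indicator H \<omega> \<partial>P y) = emeasure (completion (P y)) H"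
      using HC by (simp flip: nn_integral_completion[of "P y"])
    then show ?thesis using c[of y] by (simp add: Cy.emeasure_eq_measure Prob_def)
  qed
  have "(indicator H :: 'w \<Rightarrow> ennreal) \<in> borel_measurable (\<F> \<infinity>)" using H by simp
  then obtain Z where Z: "Z \<in> borel_measurable \<F>0" "AE y in m. (\<integral>\<^sup>+\<omega>. Z \<omega> \<partial>P y) = (\<integral>\<^sup>+\<omega>. indicator H \<omega> \<partial>P y)"
    "\<And>x s. 0 < s \<Longrightarrow> AE \<omega> in P x. indicator H (\<theta> s \<omega>) = Z (\<theta> s \<omega>)"
    using completed_version by blast
  have indep: "emeasure (completion (P x)) (\<Lambda> \<inter> H) = ennreal c * emeasure (completion (P x)) \<Lambda>"
    if t: "0 < t" and \<Lambda>: "\<Lambda> \<in> sets (\<F> (ennreal t))" for t \<Lambda>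
  proof -
    have \<Lambda>C: "\<Lambda> \<in> sets (completion (P x))" using \<Lambda> completed_subset_C by blast
    have "emeasure (completion (P x)) (\<Lambda> \<inter> H) = (\<integral>\<^sup>+\<omega>. indicator \<Lambda> \<omega> * indicator H \<omega> \<partial>P x)"
      using \<Lambda>C HC by (simp flip: nn_integral_completion[of "P x"] indicator_inter_arith)
    also have "\<dots> = (\<integral>\<^sup>+\<omega>. indicator \<Lambda> \<omega> * Z (\<theta> t \<omega>) \<partial>P x)"
    proof (rule nn_integral_cong_AE)
      show "AE \<omega> in P x. indicator \<Lambda> \<omega> * indicator H \<omega> = indicator \<Lambda> \<omega> * Z (\<theta> t \<omega>)"
        using Z(3)[OF t] inv[OF t] by eventually_elim (auto simp: indicator_def split: if_splits)
    qed
    also have "\<dots> = (\<integral>\<^sup>+\<omega>. indicator \<Lambda> \<omega> * (\<integral>\<^sup>+\<omega>'. Z \<omega>' \<partial>P (Y t \<omega>)) \<partial>P x)"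
      using t \<Lambda> Z(1) by (intro nn_integral_markov) auto
    also have "\<dots> = (\<integral>\<^sup>+\<omega>. ennreal c * indicator \<Lambda> \<omega> \<partial>P x)"
      using AE_Y[OF t Z(2), of x] by (intro nn_integral_cong_AE) (auto elim!: eventually_mono simp: int_H mult.commute)
    also have "\<dots> = ennreal c * emeasure (completion (P x)) \<Lambda>"
      using \<Lambda>C by (simp flip: nn_integral_completion[of "P x"] add: nn_integral_cmult)
    finally show ?thesis .
  qed
  \<comment> \<open>Independence in the form P_x(H \<inter> B) = c P_x(B): known for cylinders, it
    extends to all of \<open>\<F>0\<close> as an identity of measures.\<close>
  have "distr (restrict_P x H) \<F>0 (\<lambda>\<omega>. \<omega>) = density (P x) (\<lambda>_. ennreal c)"
  proof (rule measure_eqI_cylinders)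
    have id: "(\<lambda>\<omega>. \<omega>) \<in> restrict_P x H \<rightarrow>\<^sub>M \<F>0" by (rule measurable_restrict_P) simp
    have em: "emeasure (distr (restrict_P x H) \<F>0 (\<lambda>\<omega>. \<omega>)) B = emeasure (completion (P x)) (H \<inter> B)"
      if "B \<in> sets \<F>0" for B
      using that id emeasure_restrict_P[OF H, of B x] by (simp add: emeasure_distr)
    then show "emeasure (distr (restrict_P x H) \<F>0 (\<lambda>\<omega>. \<omega>)) UNIV \<noteq> \<infinity>"
      using sets.top[of \<F>0] by (simp add: emeasure_eq_measure)
    fix S :: "real set" and B :: "real \<Rightarrow> 'a option set" assume *: "finite S" "S \<subseteq> {0..}" "\<And>s. B s \<in> sets cpt_borel"
    \<comment> \<open>Inserting 1 keeps t positive when \<open>S\<close> is empty or {0}; absolute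
      continuity is available only at positive times.\<close>
    define t where "t = Max (insert 1 S)"
    have "1 \<le> t" unfolding t_def using *(1) by (intro Max_ge) auto
    moreover have "s \<le> t" if "s \<in> S" for s
      unfolding t_def using *(1) that by (intro Max_ge) auto
    ultimately have t: "0 < t" "\<And>s. s \<in> S \<Longrightarrow> s \<le> t" by auto
    have "cylinder X S B \<in> sets (natural_filtration X (ennreal t))"
      using * t by (intro cylinder_natural) (auto intro: ennreal_leI)
    then have "cylinder X S B \<in> sets (\<F> (ennreal t))" using natural_subset_completed by blast
    from indep[OF t(1) this] cylinder_F0[OF *]
    show "emeasure (distr (restrict_P x H) \<F>0 (\<lambda>\<omega>. \<omega>)) (cylinder X S B) =
      emeasure (density (P x) (\<lambda>_. ennreal c)) (cylinder X S B)"
      by (simp add: em Int_commute emeasure_density_const)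
  qed simp_all
  \<comment> \<open>\<open>H\<close> belongs only to the completion. Independence is applied to its
    \<open>\<F>0\<close>-measurable part, which lies in \<open>H\<close> and has the same
    probability.\<close>
  moreover define B where "B = main_part (P x) H"
  have B: "B \<in> sets \<F>0" using main_part_sets[OF HC[of x]] by (simp add: B_def)
  ultimately have "emeasure (distr (restrict_P x H) \<F>0 (\<lambda>\<omega>. \<omega>)) B = ennreal c * emeasure (P x) B"
    by (simp add: emeasure_density_const)
  moreover have "emeasure (distr (restrict_P x H) \<F>0 (\<lambda>\<omega>. \<omega>)) B = emeasure (completion (P x)) (H \<inter> B)"
    using B emeasure_restrict_P[OF H B, of x]
    by (subst emeasure_distr) (auto intro!: measurable_restrict_P)
  moreover have "H \<inter> B = B" using main_part_null_part_Un[OF HC[of x]] by (auto simp: B_def)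
  moreover have "emeasure (P x) B = ennreal c"
    using int_H[of x] HC[of x] nn_integral_completion[of "P x" "indicator H"]
    by (simp add: B_def emeasure_completion)
  moreover have "emeasure (completion (P x)) B = emeasure (P x) B" using B by simp
  ultimately have "ennreal c = ennreal (c * c)" using c0 by (simp add: ennreal_mult)
  then show ?thesis using c0 by (auto simp: mult_nonneg_nonneg)
qed

end

text \<open>Fatou's lemma from below and its reverse, with dominating constant 1, from above. The
  limit is described only almost everywhere, which is how the path formulas provide it
  later.\<close>

lemma nn_integral_bounded_convergence:
  fixes u :: "nat \<Rightarrow> 'b \<Rightarrow> ennreal"
  assumes "finite_measure M" and u[measurable]: "\<And>n. u n \<in> borel_measurable M"
    and bound: "\<And>n. AE x in M. u n x \<le> 1" and lim: "AE x in M. (\<lambda>n. u n x) \<longlonglongrightarrow> v x"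
  shows "(\<lambda>n. \<integral>\<^sup>+x. u n x \<partial>M) \<longlonglongrightarrow> (\<integral>\<^sup>+x. v x \<partial>M)"
proof -
  interpret finite_measure M by fact
  have "(\<integral>\<^sup>+x. v x \<partial>M) = (\<integral>\<^sup>+x. liminf (\<lambda>n. u n x) \<partial>M)"
    using lim by (intro nn_integral_cong_AE) (auto elim!: eventually_mono dest: lim_imp_Liminf[rotated])
  also have "\<dots> \<le> liminf (\<lambda>n. \<integral>\<^sup>+x. u n x \<partial>M)"
    by (rule nn_integral_liminf) simp
  finally have 1: "(\<integral>\<^sup>+x. v x \<partial>M) \<le> liminf (\<lambda>n. \<integral>\<^sup>+x. u n x \<partial>M)" .
  have "limsup (\<lambda>n. \<integral>\<^sup>+x. u n x \<partial>M) \<le> (\<integral>\<^sup>+x. limsup (\<lambda>n. u n x) \<partial>M)"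
    using bound by (intro nn_integral_limsup[where w="\<lambda>_. 1"]) (simp_all add: emeasure_eq_measure)
  also have "\<dots> = (\<integral>\<^sup>+x. v x \<partial>M)"
    using lim by (intro nn_integral_cong_AE) (auto elim!: eventually_mono dest: lim_imp_Limsup[rotated])
  finally have "limsup (\<lambda>n. \<integral>\<^sup>+x. u n x \<partial>M) \<le> (\<integral>\<^sup>+x. v x \<partial>M)" .
  then show ?thesis
    using 1 Liminf_le_Limsup[of sequentially "\<lambda>n. \<integral>\<^sup>+x. u n x \<partial>M"]
    by (intro Liminf_eq_Limsup) auto
qed

lemma measurable_exp_neg [measurable]: "exp_neg \<in> borel_measurable borel"
  unfolding exp_neg_def[abs_def] by measurable

lemma exp_neg_le_1: "exp_neg a \<le> 1"
  by (auto simp: exp_neg_def ennreal_le_1)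

section \<open>Additive functionals and the zero-one law for the total mass\<close>

locale additive_functional = strong_feller_hunt_process P X \<theta> m p
  for P :: "'a::{metric_space, second_countable_topology} \<Rightarrow> 'w measure"
    and X :: "real \<Rightarrow> 'w \<Rightarrow> 'a option"
    and \<theta> :: "real \<Rightarrow> 'w \<Rightarrow> 'w" and m p +
  fixes A :: "real \<Rightarrow> 'w \<Rightarrow> ennreal" and \<Lambda> :: "'w set"
  assumes A_measurable: "0 \<le> t \<Longrightarrow> A t \<in> borel_measurable (\<F> (ennreal t))"
    and \<Lambda>_sets: "\<Lambda> \<in> sets (\<F> \<infinity>)"
    and \<Lambda>_Prob: "Prob P x \<Lambda> = 1"
    and \<Lambda>_shift: "0 \<le> t \<Longrightarrow> \<omega> \<in> \<Lambda> \<Longrightarrow> \<theta> t \<omega> \<in> \<Lambda>"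
    and A_0: "\<omega> \<in> \<Lambda> \<Longrightarrow> A 0 \<omega> = 0"
    and A_cont: "\<omega> \<in> \<Lambda> \<Longrightarrow> continuous_on {0..} (\<lambda>t. A t \<omega>)"
    and A_finite: "\<omega> \<in> \<Lambda> \<Longrightarrow> 0 \<le> t \<Longrightarrow> ennreal t < lifetime X \<omega> \<Longrightarrow> A t \<omega> < \<infinity>"
    and A_add: "\<omega> \<in> \<Lambda> \<Longrightarrow> 0 \<le> t \<Longrightarrow> 0 \<le> s \<Longrightarrow> A (t + s) \<omega> = A t \<omega> + A s (\<theta> t \<omega>)"
begin

text \<open>A countable supremum gives measurability at once; on the defining set, where A is
  monotone, it is the limit used by \<open>af_at\<close>.\<close>

definition A_total :: "'w \<Rightarrow> ennreal" where
  "A_total \<omega> = (SUP n. A (real n) \<omega>)"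

lemma A_measurable_infty: "0 \<le> t \<Longrightarrow> A t \<in> borel_measurable (\<F> \<infinity>)"
  using A_measurable[of t] completed_mono[of "ennreal t" \<infinity>] by (auto simp: measurable_def)

lemma A_measurable_C [measurable (raw)]: "0 \<le> t \<Longrightarrow> A t \<in> borel_measurable (completion (P x))"
  by (rule measurable_completed_C[OF A_measurable])

lemma A_total_measurable: "A_total \<in> borel_measurable (\<F> \<infinity>)"
proof -
  have [measurable]: "A (real n) \<in> borel_measurable (\<F> \<infinity>)" for n
    by (rule A_measurable_infty) simp
  show ?thesis unfolding A_total_def[abs_def] by measurable
qed

lemma A_total_measurable_C [measurable]: "A_total \<in> borel_measurable (completion (P x))"
  by (rule measurable_completed_C[OF A_total_measurable])

lemma AE_\<Lambda>: "AE \<omega> in P x. \<omega> \<in> \<Lambda>"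
  by (rule AE_P_Prob1[OF \<Lambda>_Prob])

lemma A_mono: "\<omega> \<in> \<Lambda> \<Longrightarrow> 0 \<le> s \<Longrightarrow> s \<le> t \<Longrightarrow> A s \<omega> \<le> A t \<omega>"
  using A_add[of \<omega> s "t - s"] by simp

lemma A_le_total: "\<omega> \<in> \<Lambda> \<Longrightarrow> 0 \<le> t \<Longrightarrow> A t \<omega> \<le> A_total \<omega>"
proof -
  assume "\<omega> \<in> \<Lambda>" "0 \<le> t"
  then have "A t \<omega> \<le> A (real (nat \<lceil>t\<rceil>)) \<omega>" by (intro A_mono) linarith+
  also have "\<dots> \<le> A_total \<omega>" unfolding A_total_def by (rule SUP_upper) simp
  finally show ?thesis .
qed

lemma A_tendsto_total:
  assumes "\<omega> \<in> \<Lambda>"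
  shows "((\<lambda>t. A t \<omega>) \<longlongrightarrow> A_total \<omega>) at_top"
proof (rule order_tendstoI)
  fix a assume "a < A_total \<omega>"
  then obtain n where n: "a < A (real n) \<omega>" by (auto simp: A_total_def less_SUP_iff)
  have "a < A t \<omega>" if "real n \<le> t" for t
    using A_mono[OF assms, of "real n" t] that n by auto
  then show "\<forall>\<^sub>F t in at_top. a < A t \<omega>" by (rule eventually_at_top_linorderI)
next
  fix a assume a: "A_total \<omega> < a"
  have "A t \<omega> < a" if "0 \<le> t" for t
    using A_le_total[OF assms that] a by auto
  then show "\<forall>\<^sub>F t in at_top. A t \<omega> < a" by (rule eventually_at_top_linorderI)
qed

lemma af_at_infty: "\<omega> \<in> \<Lambda> \<Longrightarrow> af_at A \<top> \<omega> = A_total \<omega>"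
  unfolding af_at_def by (simp add: tendsto_Lim[OF _ A_tendsto_total])

lemma A_total_shift:
  assumes \<omega>: "\<omega> \<in> \<Lambda>" and t: "0 \<le> t"
  shows "A_total \<omega> = A t \<omega> + A_total (\<theta> t \<omega>)"
proof -
  have "A t \<omega> + A_total (\<theta> t \<omega>) = (SUP n. A (t + real n) \<omega>)"
    unfolding A_total_def using \<omega> t by (subst ennreal_SUP_add_right) (auto simp: A_add)
  also have "\<dots> = A_total \<omega>"
  proof (rule antisym)
    show "(SUP n. A (t + real n) \<omega>) \<le> A_total \<omega>"
      using t by (intro SUP_least A_le_total[OF \<omega>]) auto
    show "A_total \<omega> \<le> (SUP n. A (t + real n) \<omega>)"
      unfolding A_total_def using t \<omega> by (intro SUP_subset_mono A_mono) auto
  qed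
  finally show ?thesis by simp
qed

text \<open>\<open>af_at A \<infinity>\<close> is controlled only on the defining set. Events about
  it are measurable in the completion because they differ by null sets from events about
  \<open>A_total\<close>.\<close>

lemma Prob_eq_AE:
  assumes "S \<in> sets (completion (P x))" "AE \<omega> in P x. \<omega> \<in> S \<longleftrightarrow> \<omega> \<in> T"
  shows "T \<in> sets (completion (P x))" "Prob P x T = Prob P x S"
proof -
  have ae: "AE \<omega> in completion (P x). \<omega> \<in> S \<longleftrightarrow> \<omega> \<in> T"
    using assms(2) by (rule AE_completion)
  then show T: "T \<in> sets (completion (P x))"
    using assms(1) by (rule completion.in_sets_AE) simp
  show "Prob P x T = Prob P x S"
    unfolding Prob_def by (intro measure_eq_AE assms(1) T) (use ae in auto)
qed

lemma total_finite_sets: "{\<omega>. A_total \<omega> < \<infinity>} \<in> sets (\<F> \<infinity>)"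
  using measurable_sets[OF A_total_measurable, of "{..<\<infinity>}"] by (simp add: vimage_def)

text \<open>The lifetime being infinite, A is finite at each finite time. A shift therefore removes
  only a finite amount of mass, so that finiteness of the total is shift-invariant and the zero-one
  law applies.\<close>

lemma total_infinite_or_finite:
  assumes "\<And>x. Prob P x {\<omega>. af_at A \<infinity> \<omega> < \<infinity>} = c"
  shows "(\<forall>x. Prob P x {\<omega>. af_at A \<infinity> \<omega> = \<infinity>} = 1) \<or> (\<forall>x. AE \<omega> in P x. A_total \<omega> < \<infinity>)"
proof -
  let ?H = "{\<omega>. A_total \<omega> < \<infinity>}"
  have HC: "?H \<in> sets (completion (P x))" for x
    using total_finite_sets completed_subset_C by blast
  have c: "Prob P x ?H = c" for x
  proof -
    have "AE \<omega> in P x. \<omega> \<in> ?H \<longleftrightarrow> \<omega> \<in> {\<omega>. af_at A \<infinity> \<omega> < \<infinity>}"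
      using AE_\<Lambda> by eventually_elim (simp add: af_at_infty)
    from Prob_eq_AE(2)[OF HC this] show ?thesis using assms by simp
  qed
  have "c = 0 \<or> c = 1"
  proof (rule invariant_zero_one[OF total_finite_sets _ c])
    fix x and t :: real assume "0 < t"
    show "AE \<omega> in P x. \<theta> t \<omega> \<in> ?H \<longleftrightarrow> \<omega> \<in> ?H"
      using AE_\<Lambda> AE_lifetime
    proof eventually_elim
      case (elim \<omega>)
      then have "A t \<omega> < \<top>" using \<open>0 < t\<close> A_finite[of \<omega> t] by simp
      moreover have "A_total \<omega> = A t \<omega> + A_total (\<theta> t \<omega>)"
        using elim \<open>0 < t\<close> by (intro A_total_shift) auto
      ultimately show ?case by (metis ennreal_add_less_top infinity_ennreal_def mem_Collect_eq)
    qed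
  qed
  then show ?thesis
  proof
    assume "c = 0"
    show ?thesis
    proof (intro disjI1 allI)
      fix x
      interpret C: prob_space "completion (P x)" by (rule prob_space_C)
      have "AE \<omega> in completion (P x). \<omega> \<notin> ?H"
        using c[of x] HC[of x] \<open>c = 0\<close> C.prob_eq_0[of ?H] by (simp add: Prob_def)
      then have "AE \<omega> in P x. \<omega> \<notin> ?H" by (simp add: AE_completion_iff)
      then have "AE \<omega> in P x. \<omega> \<in> UNIV \<longleftrightarrow> \<omega> \<in> {\<omega>. af_at A \<infinity> \<omega> = \<infinity>}"
        using AE_\<Lambda> by eventually_elim (simp add: af_at_infty not_less top_unique)
      moreover have "UNIV \<in> sets (completion (P x))"
        using sets.top[of "completion (P x)"] by simp
      ultimately have "Prob P x {\<omega>. af_at A \<infinity> \<omega> = \<infinity>} = Prob P x UNIV"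
        by (intro Prob_eq_AE(2))
      then show "Prob P x {\<omega>. af_at A \<infinity> \<omega> = \<infinity>} = 1"
        using C.prob_space by (simp add: Prob_def)
    qed
  next
    assume "c = 1"
    then show ?thesis using AE_P_Prob1[of _ ?H] c by auto
  qed
qed

end

section \<open>Functionals of finite total mass and their Laplace functional\<close>

locale finite_additive_functional = additive_functional P X \<theta> m p A \<Lambda>
  for P :: "'a::{metric_space, second_countable_topology} \<Rightarrow> 'w measure"
    and X :: "real \<Rightarrow> 'w \<Rightarrow> 'a option"
    and \<theta> :: "real \<Rightarrow> 'w \<Rightarrow> 'w" and m p
    and A :: "real \<Rightarrow> 'w \<Rightarrow> ennreal" and \<Lambda> :: "'w set" +
  assumes total_finite: "AE \<omega> in P x. A_total \<omega> < \<infinity>"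
begin

text \<open>The clamp at 0 supplies the values at negative times that
  \<open>continuous_clock\<close> requires.\<close>

definition path :: "'w \<Rightarrow> real \<Rightarrow> real" where
  "path \<omega> t = enn2real (A (max 0 t) \<omega>)"

definition total :: "'w \<Rightarrow> real" where
  "total \<omega> = enn2real (A_total \<omega>)"

definition regular :: "'w \<Rightarrow> bool" where
  "regular \<omega> \<longleftrightarrow> \<omega> \<in> \<Lambda> \<and> lifetime X \<omega> = \<infinity> \<and> A_total \<omega> < \<infinity> \<and> (\<forall>t\<ge>0. X t \<omega> = Some (Y t \<omega>))"

definition Z :: "'w \<Rightarrow> ennreal" where
  "Z \<omega> = exp_neg (A_total \<omega>)"

text \<open>On regular paths and for t >= 0 this is \<open>Z\<close> after the shift by t, the
  remaining mass being A_\<infinity> - A_t. In this form it is visibly continuous in t.\<close>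

definition R :: "real \<Rightarrow> 'w \<Rightarrow> ennreal" where
  "R t \<omega> = ennreal (exp (path \<omega> t - total \<omega>))"

definition g :: "'a \<Rightarrow> ennreal" where
  "g x = (\<integral>\<^sup>+\<omega>. Z \<omega> \<partial>P x)"

lemma AE_regular: "AE \<omega> in P x. regular \<omega>"
  using AE_\<Lambda> AE_lifetime total_finite AE_alive by eventually_elim (simp add: regular_def)

lemma Z_measurable: "Z \<in> borel_measurable (\<F> \<infinity>)"
  unfolding Z_def[abs_def] by (rule measurable_compose[OF A_total_measurable measurable_exp_neg])

lemma Z_measurable_C [measurable]: "Z \<in> borel_measurable (completion (P x))"
  by (rule measurable_completed_C[OF Z_measurable])

lemma R_measurable_C [measurable]: "R t \<in> borel_measurable (completion (P x))"
  unfolding R_def[abs_def] path_def total_def by measurable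

lemma laplace_total_eq: "laplace_total P X A x = g x"
  unfolding laplace_total_def Expect_def g_def nn_integral_completion
  using AE_regular[of x]
  by (intro nn_integral_cong_AE, eventually_elim) (auto simp: regular_def Z_def af_at_infty)

lemma g_le_1: "g x \<le> 1"
proof -
  have "g x \<le> (\<integral>\<^sup>+\<omega>. 1 \<partial>P x)" unfolding g_def Z_def by (intro nn_integral_mono exp_neg_le_1)
  then show ?thesis using prob_space.emeasure_space_1[OF prob_space_P[of x]] by simp
qed

context
  fixes \<omega> assumes reg: "regular \<omega>"
begin

lemma A_eq_path: "0 \<le> t \<Longrightarrow> A t \<omega> = ennreal (path \<omega> t)"
  using reg A_finite[of \<omega> t] by (simp add: regular_def path_def)

lemma A_total_eq: "A_total \<omega> = ennreal (total \<omega>)"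
  using reg by (simp add: regular_def total_def)

lemma path_nonneg: "0 \<le> path \<omega> t" "0 \<le> total \<omega>"
  by (simp_all add: path_def total_def)

lemma path_le_total: "path \<omega> t \<le> total \<omega>"
proof -
  have max: "path \<omega> (max 0 t) = path \<omega> t" by (simp add: path_def)
  have "ennreal (path \<omega> t) \<le> ennreal (total \<omega>)"
    using A_le_total[of \<omega> "max 0 t"] reg A_eq_path[of "max 0 t"] A_total_eq max
    by (simp add: regular_def)
  then show ?thesis using path_nonneg by (simp add: ennreal_le_iff)
qed

lemma R_le_1: "R t \<omega> \<le> 1"
  using path_le_total by (simp add: R_def)

lemma path_clock: "continuous_clock (path \<omega>)"
proof
  have fin: "A t \<omega> = ennreal (enn2real (A t \<omega>))" if "0 \<le> t" for t
    using A_eq_path[OF that] path_nonneg(1)[of t] by simp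
  have "continuous_on {0..} (\<lambda>t. enn2real (A t \<omega>))"
    unfolding continuous_on_def
  proof
    fix t :: real assume t: "t \<in> {0..}"
    have "((\<lambda>t. A t \<omega>) \<longlongrightarrow> A t \<omega>) (at t within {0..})"
      using A_cont[of \<omega>] reg t by (simp add: regular_def continuous_on_def)
    then show "((\<lambda>t. enn2real (A t \<omega>)) \<longlongrightarrow> enn2real (A t \<omega>)) (at t within {0..})"
      using t fin[of t] by (intro tendsto_enn2real) auto
  qed
  then show "continuous_on UNIV (path \<omega>)"
    unfolding path_def[abs_def] by (rule continuous_on_compose2) (auto intro!: continuous_intros)
  show "path \<omega> s \<le> path \<omega> t" if "s \<le> t" for s t
    unfolding path_def using that reg A_finite[of \<omega> "max 0 t"]
    by (intro enn2real_mono A_mono) (auto simp: regular_def max_def)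
  show "path \<omega> t = 0" if "t \<le> 0" for t
    using that A_0[of \<omega>] reg by (simp add: path_def regular_def max_def)
qed

lemma Z_shift:
  assumes t: "0 \<le> t"
  shows "Z (\<theta> t \<omega>) = R t \<omega>"
proof -
  have "ennreal (total \<omega>) = ennreal (path \<omega> t) + A_total (\<theta> t \<omega>)"
    using A_total_shift[of \<omega> t] reg t A_eq_path[OF t] A_total_eq by (simp add: regular_def)
  then have "A_total (\<theta> t \<omega>) = ennreal (total \<omega> - path \<omega> t)"
    using path_nonneg path_le_total[of t]
    by (cases "A_total (\<theta> t \<omega>)") (auto simp: ennreal_plus[symmetric] simp del: ennreal_plus)
  then show ?thesis
    using path_le_total[of t] by (simp add: Z_def exp_neg_def R_def)
qed

lemma Z_eq: "Z \<omega> = ennreal (exp (- total \<omega>))"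
  using A_total_eq path_nonneg by (simp add: Z_def exp_neg_def)

lemma path_0: "path \<omega> 0 = 0"
  using continuous_clock.r_nonpos[OF path_clock, of 0] by simp

lemma Y_right_continuous: "0 \<le> t \<Longrightarrow> continuous (at t within {t..}) (\<lambda>s. Y s \<omega>)"
  using limitin_cpt_top_SomeD[of "\<lambda>s. X s \<omega>" "Y t \<omega>" "at_right t"] right_continuous[of t \<omega>] reg
  by (simp add: continuous_within at_within_Ici_at_right regular_def flip: Y_def)

lemma Y_tendsto:
  assumes "0 \<le> t" "\<And>n. t \<le> s n" "s \<longlonglongrightarrow> t"
  shows "(\<lambda>n. Y (s n) \<omega>) \<longlonglongrightarrow> Y t \<omega>"
  using Y_right_continuous[OF assms(1)] assms(2,3) unfolding continuous_within_sequentially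
  by (auto simp: o_def)

text \<open>A right-continuous path is the limit of step functions that read it at a grid point to
  the right of t; the floor plus one keeps the approach on that side.\<close>

lemma measurable_path_Y: "(\<lambda>t. Y (max 0 t) \<omega>) \<in> borel_measurable borel"
proof (rule borel_measurable_LIMSEQ_metric)
  let ?s = "\<lambda>n t. (real_of_int \<lfloor>real (Suc n) * max 0 t\<rfloor> + 1) / real (Suc n)"
  have grid: "y \<le> (real_of_int \<lfloor>c * y\<rfloor> + 1) / c" "(real_of_int \<lfloor>c * y\<rfloor> + 1) / c \<le> y + 1 / c"
    if "0 < c" for y c :: real
    using that by (simp_all add: field_simps) linarith+
  show "(\<lambda>t. Y (?s n t) \<omega>) \<in> borel_measurable borel" for n
    by (rule measurable_compose_countable[where f="\<lambda>k _. Y ((real_of_int k + 1) / real (Suc n)) \<omega>"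
          and g="\<lambda>t. \<lfloor>real (Suc n) * max 0 t\<rfloor>"]) measurable
  fix t :: real
  show "(\<lambda>n. Y (?s n t) \<omega>) \<longlonglongrightarrow> Y (max 0 t) \<omega>"
  proof (rule Y_tendsto)
    show le: "max 0 t \<le> ?s n t" for n by (rule grid) simp
    have ge: "?s n t \<le> max 0 t + 1 / real (Suc n)" for n by (rule grid) simp
    have "(\<lambda>n. max 0 t + 1 / real (Suc n)) \<longlonglongrightarrow> max 0 t"
      using LIMSEQ_inverse_real_of_nat_add[of "max 0 t"] by (simp only: inverse_eq_divide)
    then show "(\<lambda>n. ?s n t) \<longlonglongrightarrow> max 0 t"
      by (rule tendsto_sandwich[OF always_eventually[OF allI[OF le]] always_eventually[OF allI[OF ge]] tendsto_const])
  qed simp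
qed

end

text \<open>\<open>G\<close> stands in for \<open>g\<close> until the latter is known to be Borel.
  Truncation at 1 changes nothing m-a.e. and provides the bound for the strong Feller
  property.\<close>

lemma g_version: "\<exists>G\<in>borel_measurable borel. (\<forall>y. G y \<le> 1) \<and> (AE y in m. G y = g y) \<and>
  (\<forall>x t. \<forall>S\<in>sets (\<F> (ennreal t)). 0 < t \<longrightarrow>
    (\<integral>\<^sup>+\<omega>. indicator S \<omega> * Z (\<theta> t \<omega>) \<partial>P x) = (\<integral>\<^sup>+\<omega>. indicator S \<omega> * G (Y t \<omega>) \<partial>P x))"
proof -
  obtain Z' where Z': "Z' \<in> borel_measurable \<F>0" "AE y in m. (\<integral>\<^sup>+\<omega>. Z' \<omega> \<partial>P y) = (\<integral>\<^sup>+\<omega>. Z \<omega> \<partial>P y)"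
    "\<And>x s. 0 < s \<Longrightarrow> AE \<omega> in P x. Z (\<theta> s \<omega>) = Z' (\<theta> s \<omega>)"
    using completed_version[OF Z_measurable] by blast
  define G where "G y = min 1 (\<integral>\<^sup>+\<omega>. Z' \<omega> \<partial>P y)" for y
  have "(\<lambda>y. \<integral>\<^sup>+\<omega>. Z' \<omega> \<partial>P y) \<in> borel_measurable borel"
    by (rule measurable_compose[OF kernel_subprob nn_integral_measurable_subprob_algebra[OF Z'(1)]])
  then have G: "G \<in> borel_measurable borel" unfolding G_def by measurable
  have ae: "AE y in m. (\<integral>\<^sup>+\<omega>. Z' \<omega> \<partial>P y) = G y \<and> G y = g y"
    using Z'(2) g_le_1 by (auto elim!: eventually_mono simp: G_def g_def)
  show ?thesis
  proof (intro bexI[OF _ G] conjI allI ballI impI)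
    show "G y \<le> 1" for y by (simp add: G_def)
    show "AE y in m. G y = g y" using ae by eventually_elim simp
    fix x t S assume t: "0 < t" and S: "S \<in> sets (\<F> (ennreal t))"
    have "(\<integral>\<^sup>+\<omega>. indicator S \<omega> * Z (\<theta> t \<omega>) \<partial>P x) = (\<integral>\<^sup>+\<omega>. indicator S \<omega> * Z' (\<theta> t \<omega>) \<partial>P x)"
      using Z'(3)[OF t, of x] by (intro nn_integral_cong_AE) (auto elim!: eventually_mono)
    also have "\<dots> = (\<integral>\<^sup>+\<omega>. indicator S \<omega> * (\<integral>\<^sup>+\<omega>'. Z' \<omega>' \<partial>P (Y t \<omega>)) \<partial>P x)"
      using t S Z'(1) by (intro nn_integral_markov) auto
    also have "\<dots> = (\<integral>\<^sup>+\<omega>. indicator S \<omega> * G (Y t \<omega>) \<partial>P x)"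
      using AE_Y[OF t ae, of x] by (intro nn_integral_cong_AE) (auto elim!: eventually_mono)
    finally show "(\<integral>\<^sup>+\<omega>. indicator S \<omega> * Z (\<theta> t \<omega>) \<partial>P x) = (\<integral>\<^sup>+\<omega>. indicator S \<omega> * G (Y t \<omega>) \<partial>P x)" .
  qed
qed

definition G :: "'a \<Rightarrow> ennreal" where
  "G = (SOME G. G \<in> borel_measurable borel \<and> (\<forall>y. G y \<le> 1) \<and> (AE y in m. G y = g y) \<and>
    (\<forall>x t. \<forall>S\<in>sets (\<F> (ennreal t)). 0 < t \<longrightarrow>
      (\<integral>\<^sup>+\<omega>. indicator S \<omega> * Z (\<theta> t \<omega>) \<partial>P x) = (\<integral>\<^sup>+\<omega>. indicator S \<omega> * G (Y t \<omega>) \<partial>P x)))"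

lemma
  shows G_measurable [measurable]: "G \<in> borel_measurable borel"
    and G_le_1: "G y \<le> 1"
    and AE_G: "AE y in m. G y = g y"
    and markov_G: "0 < t \<Longrightarrow> S \<in> sets (\<F> (ennreal t)) \<Longrightarrow>
      (\<integral>\<^sup>+\<omega>. indicator S \<omega> * Z (\<theta> t \<omega>) \<partial>P x) = (\<integral>\<^sup>+\<omega>. indicator S \<omega> * G (Y t \<omega>) \<partial>P x)"
  using someI_ex[OF g_version[unfolded Bex_def], folded G_def] by blast+

text \<open>For s > 0 this is p_s g: by absolute continuity the semigroup does not distinguish
  \<open>G\<close> from \<open>g\<close>.\<close>

definition q :: "real \<Rightarrow> 'a \<Rightarrow> ennreal" where
  "q s = trans_nn P X s G"

lemma q_le_1: "0 < s \<Longrightarrow> q s x \<le> 1"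
  unfolding q_def by (rule trans_nn_le_1) (auto simp: G_le_1)

lemma q_continuous: "0 < s \<Longrightarrow> continuous_on UNIV (q s)"
  unfolding q_def by (rule continuous_trans_nn) (auto simp: G_le_1)

lemma q_measurable [measurable (raw)]: "0 < s \<Longrightarrow> q s \<in> borel_measurable borel"
  by (intro borel_measurable_continuous_onI q_continuous)

text \<open>Two conditionings: from \<open>Z\<close> after the shift by t + s to \<open>G\<close> of
  the position at t + s, then by the semigroup to time t. \<open>G\<close> enters only at the
  positive time t + s, so the grid point t = 0 is covered.\<close>

lemma markov_q:
  assumes t: "0 \<le> t" "0 < s" and S: "S \<in> sets (\<F> (ennreal t))"
  shows "(\<integral>\<^sup>+\<omega>. indicator S \<omega> * q s (Y t \<omega>) \<partial>P x) = (\<integral>\<^sup>+\<omega>. indicator S \<omega> * R (t + s) \<omega> \<partial>P x)"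
proof -
  have S': "S \<in> sets (\<F> (ennreal (t + s)))"
    using S completed_mono[of "ennreal t" "ennreal (t + s)"] t by (auto simp: ennreal_leI)
  have q: "q s (Y t \<omega>) = (\<integral>\<^sup>+\<omega>'. G (the (X s \<omega>')) \<partial>P (Y t \<omega>))" for \<omega>
    using t by (simp add: q_def trans_nn_eq Y_def)
  have f: "(\<lambda>z. G (the z)) \<in> borel_measurable cpt_borel" by measurable
  have meas: "(\<lambda>\<omega>. q s (Y t \<omega>)) \<in> borel_measurable (completion (P x))"
    "(\<lambda>\<omega>. G (the (X (t + s) \<omega>))) \<in> borel_measurable (completion (P x))"
    using t measurable_compose[OF measurable_Y_C q_measurable]
      measurable_compose[OF measurable_X_C f, of "t + s"] by auto
  have "(\<integral>\<^sup>+\<omega>. indicator S \<omega> * q s (Y t \<omega>) \<partial>P x) = (\<integral>\<^sup>+\<omega>. q s (Y t \<omega>) \<partial>restrict_P x S)"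
    by (rule nn_integral_restrict_P[OF S meas(1), symmetric])
  also have "\<dots> = (\<integral>\<^sup>+\<omega>. G (the (X (t + s) \<omega>)) \<partial>restrict_P x S)"
    unfolding q using t by (intro nn_integral_markov_marginal[OF S _ _ f, symmetric]) auto
  also have "\<dots> = (\<integral>\<^sup>+\<omega>. indicator S \<omega> * G (Y (t + s) \<omega>) \<partial>P x)"
    unfolding Y_def by (rule nn_integral_restrict_P[OF S meas(2)])
  also have "\<dots> = (\<integral>\<^sup>+\<omega>. indicator S \<omega> * Z (\<theta> (t + s) \<omega>) \<partial>P x)"
    using t S' by (intro markov_G[symmetric]) auto
  also have "\<dots> = (\<integral>\<^sup>+\<omega>. indicator S \<omega> * R (t + s) \<omega> \<partial>P x)"
    using AE_regular[of x] t by (intro nn_integral_cong_AE) (auto elim!: eventually_mono simp: Z_shift)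
  finally show ?thesis .
qed

lemma q_eq: "0 < s \<Longrightarrow> q s x = (\<integral>\<^sup>+\<omega>. R s \<omega> \<partial>P x)"
proof -
  assume s: "0 < s"
  have "q s x = (\<integral>\<^sup>+\<omega>. indicator UNIV \<omega> * G (Y s \<omega>) \<partial>P x)"
    using s by (simp add: q_def trans_nn_eq)
  also have "\<dots> = (\<integral>\<^sup>+\<omega>. indicator UNIV \<omega> * Z (\<theta> s \<omega>) \<partial>P x)"
    using s sets.top[of "\<F> (ennreal s)"] by (intro markov_G[symmetric]) auto
  also have "\<dots> = (\<integral>\<^sup>+\<omega>. R s \<omega> \<partial>P x)"
    using AE_regular[of x] s by (intro nn_integral_cong_AE) (auto elim!: eventually_mono simp: Z_shift)
  finally show ?thesis .
qed

lemma R_tendsto: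
  assumes "regular \<omega>" "s \<longlonglongrightarrow> t"
  shows "(\<lambda>n. R (s n) \<omega>) \<longlonglongrightarrow> R t \<omega>"
proof -
  interpret continuous_clock "path \<omega>" by (rule path_clock[OF assms(1)])
  have "(\<lambda>n. path \<omega> (s n)) \<longlonglongrightarrow> path \<omega> t"
    using cont assms(2) by (auto intro: continuous_on_tendsto_compose)
  then show ?thesis unfolding R_def by (intro tendsto_intros tendsto_ennrealI)
qed

definition eps :: "nat \<Rightarrow> real" where "eps j = 1 / real (Suc j)"

lemma eps_pos: "0 < eps j" and eps_tendsto: "eps \<longlonglongrightarrow> 0"
  using LIMSEQ_inverse_real_of_nat by (simp_all add: eps_def[abs_def] inverse_eq_divide)

lemma finite_measure_C: "finite_measure (completion (P x))"
  using prob_space_C by (rule prob_space.finite_measure)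

text \<open>This holds at every x and not merely m-a.e., because \<open>q_eq\<close> writes p_s g(x)
  as the expectation of \<open>R s\<close>, which tends to \<open>Z\<close> by continuity of A at
  0.\<close>

lemma q_tendsto: "(\<lambda>j. q (eps j) x) \<longlonglongrightarrow> g x"
proof -
  have "(\<lambda>j. \<integral>\<^sup>+\<omega>. R (eps j) \<omega> \<partial>completion (P x)) \<longlonglongrightarrow> (\<integral>\<^sup>+\<omega>. Z \<omega> \<partial>completion (P x))"
  proof (rule nn_integral_bounded_convergence[OF finite_measure_C])
    show "AE \<omega> in completion (P x). R (eps j) \<omega> \<le> 1" for j
      using AE_completion[OF AE_regular] by eventually_elim (rule R_le_1)
    show "AE \<omega> in completion (P x). (\<lambda>j. R (eps j) \<omega>) \<longlonglongrightarrow> Z \<omega>"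
      using AE_completion[OF AE_regular]
    proof eventually_elim
      case (elim \<omega>)
      then show ?case using R_tendsto[OF elim eps_tendsto]
        by (simp add: Z_eq R_def path_0)
    qed
  qed simp
  then show ?thesis by (simp add: q_eq eps_pos g_def nn_integral_completion)
qed

text \<open>\<open>Z\<close> is measurable only for the completed \<sigma>-algebra, so the kernel P
  does not yield this directly; the continuous approximations \<open>q\<close> do.\<close>

lemma g_measurable [measurable]: "g \<in> borel_measurable borel"
  using q_tendsto by (rule borel_measurable_LIMSEQ_order) (simp add: q_measurable eps_pos)

section \<open>Grid approximation of the level times\<close>

text \<open>The event that k/(n+1) is the first point of its grid at which level u has been reached.
  Only values of A up to that point enter, so the event belongs to the past at k/(n+1).\<close>

definition cell :: "nat \<Rightarrow> nat \<Rightarrow> real \<Rightarrow> 'w set" where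
  "cell n k u = {\<omega>. ennreal u \<le> A (real k / real (Suc n)) \<omega> \<and>
    (\<forall>j<k. \<not> ennreal u \<le> A (real j / real (Suc n)) \<omega>)}"

text \<open>The level is reached in finite time. At u = A_\<infinity> this can fail.\<close>

definition hit :: "real \<Rightarrow> 'w \<Rightarrow> bool" where
  "hit u \<omega> \<longleftrightarrow> (\<exists>k. ennreal u \<le> A (real k) \<omega>)"

definition clock :: "'w \<Rightarrow> real \<Rightarrow> real" where
  "clock \<omega> = continuous_clock.clock_inv (path \<omega>)"

definition index :: "'w \<Rightarrow> real \<Rightarrow> nat \<Rightarrow> nat" where
  "index \<omega> u n = (LEAST k. u \<le> path \<omega> (real k / real (Suc n)))"

lemma cell_sets: "cell n k u \<in> sets (\<F> (ennreal (real k / real (Suc n))))" (is "_ \<in> sets ?F")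
proof -
  have [measurable]: "A (real j / real (Suc n)) \<in> borel_measurable ?F" if "j \<le> k" for j
    using A_measurable[of "real j / real (Suc n)"] that
      completed_mono[of "ennreal (real j / real (Suc n))" "ennreal (real k / real (Suc n))"]
    by (auto simp: measurable_def ennreal_leI divide_right_mono)
  have *: "{\<omega>. ennreal u \<le> A (real j / real (Suc n)) \<omega>} \<in> sets ?F" if "j \<le> k" for j
    using measurable_sets[OF \<open>j \<le> k \<Longrightarrow> A (real j / real (Suc n)) \<in> borel_measurable ?F\<close>[OF that], of "{ennreal u..}"]
    by (simp add: vimage_def)
  have "cell n k u = {\<omega>. ennreal u \<le> A (real k / real (Suc n)) \<omega>} - (\<Union>j\<in>{..<k}. {\<omega>. ennreal u \<le> A (real j / real (Suc n)) \<omega>})"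
    by (auto simp: cell_def)
  also have "\<dots> \<in> sets ?F" by (intro sets.Diff sets.finite_UN *) auto
  finally show ?thesis .
qed

context
  fixes \<omega> and u :: real assumes reg: "regular \<omega>" and u: "0 < u"
begin

lemma le_A_iff: "0 \<le> t \<Longrightarrow> ennreal u \<le> A t \<omega> \<longleftrightarrow> u \<le> path \<omega> t"
  using u by (simp add: A_eq_path[OF reg] ennreal_le_iff path_nonneg[OF reg])

lemma hit_iff: "hit u \<omega> \<longleftrightarrow> (\<exists>k. u \<le> path \<omega> (real k))"
  by (simp add: hit_def le_A_iff)

lemma hitI: "0 \<le> t \<Longrightarrow> u \<le> path \<omega> t \<Longrightarrow> hit u \<omega>"
proof -
  assume t: "0 \<le> t" "u \<le> path \<omega> t"
  have "path \<omega> t \<le> path \<omega> (real (nat \<lceil>t\<rceil>))"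
    using t by (intro continuous_clock.r_mono[OF path_clock[OF reg]]) linarith
  then show ?thesis using t unfolding hit_iff by (intro exI[of _ "nat \<lceil>t\<rceil>"]) linarith
qed

lemma clock_le_iff: "hit u \<omega> \<Longrightarrow> clock \<omega> u \<le> t \<longleftrightarrow> u \<le> path \<omega> t"
  unfolding hit_iff clock_def
  using continuous_clock.clock_inv_le_iff[OF path_clock[OF reg] u] by blast

lemma clock_pos: "hit u \<omega> \<Longrightarrow> 0 < clock \<omega> u"
  unfolding hit_iff clock_def
  using continuous_clock.clock_inv_pos[OF path_clock[OF reg] u] by blast

lemma path_clock_eq: "hit u \<omega> \<Longrightarrow> path \<omega> (clock \<omega> u) = u"
  unfolding hit_iff clock_def
  using continuous_clock.clock_inv_eq[OF path_clock[OF reg] u] by blast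

lemma cell_iff: "hit u \<omega> \<Longrightarrow> \<omega> \<in> cell n k u \<longleftrightarrow> k = index \<omega> u n"
  and clock_le_idx: "hit u \<omega> \<Longrightarrow> clock \<omega> u \<le> real (index \<omega> u n) / real (Suc n)"
  and idx_le_clock: "hit u \<omega> \<Longrightarrow> real (index \<omega> u n) / real (Suc n) \<le> clock \<omega> u + eps n"
proof -
  assume h: "hit u \<omega>"
  let ?Q = "\<lambda>k. u \<le> path \<omega> (real k / real (Suc n))"
  obtain k where "u \<le> path \<omega> (real k)" using h by (auto simp: hit_iff)
  \<comment> \<open>The integer time k belongs to every grid, with index k (n + 1), so a level that
    is hit is also seen on the grid.\<close>
  moreover have "real (k * Suc n) / real (Suc n) = real k"
    unfolding of_nat_mult by (simp del: of_nat_Suc)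
  ultimately have "?Q (k * Suc n)" by simp
  then have 1: "?Q (index \<omega> u n)" unfolding index_def by (rule LeastI)
  have 2: "\<not> ?Q j" if "j < index \<omega> u n" for j using that unfolding index_def by (rule not_less_Least)
  show "\<omega> \<in> cell n k u \<longleftrightarrow> k = index \<omega> u n" for k
    using 1 2 by (auto simp: cell_def le_A_iff simp del: of_nat_Suc) (metis linorder_neqE_nat)
  show 3: "clock \<omega> u \<le> real (index \<omega> u n) / real (Suc n)"
    using 1 clock_le_iff[OF h] by blast
  \<comment> \<open>The level time is positive, so the index is not 0; the preceding grid point lies
    before the level time, which bounds the overshoot by one mesh width.\<close>
  obtain j where j: "index \<omega> u n = Suc j"
    using 3 clock_pos[OF h] by (cases "index \<omega> u n") auto
  have "\<not> clock \<omega> u \<le> real j / real (Suc n)"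
    using 2[of j] j clock_le_iff[OF h] by auto
  then show "real (index \<omega> u n) / real (Suc n) \<le> clock \<omega> u + eps n"
    unfolding j eps_def by (simp add: add_divide_distrib)
qed

lemma suminf_cell: "(\<Sum>k. indicator (cell n k u) \<omega> * f k) = (if hit u \<omega> then f (index \<omega> u n) else (0::ennreal))"
proof (cases "hit u \<omega>")
  case True
  then show ?thesis
    by (subst suminf_finite[of "{index \<omega> u n}"]) (auto simp: cell_iff indicator_def)
next
  case False
  then have "\<omega> \<notin> cell n k u" for k
    using hitI[of "real k / real (Suc n)"] by (auto simp: cell_def le_A_iff simp del: of_nat_Suc)
  then show ?thesis using False by (simp add: indicator_def)
qed

lemma idx_tendsto: "hit u \<omega> \<Longrightarrow> (\<lambda>n. real (index \<omega> u n) / real (Suc n)) \<longlonglongrightarrow> clock \<omega> u"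
proof -
  assume h: "hit u \<omega>"
  have "(\<lambda>n. clock \<omega> u + eps n) \<longlonglongrightarrow> clock \<omega> u"
    using tendsto_add[OF tendsto_const eps_tendsto, of "clock \<omega> u"] by simp
  then show ?thesis
    by (rule tendsto_sandwich[OF always_eventually[OF allI[OF clock_le_idx[OF h]]]
          always_eventually[OF allI[OF idx_le_clock[OF h]]] tendsto_const])
qed

end

text \<open>\<open>V n s u\<close> is \<open>p\<^sub>s g\<close> at the position of the process at the first point \<open>t\<close> after \<open>\<tau>\<^sub>u\<close> of
  the grid of width \<open>1/(n+1)\<close>; since \<open>R t = Z \<circ> \<theta>\<^sub>t\<close>, \<open>V' n s u\<close> is \<open>Z \<circ> \<theta>\<^sub>t\<^sub>+\<^sub>s\<close> at the same \<open>t\<close>,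
  and the Markov property at the grid points equates their expectations.\<close>

definition V :: "nat \<Rightarrow> real \<Rightarrow> real \<Rightarrow> 'w \<Rightarrow> ennreal" where
  "V n s u \<omega> = (\<Sum>k. indicator (cell n k u) \<omega> * q s (Y (real k / real (Suc n)) \<omega>))"

definition V' :: "nat \<Rightarrow> real \<Rightarrow> real \<Rightarrow> 'w \<Rightarrow> ennreal" where
  "V' n s u \<omega> = (\<Sum>k. indicator (cell n k u) \<omega> * R (real k / real (Suc n) + s) \<omega>)"

definition L :: "real \<Rightarrow> real \<Rightarrow> 'w \<Rightarrow> ennreal" where
  "L s u \<omega> = liminf (\<lambda>n. V n s u \<omega>)"

definition L' :: "real \<Rightarrow> real \<Rightarrow> 'w \<Rightarrow> ennreal" where
  "L' s u \<omega> = liminf (\<lambda>n. V' n s u \<omega>)"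

text \<open>\<open>g\<close> at the position at the level time, or 0 if the level is not reached
  (\<open>W_eq\<close>). Iterated lower limits make it jointly measurable in level and path, as
  Fubini requires.\<close>

definition W :: "real \<Rightarrow> 'w \<Rightarrow> ennreal" where
  "W u \<omega> = liminf (\<lambda>j. L (eps j) u \<omega>)"

text \<open>Grid points approach the level time from the right, where the path is right-continuous;
  continuity of \<open>q s\<close> carries this over to the values.\<close>

lemma V_tendsto:
  assumes "regular \<omega>" "0 < u" "0 < s"
  shows "(\<lambda>n. V n s u \<omega>) \<longlonglongrightarrow> (if hit u \<omega> then q s (Y (clock \<omega> u) \<omega>) else 0)"
proof -
  have "(\<lambda>n. q s (Y (real (index \<omega> u n) / real (Suc n)) \<omega>)) \<longlonglongrightarrow> q s (Y (clock \<omega> u) \<omega>)" if "hit u \<omega>"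
    using that assms
    by (intro continuous_on_tendsto_compose[OF q_continuous] Y_tendsto idx_tendsto clock_le_idx)
      (auto intro: less_imp_le clock_pos)
  then show ?thesis unfolding V_def suminf_cell[OF assms(1,2)] by auto
qed

lemma V'_tendsto:
  assumes "regular \<omega>" "0 < u"
  shows "(\<lambda>n. V' n s u \<omega>) \<longlonglongrightarrow> (if hit u \<omega> then R (clock \<omega> u + s) \<omega> else 0)"
proof -
  have "(\<lambda>n. R (real (index \<omega> u n) / real (Suc n) + s) \<omega>) \<longlonglongrightarrow> R (clock \<omega> u + s) \<omega>" if "hit u \<omega>"
    using that assms by (intro R_tendsto tendsto_add idx_tendsto tendsto_const)
  then show ?thesis unfolding V'_def suminf_cell[OF assms(1,2)] by auto
qed

lemma V_le_1: "regular \<omega> \<Longrightarrow> 0 < u \<Longrightarrow> 0 < s \<Longrightarrow> V n s u \<omega> \<le> 1"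
  unfolding V_def by (simp add: suminf_cell q_le_1)

lemma V'_le_1: "regular \<omega> \<Longrightarrow> 0 < u \<Longrightarrow> V' n s u \<omega> \<le> 1"
  unfolding V'_def by (simp add: suminf_cell R_le_1)

lemma L_eq: "regular \<omega> \<Longrightarrow> 0 < u \<Longrightarrow> 0 < s \<Longrightarrow> L s u \<omega> = (if hit u \<omega> then q s (Y (clock \<omega> u) \<omega>) else 0)"
  unfolding L_def by (rule lim_imp_Liminf[OF _ V_tendsto]) auto

lemma L'_eq: "regular \<omega> \<Longrightarrow> 0 < u \<Longrightarrow> L' s u \<omega> = (if hit u \<omega> then R (clock \<omega> u + s) \<omega> else 0)"
  unfolding L'_def by (rule lim_imp_Liminf[OF _ V'_tendsto]) auto

lemma L_tendsto:
  "regular \<omega> \<Longrightarrow> 0 < u \<Longrightarrow> (\<lambda>j. L (eps j) u \<omega>) \<longlonglongrightarrow> (if hit u \<omega> then g (Y (clock \<omega> u) \<omega>) else 0)"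
  by (simp add: L_eq eps_pos q_tendsto)

lemma L'_tendsto:
  assumes "regular \<omega>" "0 < u"
  shows "(\<lambda>j. L' (eps j) u \<omega>) \<longlonglongrightarrow> (if hit u \<omega> then ennreal (exp (u - total \<omega>)) else 0)"
proof -
  have "(\<lambda>j. R (clock \<omega> u + eps j) \<omega>) \<longlonglongrightarrow> R (clock \<omega> u + 0) \<omega>"
    using assms by (intro R_tendsto tendsto_add eps_tendsto tendsto_const)
  then show ?thesis
    using assms by (auto simp: L'_eq R_def path_clock_eq)
qed

lemma W_eq: "regular \<omega> \<Longrightarrow> 0 < u \<Longrightarrow> W u \<omega> = (if hit u \<omega> then g (Y (clock \<omega> u) \<omega>) else 0)"
  unfolding W_def by (rule lim_imp_Liminf[OF _ L_tendsto]) auto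

lemma cell_sets_C [measurable]: "cell n k u \<in> sets (completion (P x))"
  using cell_sets completed_subset_C by blast

lemma q_Y_measurable_C: "0 \<le> t \<Longrightarrow> 0 < s \<Longrightarrow> (\<lambda>\<omega>. q s (Y t \<omega>)) \<in> borel_measurable (completion (P x))"
  by (rule measurable_compose[OF measurable_Y_C q_measurable])

lemma V_measurable: "0 < s \<Longrightarrow> V n s u \<in> borel_measurable (completion (P x))"
  unfolding V_def[abs_def]
  by (intro borel_measurable_suminf_order borel_measurable_times_ennreal borel_measurable_indicator
      cell_sets_C q_Y_measurable_C) auto

lemma V'_measurable [measurable]: "V' n s u \<in> borel_measurable (completion (P x))"
  unfolding V'_def[abs_def]
  by (intro borel_measurable_suminf_order borel_measurable_times_ennreal borel_measurable_indicator
      cell_sets_C R_measurable_C)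

lemma integral_V:
  assumes "0 < s"
  shows "(\<integral>\<^sup>+\<omega>. V n s u \<omega> \<partial>completion (P x)) = (\<integral>\<^sup>+\<omega>. V' n s u \<omega> \<partial>completion (P x))"
proof -
  let ?C = "completion (P x)"
  have "(\<integral>\<^sup>+\<omega>. V n s u \<omega> \<partial>?C) = (\<Sum>k. \<integral>\<^sup>+\<omega>. indicator (cell n k u) \<omega> * q s (Y (real k / real (Suc n)) \<omega>) \<partial>?C)"
    unfolding V_def using assms
    by (intro nn_integral_suminf borel_measurable_times_ennreal borel_measurable_indicator
        cell_sets_C q_Y_measurable_C) auto
  also have "\<dots> = (\<Sum>k. \<integral>\<^sup>+\<omega>. indicator (cell n k u) \<omega> * R (real k / real (Suc n) + s) \<omega> \<partial>?C)"
    unfolding nn_integral_completion using assms cell_sets by (subst markov_q) auto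
  also have "\<dots> = (\<integral>\<^sup>+\<omega>. V' n s u \<omega> \<partial>?C)"
    unfolding V'_def by (intro nn_integral_suminf[symmetric]) simp
  finally show ?thesis .
qed

text \<open>The Markov property at the level time, obtained by refining the grid for fixed s and
  then letting s tend to 0. On the side of \<open>R\<close> the limit is explicit because A equals u
  at that time.\<close>

lemma integral_W:
  assumes u: "0 < u"
  shows "(\<integral>\<^sup>+\<omega>. W u \<omega> \<partial>completion (P x)) =
    (\<integral>\<^sup>+\<omega>. (if hit u \<omega> then ennreal (exp (u - total \<omega>)) else 0) \<partial>completion (P x))"
proof -
  let ?C = "completion (P x)"
  note reg = AE_completion[OF AE_regular[of x]]
  have L: "(\<integral>\<^sup>+\<omega>. L s u \<omega> \<partial>?C) = (\<integral>\<^sup>+\<omega>. L' s u \<omega> \<partial>?C)" if s: "0 < s" for s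
  proof (rule LIMSEQ_unique)
    show "(\<lambda>n. \<integral>\<^sup>+\<omega>. V n s u \<omega> \<partial>?C) \<longlonglongrightarrow> (\<integral>\<^sup>+\<omega>. L s u \<omega> \<partial>?C)"
      using reg u s V_tendsto L_eq
      by (intro nn_integral_bounded_convergence[OF finite_measure_C] V_measurable)
        (auto elim!: eventually_mono simp: V_le_1)
    show "(\<lambda>n. \<integral>\<^sup>+\<omega>. V n s u \<omega> \<partial>?C) \<longlonglongrightarrow> (\<integral>\<^sup>+\<omega>. L' s u \<omega> \<partial>?C)"
      unfolding integral_V[OF s] using reg u V'_tendsto L'_eq
      by (intro nn_integral_bounded_convergence[OF finite_measure_C] V'_measurable)
        (auto elim!: eventually_mono simp: V'_le_1)
  qed
  have Lm: "L s u \<in> borel_measurable ?C" if "0 < s" for s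
    unfolding L_def[abs_def] using V_measurable[OF that] by (intro borel_measurable_liminf)
  have L'm: "L' s u \<in> borel_measurable ?C" for s
    unfolding L'_def[abs_def] by (intro borel_measurable_liminf V'_measurable)
  show ?thesis
  proof (rule LIMSEQ_unique)
    show "(\<lambda>j. \<integral>\<^sup>+\<omega>. L (eps j) u \<omega> \<partial>?C) \<longlonglongrightarrow> (\<integral>\<^sup>+\<omega>. W u \<omega> \<partial>?C)"
      using reg u L_tendsto W_eq eps_pos
      by (intro nn_integral_bounded_convergence[OF finite_measure_C] Lm)
        (auto elim!: eventually_mono simp: L_eq q_le_1)
    show "(\<lambda>j. \<integral>\<^sup>+\<omega>. L (eps j) u \<omega> \<partial>?C) \<longlonglongrightarrow>
        (\<integral>\<^sup>+\<omega>. (if hit u \<omega> then ennreal (exp (u - total \<omega>)) else 0) \<partial>?C)"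
      unfolding L[OF eps_pos]
    proof (rule nn_integral_bounded_convergence[OF finite_measure_C L'm])
      show "AE \<omega> in ?C. L' (eps j) u \<omega> \<le> 1" for j
        using reg by eventually_elim (simp add: L'_eq u R_le_1)
      show "AE \<omega> in ?C. (\<lambda>j. L' (eps j) u \<omega>) \<longlonglongrightarrow>
          (if hit u \<omega> then ennreal (exp (u - total \<omega>)) else 0)"
        using reg by eventually_elim (rule L'_tendsto[OF _ u])
    qed
  qed
qed

lemma cell_measurable_pair:
  "(\<lambda>z. indicator (cell n k (fst z)) (snd z) :: ennreal) \<in> borel_measurable (lborel \<Otimes>\<^sub>M completion (P x))"
proof -
  have [measurable]: "(\<lambda>z. A (real j / real (Suc n)) (snd z)) \<in> borel_measurable (lborel \<Otimes>\<^sub>M completion (P x))" for j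
    by (rule measurable_compose[OF measurable_snd A_measurable_C]) simp
  have "(\<lambda>z. if ennreal (fst z) \<le> A (real k / real (Suc n)) (snd z) \<and>
      (\<forall>j\<in>{..<k}. \<not> ennreal (fst z) \<le> A (real j / real (Suc n)) (snd z)) then 1 else 0 :: ennreal)
      \<in> borel_measurable (lborel \<Otimes>\<^sub>M completion (P x))"
    by measurable
  moreover have "(\<lambda>z. indicator (cell n k (fst z)) (snd z) :: ennreal) =
      (\<lambda>z. if ennreal (fst z) \<le> A (real k / real (Suc n)) (snd z) \<and>
        (\<forall>j\<in>{..<k}. \<not> ennreal (fst z) \<le> A (real j / real (Suc n)) (snd z)) then 1 else 0)"
    by (auto simp: fun_eq_iff cell_def indicator_def)
  ultimately show ?thesis by simp
qed

lemma W_measurable_pair: "(\<lambda>z. W (fst z) (snd z)) \<in> borel_measurable (lborel \<Otimes>\<^sub>M completion (P x))"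
  unfolding W_def L_def V_def
  by (intro borel_measurable_liminf borel_measurable_suminf_order borel_measurable_times_ennreal
      cell_measurable_pair measurable_compose[OF measurable_snd q_Y_measurable_C] eps_pos) simp

lemma W_measurable_time [measurable]: "(\<lambda>u. W u \<omega>) \<in> borel_measurable lborel"
  using measurable_compose[OF _ W_measurable_pair[of undefined], of "\<lambda>u. (u, \<omega>)" lborel] by simp

text \<open>The change of variables \<open>u = A\<^sub>t\<close> turns \<open>\<integral> g(X\<^sub>t) dA\<^sub>t\<close> into an integral over levels \<open>u\<close>.\<close>

lemma af_integral_eq:
  assumes reg: "regular \<omega>"
  shows "af_integral X A (\<lambda>t. ext0 g (X t \<omega>)) \<omega> = (\<integral>\<^sup>+u. W u \<omega> * indicator {0<..} u \<partial>lborel)"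
proof -
  interpret continuous_clock "path \<omega>" by (rule path_clock[OF reg])
  have X: "X t \<omega> = Some (Y t \<omega>)" if "0 \<le> t" for t
    using reg that by (simp add: regular_def)
  have "(\<lambda>t. g (Y (max 0 t) \<omega>) * indicator {0<..} t) \<in> borel_measurable borel"
    using measurable_compose[OF measurable_path_Y[OF reg] g_measurable] by measurable
  also have "(\<lambda>t. g (Y (max 0 t) \<omega>) * indicator {0<..} t) = (\<lambda>t. ext0 g (X t \<omega>) * indicator {0<..} t)"
    by (auto simp: fun_eq_iff indicator_def X ext0_def)
  finally have meas: "(\<lambda>t. ext0 g (X t \<omega>) * indicator {0<..} t) \<in> borel_measurable borel" .
  have level: "(\<integral>\<^sup>+t. ext0 g (X t \<omega>) \<partial>interval_measure (\<lambda>s. enn2real (A (max 0 (min s T)) \<omega>))) =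
      (\<integral>\<^sup>+u. W u \<omega> * indicator {0<..path \<omega> T} u \<partial>lborel)" if T: "0 \<le> T" for T
  proof -
    have "(\<integral>\<^sup>+t. ext0 g (X t \<omega>) \<partial>interval_measure (\<lambda>s. path \<omega> (min s T))) =
      (\<integral>\<^sup>+u. ext0 g (X (clock \<omega> u) \<omega>) * indicator {0<..path \<omega> T} u \<partial>lborel)"
      unfolding clock_def by (rule nn_integral_clock[OF T meas])
    also have "\<dots> = (\<integral>\<^sup>+u. W u \<omega> * indicator {0<..path \<omega> T} u \<partial>lborel)"
    proof (rule nn_integral_cong)
      fix u
      show "ext0 g (X (clock \<omega> u) \<omega>) * indicator {0<..path \<omega> T} u = W u \<omega> * indicator {0<..path \<omega> T} u"
      proof (cases "u \<in> {0<..path \<omega> T}")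
        case True
        then have "hit u \<omega>" using hitI[OF reg _ T] by simp
        then show ?thesis
          using True clock_pos[OF reg, of u] by (simp add: W_eq[OF reg] X ext0_def)
      qed simp
    qed
    finally show ?thesis by (simp add: path_def)
  qed
  have "{T. 0 \<le> T \<and> ennreal T < lifetime X \<omega>} = {0..}"
    using reg by (auto simp: regular_def)
  then have "af_integral X A (\<lambda>t. ext0 g (X t \<omega>)) \<omega> = (SUP T\<in>{0..}. \<integral>\<^sup>+u. W u \<omega> * indicator {0<..path \<omega> T} u \<partial>lborel)"
    unfolding af_integral_def by (simp add: level cong: SUP_cong_simp)
  also have "\<dots> = (\<integral>\<^sup>+u. W u \<omega> * indicator {0<..} u \<partial>lborel)"
  proof (rule antisym)
    show "(SUP T\<in>{0..}. \<integral>\<^sup>+u. W u \<omega> * indicator {0<..path \<omega> T} u \<partial>lborel) \<le> (\<integral>\<^sup>+u. W u \<omega> * indicator {0<..} u \<partial>lborel)"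
      by (intro SUP_least nn_integral_mono) (auto simp: indicator_def)
    \<comment> \<open>Every level that is hit is reached by some integer time, and \<open>W\<close>
      vanishes at the others, so finite horizons exhaust the integral.\<close>
    have "W u \<omega> * indicator {0<..} u = (SUP n. W u \<omega> * indicator {0<..path \<omega> (real n)} u)" for u
    proof (cases "0 < u \<and> hit u \<omega>")
      case True
      then obtain n where "u \<le> path \<omega> (real n)" using hit_iff[OF reg] by auto
      then have "W u \<omega> * indicator {0<..} u \<le> (SUP n. W u \<omega> * indicator {0<..path \<omega> (real n)} u)"
        using True by (intro SUP_upper2[of n]) auto
      then show ?thesis by (intro antisym SUP_least) (auto simp: indicator_def)
    next
      case False
      then have "W u \<omega> * indicator {0<..} u = 0" "\<And>n. W u \<omega> * indicator {0<..path \<omega> (real n)} u = 0"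
        by (auto simp: W_eq[OF reg] indicator_def)
      then show ?thesis by (simp del: mult_eq_0_iff)
    qed
    then have "(\<integral>\<^sup>+u. W u \<omega> * indicator {0<..} u \<partial>lborel) =
      (\<integral>\<^sup>+u. (SUP n. W u \<omega> * indicator {0<..path \<omega> (real n)} u) \<partial>lborel)" by simp
    also have "\<dots> = (SUP n. \<integral>\<^sup>+u. W u \<omega> * indicator {0<..path \<omega> (real n)} u \<partial>lborel)"
    proof (rule nn_integral_monotone_convergence_SUP)
      have "path \<omega> (real i) \<le> path \<omega> (real j)" if "i \<le> j" for i j
        using that by (intro r_mono) simp
      then show "incseq (\<lambda>n u. W u \<omega> * indicator {0<..path \<omega> (real n)} u)"
        by (fastforce simp: incseq_def le_fun_def indicator_def intro: order_trans)
    qed measurable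
    also have "\<dots> \<le> (SUP T\<in>{0..}. \<integral>\<^sup>+u. W u \<omega> * indicator {0<..path \<omega> T} u \<partial>lborel)"
      by (intro SUP_least SUP_upper) simp
    finally show "(\<integral>\<^sup>+u. W u \<omega> * indicator {0<..} u \<partial>lborel) \<le>
      (SUP T\<in>{0..}. \<integral>\<^sup>+u. W u \<omega> * indicator {0<..path \<omega> T} u \<partial>lborel)" .
  qed
  finally show ?thesis .
qed

text \<open>Levels below A_\<infinity> are reached and levels above it are not; A_\<infinity>
  itself, reached or not, is Lebesgue-null. What remains is the integral of exp(u - A_\<infinity>)
  over [0, A_\<infinity>].\<close>

lemma integral_levels:
  assumes reg: "regular \<omega>"
  shows "(\<integral>\<^sup>+u. (if hit u \<omega> then ennreal (exp (u - total \<omega>)) else 0) * indicator {0<..} u \<partial>lborel) = 1 - Z \<omega>"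
proof -
  let ?a = "total \<omega>"
  have "AE u in lborel. (if hit u \<omega> then ennreal (exp (u - ?a)) else 0) * indicator {0<..} u =
    ennreal (exp (u - ?a)) * indicator {0..?a} u"
    using AE_lborel_singleton[of 0] AE_lborel_singleton[of ?a]
  proof eventually_elim
    case (elim u)
    show ?case
    proof (cases "0 < u")
      case True
      have "u \<le> ?a" if "hit u \<omega>"
        using that path_le_total[OF reg] unfolding hit_iff[OF reg True] by (meson order_trans)
      moreover have "hit u \<omega>" if "u < ?a"
      proof -
        have "ennreal u < A_total \<omega>"
          using that True A_total_eq[OF reg] by (simp add: ennreal_lessI)
        then show ?thesis unfolding A_total_def less_SUP_iff hit_def by (auto intro: less_imp_le)
      qed
      ultimately show ?thesis using True elim by (auto simp: indicator_def)
    qed (use elim in \<open>auto simp: indicator_def\<close>)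
  qed
  then have "(\<integral>\<^sup>+u. (if hit u \<omega> then ennreal (exp (u - ?a)) else 0) * indicator {0<..} u \<partial>lborel) =
      (\<integral>\<^sup>+u. ennreal (exp (u - ?a)) * indicator {0..?a} u \<partial>lborel)"
    by (rule nn_integral_cong_AE)
  also have "\<dots> = ennreal (exp (?a - ?a) - exp (0 - ?a))"
    using path_nonneg[OF reg] by (intro nn_integral_FTC_Icc) (auto intro!: derivative_eq_intros)
  also have "\<dots> = 1 - Z \<omega>"
    by (simp add: Z_eq[OF reg] ennreal_minus flip: ennreal_1)
  finally show ?thesis .
qed

text \<open>The Markov identity holds level by level under the expectation, not path by path. The
  two integrals are therefore exchanged to apply it, and exchanged back to integrate the
  exponential.\<close>

lemma Expect_af_integral:
  "Expect P x (\<lambda>\<omega>. af_integral X A (\<lambda>t. ext0 g (X t \<omega>)) \<omega>) = 1 - g x"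
proof -
  let ?C = "completion (P x)"
  interpret C: prob_space ?C by (rule prob_space_C)
  interpret pair_sigma_finite lborel ?C ..
  let ?E = "\<lambda>u \<omega>. (if hit u \<omega> then ennreal (exp (u - total \<omega>)) else 0) * indicator {0<..} u :: ennreal"
  note reg = AE_completion[OF AE_regular[of x]]
  have "case_prod (\<lambda>u \<omega>. W u \<omega> * indicator {0<..} u) \<in> borel_measurable (lborel \<Otimes>\<^sub>M ?C)"
    using W_measurable_pair by (simp add: case_prod_beta')
  note W_swap = Fubini'[OF this]
  have "(\<lambda>z. A (real j) (snd z)) \<in> borel_measurable (lborel \<Otimes>\<^sub>M ?C)" for j
    by (rule measurable_compose[OF measurable_snd A_measurable_C]) simp
  moreover have "total \<in> borel_measurable ?C" unfolding total_def[abs_def] by measurable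
  ultimately have "case_prod ?E \<in> borel_measurable (lborel \<Otimes>\<^sub>M ?C)"
    unfolding hit_def case_prod_beta' by measurable
  note E_swap = Fubini'[OF this]
  have "Expect P x (\<lambda>\<omega>. af_integral X A (\<lambda>t. ext0 g (X t \<omega>)) \<omega>) =
      (\<integral>\<^sup>+\<omega>. \<integral>\<^sup>+u. W u \<omega> * indicator {0<..} u \<partial>lborel \<partial>?C)"
    unfolding Expect_def using reg by (intro nn_integral_cong_AE) (auto elim!: eventually_mono simp: af_integral_eq)
  also have "\<dots> = (\<integral>\<^sup>+u. \<integral>\<^sup>+\<omega>. W u \<omega> * indicator {0<..} u \<partial>?C \<partial>lborel)"
    by (rule W_swap)
  also have "\<dots> = (\<integral>\<^sup>+u. \<integral>\<^sup>+\<omega>. ?E u \<omega> \<partial>?C \<partial>lborel)"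
  proof (rule nn_integral_cong)
    fix u show "(\<integral>\<^sup>+\<omega>. W u \<omega> * indicator {0<..} u \<partial>?C) = (\<integral>\<^sup>+\<omega>. ?E u \<omega> \<partial>?C)"
      by (cases "0 < u") (simp_all add: integral_W)
  qed
  also have "\<dots> = (\<integral>\<^sup>+\<omega>. \<integral>\<^sup>+u. ?E u \<omega> \<partial>lborel \<partial>?C)"
    by (rule E_swap[symmetric])
  also have "\<dots> = (\<integral>\<^sup>+\<omega>. 1 - Z \<omega> \<partial>?C)"
    using reg by (intro nn_integral_cong_AE) (auto elim!: eventually_mono simp: integral_levels)
  also have "\<dots> = (\<integral>\<^sup>+\<omega>. 1 \<partial>?C) - (\<integral>\<^sup>+\<omega>. Z \<omega> \<partial>?C)"
  proof (rule nn_integral_diff)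
    show "(\<integral>\<^sup>+\<omega>. Z \<omega> \<partial>?C) \<noteq> \<infinity>"
      using g_le_1[of x] by (auto simp: g_def nn_integral_completion top_unique)
  qed (auto simp: Z_def exp_neg_le_1)
  also have "\<dots> = 1 - g x"
    using C.emeasure_space_1 by (simp add: g_def nn_integral_completion)
  finally show ?thesis .
qed

end

section \<open>The Revuz correspondence and the potential identity\<close>

text \<open>The exhausting sets of a smooth measure have finite mass. This licenses Fubini for
  \<mu>, which need not be finite on compact sets.\<close>

lemma sigma_finite_S1:
  assumes "\<mu> \<in> S1 P X p"
  shows "sets \<mu> = sets borel" "sigma_finite_measure \<mu>"
proof -
  obtain B where sets: "sets \<mu> = sets borel" and B: "\<And>n::nat. B n \<in> sets borel" "(\<Union>n. B n) = UNIV"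
    "\<And>n. density \<mu> (indicator (B n)) \<in> S00 p"
    using assms by (auto simp: S1_def)
  have sp: "space \<mu> = UNIV" using sets_eq_imp_space_eq[OF sets] by simp
  have "emeasure \<mu> (B n) \<noteq> \<infinity>" for n
  proof -
    have "emeasure (density \<mu> (indicator (B n))) UNIV < \<infinity>" using B(3) by (simp add: S00_def)
    moreover have "emeasure (density \<mu> (indicator (B n))) UNIV = emeasure \<mu> (B n)"
      using B(1)[of n] sets sets.top[of \<mu>] by (subst emeasure_density) (auto simp: sp)
    ultimately show ?thesis by simp
  qed
  then show "sigma_finite_measure \<mu>"
    using B sets sp by (intro sigma_finite_measure.intro exI[of _ "range B"]) auto
  show "sets \<mu> = sets borel" by (fact sets)
qed

locale revuz_pair = finite_additive_functional P X \<theta> m p A \<Lambda>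
  for P :: "'a::{metric_space, second_countable_topology} \<Rightarrow> 'w measure"
    and X :: "real \<Rightarrow> 'w \<Rightarrow> 'a option"
    and \<theta> :: "real \<Rightarrow> 'w \<Rightarrow> 'w" and m p
    and A :: "real \<Rightarrow> 'w \<Rightarrow> ennreal" and \<Lambda> :: "'w set" +
  fixes \<mu> :: "'a measure"
  assumes sets_\<mu> [simp, measurable_cong]: "sets \<mu> = sets borel"
    and sigma_finite_\<mu>: "sigma_finite_measure \<mu>"
    and revuz: "revuz_correspondence m P X \<mu> A"
begin

lemma green_pair [measurable]: "(\<lambda>z. green p 0 (fst z) (snd z)) \<in> borel_measurable (borel \<Otimes>\<^sub>M borel)"
  using density by (simp add: transition_density_def case_prod_beta')

lemma green_sym: "green p 0 x y = green p 0 y x"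
  using density by (simp add: transition_density_def)

lemma resolvent_green: "h \<in> borel_measurable borel \<Longrightarrow> resolvent P X 0 h x = (\<integral>\<^sup>+y. green p 0 x y * h y \<partial>m)"
  using density by (simp add: transition_density_def)

lemma excessive_green: "excessive P X 0 (\<lambda>x. green p 0 x y)"
  using density by (simp add: transition_density_def)

lemma green_measurable [measurable]:
  "(\<lambda>y. green p 0 x y) \<in> borel_measurable borel" "(\<lambda>x. green p 0 x y) \<in> borel_measurable borel"
  using excessive_green[of x] excessive_green[of y] by (simp_all add: excessive_def green_sym[of x])

definition U :: "'a \<Rightarrow> ennreal" where
  "U x = (\<integral>\<^sup>+y. green p 0 x y * g y \<partial>\<mu>)"

lemma U_measurable [measurable]: "U \<in> borel_measurable borel"
proof -
  interpret sigma_finite_measure \<mu> by (rule sigma_finite_\<mu>)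
  have "(\<lambda>z. green p 0 (fst z) (snd z) * g (snd z)) \<in> borel_measurable (borel \<Otimes>\<^sub>M \<mu>)"
    by measurable
  then show ?thesis unfolding U_def[abs_def]
    by (intro borel_measurable_nn_integral) (simp add: case_prod_beta')
qed

text \<open>The correspondence at \<alpha> = 0 with f = \<open>g\<close> is tested against
  indicators; symmetry of the kernel and Fubini move the resolvent from the indicator onto
  \<open>g\<close>. Uniqueness of densities then gives the equality.\<close>

lemma AE_U: "AE x in m. 1 - g x = U x"
proof -
  interpret m: sigma_finite_measure m by (rule sigma_finite_m)
  interpret \<mu>: sigma_finite_measure \<mu> by (rule sigma_finite_\<mu>)
  interpret pair_sigma_finite m \<mu> ..
  have "density m (\<lambda>x. 1 - g x) = density m U"
  proof (rule measure_eqI)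
    fix B assume "B \<in> sets (density m (\<lambda>x. 1 - g x))"
    then have B[measurable]: "B \<in> sets borel" by simp
    let ?h = "indicator B :: 'a \<Rightarrow> ennreal"
    have "emeasure (density m (\<lambda>x. 1 - g x)) B = (\<integral>\<^sup>+x. (1 - g x) * ?h x \<partial>m)"
      by (subst emeasure_density) auto
    also have "\<dots> = (\<integral>\<^sup>+x. Expect P x
        (\<lambda>\<omega>. af_integral X A (\<lambda>t. ennreal (exp (- 0 * t)) * ext0 g (X t \<omega>)) \<omega>) * ?h x \<partial>m)"
      by (simp add: Expect_af_integral)
    also have "\<dots> = (\<integral>\<^sup>+x. resolvent P X 0 ?h x * g x \<partial>\<mu>)"
      using revuz unfolding revuz_correspondence_def by (elim allE[of _ 0] impE ballE[of _ _ g] ballE[of _ _ ?h]) auto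
    also have "\<dots> = (\<integral>\<^sup>+x. (\<integral>\<^sup>+y. green p 0 y x * ?h y * g x \<partial>m) \<partial>\<mu>)"
      by (intro nn_integral_cong, subst resolvent_green)
        (auto simp: green_sym nn_integral_multc)
    also have "\<dots> = (\<integral>\<^sup>+y. (\<integral>\<^sup>+x. green p 0 y x * ?h y * g x \<partial>\<mu>) \<partial>m)"
      by (rule Fubini') (simp add: case_prod_beta')
    also have "\<dots> = (\<integral>\<^sup>+y. U y * ?h y \<partial>m)"
    proof (rule nn_integral_cong)
      fix y
      have "(\<integral>\<^sup>+x. green p 0 y x * ?h y * g x \<partial>\<mu>) = (\<integral>\<^sup>+x. green p 0 y x * g x * ?h y \<partial>\<mu>)"
        by (intro nn_integral_cong) (simp add: ac_simps)
      also have "\<dots> = U y * ?h y" unfolding U_def by (rule nn_integral_multc) simp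
      finally show "(\<integral>\<^sup>+x. green p 0 y x * ?h y * g x \<partial>\<mu>) = U y * ?h y" .
    qed
    also have "\<dots> = emeasure (density m U) B"
      by (subst emeasure_density) auto
    finally show "emeasure (density m (\<lambda>x. 1 - g x)) B = emeasure (density m U) B" .
  qed simp
  then show ?thesis by (intro m.density_unique) auto
qed

text \<open>Two expressions for p_t U to be compared as t tends to 0: one through the excessive
  kernels, one through the a.e. identity, which suffices at positive times.\<close>

lemma trans_U:
  assumes t: "0 < t"
  shows "trans_nn P X t U x = (\<integral>\<^sup>+z. trans_nn P X t (\<lambda>x. green p 0 x z) x * g z \<partial>\<mu>)"
    "trans_nn P X t U x = 1 - q t x"
proof -
  interpret P: prob_space "P x" by (rule prob_space_P)
  interpret \<mu>: sigma_finite_measure \<mu> by (rule sigma_finite_\<mu>)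
  interpret pair_sigma_finite \<mu> "P x" ..
  have Y[measurable]: "Y t \<in> P x \<rightarrow>\<^sub>M borel" using t by (simp add: measurable_Y0)
  have "trans_nn P X t U x = (\<integral>\<^sup>+\<omega>. \<integral>\<^sup>+z. green p 0 (Y t \<omega>) z * g z \<partial>\<mu> \<partial>P x)"
    using t by (simp add: trans_nn_eq U_def)
  also have "\<dots> = (\<integral>\<^sup>+z. \<integral>\<^sup>+\<omega>. green p 0 (Y t \<omega>) z * g z \<partial>P x \<partial>\<mu>)"
  proof (rule Fubini')
    have "(\<lambda>w. green p 0 (Y t (snd w)) (fst w)) \<in> borel_measurable (\<mu> \<Otimes>\<^sub>M P x)"
      using measurable_compose[OF _ green_pair, of "\<lambda>w. (Y t (snd w), fst w)" "\<mu> \<Otimes>\<^sub>M P x"] by simp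
    then show "(\<lambda>(z, \<omega>). green p 0 (Y t \<omega>) z * g z) \<in> borel_measurable (\<mu> \<Otimes>\<^sub>M P x)"
      by (simp add: case_prod_beta')
  qed
  also have "\<dots> = (\<integral>\<^sup>+z. trans_nn P X t (\<lambda>x. green p 0 x z) x * g z \<partial>\<mu>)"
    using t by (intro nn_integral_cong) (simp add: trans_nn_eq nn_integral_multc)
  finally show "trans_nn P X t U x = (\<integral>\<^sup>+z. trans_nn P X t (\<lambda>x. green p 0 x z) x * g z \<partial>\<mu>)" .
  have ae: "AE y in m. U y = 1 - G y" using AE_U AE_G by eventually_elim simp
  have "trans_nn P X t U x = (\<integral>\<^sup>+\<omega>. 1 - G (Y t \<omega>) \<partial>P x)"
    using AE_Y[OF t ae, of x] t by (auto simp: trans_nn_eq intro!: nn_integral_cong_AE)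
  also have "\<dots> = (\<integral>\<^sup>+\<omega>. 1 \<partial>P x) - (\<integral>\<^sup>+\<omega>. G (Y t \<omega>) \<partial>P x)"
  proof (rule nn_integral_diff)
    have "q t x \<le> 1" using t by (rule q_le_1)
    then show "(\<integral>\<^sup>+\<omega>. G (Y t \<omega>) \<partial>P x) \<noteq> \<infinity>"
      using t by (auto simp: q_def trans_nn_eq top_unique)
  qed (auto simp: G_le_1)
  finally show "trans_nn P X t U x = 1 - q t x"
    using t P.emeasure_space_1 by (simp add: q_def trans_nn_eq)
qed

lemma eps_at_right: "filterlim eps (at_right 0) sequentially"
  using eps_tendsto eps_pos by (intro tendsto_imp_filterlim_at_right) auto

text \<open>The two sides agree \<open>m\<close>-a.e. by the Revuz correspondence, and both are excessive, so the
  absolute continuity of \<open>p\<^sub>t\<close> yields the identity everywhere.\<close>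

lemma U_eq: "U x = 1 - g x"
proof (rule antisym)
  have lim: "(\<lambda>j. trans_nn P X (eps j) U x) \<longlonglongrightarrow> 1 - g x"
    unfolding trans_U(2)[OF eps_pos] using g_le_1[of x]
    by (intro tendsto_diff_ennreal tendsto_const q_tendsto) (auto simp: top_unique)
  have exc: "(\<lambda>j. trans_nn P X (eps j) (\<lambda>x. green p 0 x z) x) \<longlonglongrightarrow> green p 0 x z"
    "trans_nn P X (eps j) (\<lambda>x. green p 0 x z) x \<le> green p 0 x z" for z j
  proof -
    have "((\<lambda>t. trans_nn P X t (\<lambda>x. green p 0 x z) x) \<longlongrightarrow> green p 0 x z) (at_right 0)"
      using excessive_green[of z] by (simp add: excessive_def)
    from filterlim_compose[OF this eps_at_right]
    show "(\<lambda>j. trans_nn P X (eps j) (\<lambda>x. green p 0 x z) x) \<longlonglongrightarrow> green p 0 x z" .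
    show "trans_nn P X (eps j) (\<lambda>x. green p 0 x z) x \<le> green p 0 x z"
      using excessive_green[of z] eps_pos[of j] by (simp add: excessive_def)
  qed
  have meas: "(\<lambda>z. trans_nn P X (eps j) (\<lambda>x. green p 0 x z) x) \<in> borel_measurable \<mu>" for j
  proof -
    interpret P: prob_space "P x" by (rule prob_space_P)
    have [measurable]: "Y (eps j) \<in> P x \<rightarrow>\<^sub>M borel" using eps_pos[of j] by (simp add: measurable_Y0)
    have "(\<lambda>w. green p 0 (Y (eps j) (snd w)) (fst w)) \<in> borel_measurable (\<mu> \<Otimes>\<^sub>M P x)"
      using measurable_compose[OF _ green_pair, of "\<lambda>w. (Y (eps j) (snd w), fst w)" "\<mu> \<Otimes>\<^sub>M P x"] by simp
    then show ?thesis
      using eps_pos[of j] by (auto simp: trans_nn_eq case_prod_beta' intro!: P.borel_measurable_nn_integral)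
  qed
  \<comment> \<open>Excessivity is used twice: convergence of the kernels for each z gives this
    inequality by Fatou, and their domination by the Green kernel gives the opposite one.\<close>
  have "U x = (\<integral>\<^sup>+z. liminf (\<lambda>j. trans_nn P X (eps j) (\<lambda>x. green p 0 x z) x * g z) \<partial>\<mu>)"
    unfolding U_def
  proof (rule nn_integral_cong)
    fix z
    have "g z < \<top>" using g_le_1[of z] by (auto simp: less_top[symmetric] top_unique)
    then have "(\<lambda>j. trans_nn P X (eps j) (\<lambda>x. green p 0 x z) x * g z) \<longlonglongrightarrow> green p 0 x z * g z"
      unfolding mult.commute[of _ "g z"] by (intro ennreal_tendsto_cmult exc)
    then show "green p 0 x z * g z = liminf (\<lambda>j. trans_nn P X (eps j) (\<lambda>x. green p 0 x z) x * g z)"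
      by (intro lim_imp_Liminf[symmetric]) auto
  qed
  also have "\<dots> \<le> liminf (\<lambda>j. trans_nn P X (eps j) U x)"
    unfolding trans_U(1)[OF eps_pos] using meas by (intro nn_integral_liminf) simp
  also have "\<dots> = 1 - g x" using lim by (intro lim_imp_Liminf) auto
  finally show "U x \<le> 1 - g x" .
  have "trans_nn P X (eps j) U x \<le> U x" for j
    unfolding trans_U(1)[OF eps_pos] U_def by (intro nn_integral_mono mult_right_mono exc) simp
  then show "1 - g x \<le> U x" using lim by (intro LIMSEQ_le_const2) auto
qed

lemma green_finite:
  assumes lim: "(ext0 U \<longlongrightarrow> 0) (atin cpt_top None)"
    and K: "\<And>K. compact K \<Longrightarrow> (\<integral>\<^sup>+y\<in>K. green p 0 x y \<partial>\<mu>) < \<infinity>"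
  shows "(\<integral>\<^sup>+y. green p 0 x y \<partial>\<mu>) < \<infinity>"
proof -
  \<comment> \<open>Any constant strictly between 0 and 1 would serve: with g = 1 - U at every
    point, a bound on U below 1 off \<open>K\<close> keeps g away from 0 there. The factor 2 below
    is the reciprocal of 1 - 1/2.\<close>
  have "(0::ennreal) < ennreal (1/2)" by (simp only: ennreal_less_zero_iff)
  from tendsto_cemetery_compact[OF lim this] obtain K where K': "compact K" "\<And>y. y \<notin> K \<Longrightarrow> U y < ennreal (1/2)"
    by blast
  have half: "1 \<le> 2 * g y" if "y \<notin> K" for y
  proof -
    obtain r where r: "g y = ennreal r" "0 \<le> r" "r \<le> 1"
      using g_le_1[of y] by (cases "g y") (auto simp: top_unique)
    have "1 - g y = ennreal (1 - r)" using r by (simp add: ennreal_minus flip: ennreal_1)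
    then have "ennreal (1 - r) < ennreal (1/2)" using K'(2)[OF that] by (simp only: U_eq)
    then have "1 - r < 1/2" using ennreal_less_iff[of "1 - r" "1/2"] r(3) by (simp only: diff_ge_0_iff_ge)
    then have "1 \<le> 2 * r" "g y = ennreal r" "0 \<le> r" using r by simp_all
    then show ?thesis
      by (simp add: ennreal_mult[symmetric] flip: ennreal_1 ennreal_numeral)
  qed
  have [measurable]: "K \<in> sets borel" using K'(1) by (rule borel_compact)
  have "(\<integral>\<^sup>+y. green p 0 x y \<partial>\<mu>) \<le> (\<integral>\<^sup>+y. green p 0 x y * indicator K y + 2 * (green p 0 x y * g y) \<partial>\<mu>)"
  proof (rule nn_integral_mono)
    fix y
    have "green p 0 x y * 1 \<le> green p 0 x y * (2 * g y)" if "y \<notin> K"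
      using half[OF that] by (rule mult_left_mono) simp
    then show "green p 0 x y \<le> green p 0 x y * indicator K y + 2 * (green p 0 x y * g y)"
      by (cases "y \<in> K") (auto simp: ac_simps)
  qed
  also have "\<dots> = (\<integral>\<^sup>+y\<in>K. green p 0 x y \<partial>\<mu>) + 2 * U x"
    unfolding U_def by (simp add: nn_integral_add nn_integral_cmult)
  also have "\<dots> < \<infinity>"
  proof -
    have "U x \<le> 1" by (simp add: U_eq)
    also have "(1::ennreal) < \<top>" by simp
    finally have "2 * U x < \<infinity>" by (simp add: ennreal_mult_less_top)
    then show ?thesis using K[OF K'(1)] by simp
  qed
  finally show ?thesis .
qed

end

theorem theorem3p4:
  fixes m :: "'a::{metric_space, second_countable_topology} measure"
    and P :: "'a \<Rightarrow> 'w measure"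
    and X :: "real \<Rightarrow> 'w \<Rightarrow> 'a option"
    and \<theta> :: "real \<Rightarrow> 'w \<Rightarrow> 'w"
    and \<E>\<^sub>c :: "('a \<Rightarrow> real) \<Rightarrow> ('a \<Rightarrow> real) \<Rightarrow> real"
    and J :: "('a \<times> 'a) measure"
    and k :: "'a measure"
    and p :: "real \<Rightarrow> 'a \<Rightarrow> 'a \<Rightarrow> ennreal"
    and \<mu> :: "'a measure"
    and A :: "real \<Rightarrow> 'w \<Rightarrow> ennreal"
  assumes "locally_compact_space (euclidean :: 'a topology)"
    and "\<not> compact (UNIV :: 'a set)"
    and "radon_measure m" and "full_support m"
    and "hunt_process P X \<theta>" and "m_symmetric m P X"
    and "regular_form m P X"
    and "beurling_deny m P X \<E>\<^sub>c J k" and "k = null_measure borel"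
    and "transient m P X"
    and "irreducible_process m P X"
    and "strong_feller P X"
    and "transition_density m P X p"
    and "\<mu> \<in> S1 P X p"
    and "A \<in> strict_pcaf P X \<theta>"
    and "revuz_correspondence m P X \<mu> A"
    and "conservative P X"
    and "\<exists>c. \<forall>x. Prob P x {\<omega>. af_at A \<infinity> \<omega> < \<infinity>} = c"
    and "(ext0 (\<lambda>x. \<integral>\<^sup>+y. green p 0 x y * laplace_total P X A y \<partial>\<mu>) \<longlongrightarrow> 0) (atin cpt_top None)"
    and "\<exists>x\<^sub>0. (\<integral>\<^sup>+y. green p 0 x\<^sub>0 y \<partial>\<mu>) = \<infinity> \<and>
           (\<forall>K. compact K \<longrightarrow> (\<integral>\<^sup>+y\<in>K. green p 0 x\<^sub>0 y \<partial>\<mu>) < \<infinity>)"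
  shows "\<forall>x. Prob P x {\<omega>. af_at A \<infinity> \<omega> = \<infinity>} = 1"
proof -
  interpret hunt_process P X \<theta> by fact
  interpret strong_feller_hunt_process P X \<theta> m p
  proof (intro strong_feller_hunt_process.intro conservative_hunt_process.intro
      conservative_hunt_process_axioms.intro strong_feller_hunt_process_axioms.intro)
    show "sigma_finite_measure m" using assms(1,3) by (rule sigma_finite_radon_measure)
    show "sets m = sets borel" using assms(3) by (simp add: radon_measure_def)
    show "emeasure m UNIV \<noteq> 0" using assms(4) by (force simp: full_support_def)
  qed (fact assms)+
  obtain \<Lambda> where "\<Lambda> \<in> sets (completed_filtration P X \<infinity>)" "\<forall>x. Prob P x \<Lambda> = 1"
    "\<forall>t\<ge>0. \<theta> t ` \<Lambda> \<subseteq> \<Lambda>"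
    "\<forall>\<omega>\<in>\<Lambda>. A 0 \<omega> = 0 \<and> continuous_on {0..} (\<lambda>t. A t \<omega>) \<and>
      (\<forall>t\<ge>0. ennreal t < lifetime X \<omega> \<longrightarrow> A t \<omega> < \<infinity>) \<and>
      (\<forall>t\<ge>0. lifetime X \<omega> \<le> ennreal t \<longrightarrow> A t \<omega> = af_at A (lifetime X \<omega>) \<omega>) \<and>
      (\<forall>t\<ge>0. \<forall>s\<ge>0. A (t + s) \<omega> = A t \<omega> + A s (\<theta> t \<omega>))"
    and "\<forall>t\<ge>0. A t \<in> borel_measurable (completed_filtration P X (ennreal t))"
    using assms(15)[unfolded strict_pcaf_def mem_Collect_eq] by (elim conjE bexE) (rule that)
  then have "additive_functional_axioms P X \<theta> A \<Lambda>"
    unfolding additive_functional_axioms_def by (auto simp: image_subset_iff)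
  then interpret additive_functional P X \<theta> m p A \<Lambda>
    by (intro additive_functional.intro strong_feller_hunt_process_axioms)
  obtain c where "\<And>x. Prob P x {\<omega>. af_at A \<infinity> \<omega> < \<infinity>} = c" using assms(18) by auto
  from total_infinite_or_finite[OF this] show ?thesis
  proof
    assume "\<forall>x. AE \<omega> in P x. A_total \<omega> < \<infinity>"
    then interpret finite_additive_functional P X \<theta> m p A \<Lambda> by unfold_locales simp
    interpret revuz_pair P X \<theta> m p A \<Lambda> \<mu>
      by (intro revuz_pair.intro finite_additive_functional_axioms revuz_pair_axioms.intro
          sigma_finite_S1[OF assms(14)] assms(16))
    have "(ext0 U \<longlongrightarrow> 0) (atin cpt_top None)"
      using assms(19) by (simp add: U_def[abs_def] laplace_total_eq)
    from green_finite[OF this] assms(20) have False by fastforce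
    then show ?thesis ..
  qed simp
qed

end
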